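(* Let $p$ be a prime and let $G$ be a $2$-tuple regular finite $p$-group. Then $G$ is homocyclic, or $G$ is isomorphic to $Q_8$ or to $G_{64}$.
   Context: A finite group $G$ is $2$-tuple regular if for all pairs $(g_1,g_2),(h_1,h_2)\in G^2$ (entries may coincide) for which $g_1\mapsto h_1, g_2\mapsto h_2$ defines an isomorphism $\langle g_1,g_2\rangle\to\langle h_1,h_2\rangle$, there is a bijection $\Psi\colon G\to G$ such that for every $g\in G$ the assignment $g_1\mapsto h_1,g_2\mapsto h_2,g\mapsto\Psi(g)$ defines an isomorphism $\langle g_1,g_2,g\rangle\to\langle h_1,h_2,\Psi(g)\rangle$. A $p$-group is homocyclic if it is a direct product of copies of $C_{p^m}$ for a single $m$. $G_{64}$ is the Suzuki 2-group of order 64 (a Sylow 2-subgroup of $\mathrm{PSU}(3,4)$). *)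

theory Defs
  imports "HOL-Algebra.Algebra"
begin

definition gen_sub :: "('a, 'b) monoid_scheme \<Rightarrow> 'a list \<Rightarrow> ('a, 'b) monoid_scheme" where
  "gen_sub G xs = G\<lparr>carrier := generate G (set xs)\<rparr>"

definition assign_iso :: "('a, 'b) monoid_scheme \<Rightarrow> 'a list \<Rightarrow> 'a list \<Rightarrow> bool" where
  "assign_iso G xs ys \<longleftrightarrow> length xs = length ys \<and>
     (\<exists>\<phi>. \<phi> \<in> iso (gen_sub G xs) (gen_sub G ys) \<and> (\<forall>i < length xs. \<phi> (xs ! i) = ys ! i))"

definition two_tuple_regular :: "('a, 'b) monoid_scheme \<Rightarrow> bool" where
  "two_tuple_regular G \<longleftrightarrow>
     (\<forall>g1 \<in> carrier G. \<forall>g2 \<in> carrier G. \<forall>h1 \<in> carrier G. \<forall>h2 \<in> carrier G.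
        assign_iso G [g1, g2] [h1, h2] \<longrightarrow>
        (\<exists>\<Psi>. bij_betw \<Psi> (carrier G) (carrier G) \<and>
             (\<forall>g \<in> carrier G. assign_iso G [g1, g2, g] [h1, h2, \<Psi> g])))"

definition finite_p_group :: "nat \<Rightarrow> ('a, 'b) monoid_scheme \<Rightarrow> bool" where
  "finite_p_group p G \<longleftrightarrow> group G \<and> finite (carrier G) \<and> (\<exists>n. card (carrier G) = p ^ n)"

definition homocyclic_model :: "nat \<Rightarrow> nat \<Rightarrow> nat \<Rightarrow> (nat \<Rightarrow> int) monoid" where
  "homocyclic_model p m k =
     \<lparr>carrier = {f. (\<forall>i<k. f i \<in> carrier (integer_mod_group (p ^ m))) \<and> (\<forall>i. k \<le> i \<longrightarrow> f i = 0)},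
      monoid.mult = (\<lambda>f g i. if i < k then f i \<otimes>\<^bsub>integer_mod_group (p ^ m)\<^esub> g i else 0),
      one = (\<lambda>i. 0)\<rparr>"

definition homocyclic :: "nat \<Rightarrow> ('a, 'b) monoid_scheme \<Rightarrow> bool" where
  "homocyclic p G \<longleftrightarrow> (\<exists>m k. G \<cong> homocyclic_model p m k)"

text \<open>Element (s, u): sign s (True = negative), u = 0,1,2,3 stands for 1, i, j, k.\<close>
definition q8_neg :: "nat \<Rightarrow> nat \<Rightarrow> bool" where
  "q8_neg u v \<longleftrightarrow> (u = v \<and> u \<noteq> 0) \<or> (u, v) \<in> {(2, 1), (3, 2), (1, 3)}"

definition Q8 :: "(bool \<times> nat) monoid" where
  "Q8 = \<lparr>carrier = {(s, u). u < 4},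
         monoid.mult = (\<lambda>(s, u) (t, v). (s \<noteq> (t \<noteq> q8_neg u v), xor u v)),
         one = (False, 0)\<rparr>"

section \<open>The Suzuki 2-group G_64: Sylow 2-subgroup of PSU(3,4) = SU(3,4)\<close>

text \<open>GF(16) = GF(2)[x]/(x^4+x+1), elements encoded as naturals below 16 (bit vectors).\<close>
definition gf16_red :: "nat \<Rightarrow> nat \<Rightarrow> nat" where
  "gf16_red k r = (if bit r k then xor r (push_bit (k - 4) 19) else r)"

definition gf16_mul :: "nat \<Rightarrow> nat \<Rightarrow> nat" where
  "gf16_mul a b = gf16_red 4 (gf16_red 5 (gf16_red 6
     (xor (xor (if bit b 0 then a else 0) (if bit b 1 then push_bit 1 a else 0))
          (xor (if bit b 2 then push_bit 2 a else 0) (if bit b 3 then push_bit 3 a else 0)))))"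

definition gf16_pow :: "nat \<Rightarrow> nat \<Rightarrow> nat" where
  "gf16_pow a n = (gf16_mul a ^^ n) 1"

text \<open>Upper unitriangular matrices [[1, a, b], [0, 1, a^4], [0, 0, 1]] over GF(16) in SU(3,4)
  (unitary w.r.t. the antidiagonal Hermitian form): condition b + b^4 = a^5.\<close>
definition G64 :: "(nat \<times> nat) monoid" where
  "G64 = \<lparr>carrier = {(a, b). a < 16 \<and> b < 16 \<and> xor b (gf16_pow b 4) = gf16_pow a 5},
          monoid.mult = (\<lambda>(a, b) (c, d). (xor a c, xor (xor b d) (gf16_mul a (gf16_pow c 4)))),
          one = (0, 0)\<rparr>"

end

theory Submission
  imports Defs
begin

text \<open>Two-tuple regularity is used only for pairs \<open>(x, 1)\<close>, \<open>(y, 1)\<close> with \<open>x\<close>, \<open>y\<close> of the same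
  order, and for pairs \<open>(x, z)\<close>, \<open>(x, w)\<close> with \<open>z\<close>, \<open>w\<close> central of order \<open>p\<close> outside \<open>\<langle>x\<rangle>\<close>.
  The first kind shows that the center consists of the elements of order dividing some \<open>p\<^bsup>s\<^esup>\<close> and
  that every element is a power of one of maximal order \<open>p\<^bsup>e\<^esup>\<close>; an abelian group of this sort is
  homocyclic. Otherwise commutators of elements of order \<open>p\<^bsup>s+1\<^esup>\<close> lie in the central subgroup
  \<open>V = {z. z\<^bsup>p\<^esup> = 1}\<close>. The second kind shows that a subgroup of \<open>V\<close> definable from \<open>x\<close> is contained
  in \<open>\<langle>x\<rangle>\<close> or equal to \<open>V\<close>. If \<open>x \<mapsto> x\<^bsup>p^s\<^esup>\<close> is a homomorphism on the elements of order at most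
  \<open>p\<^bsup>s+1\<^esup>\<close>, then the commutators of these elements with a fixed \<open>y\<close> do not exhaust \<open>V\<close>, since a
  surjective map on the finite set \<open>V\<close> is injective; hence they lie in \<open>\<langle>y\<rangle>\<close>, and comparing two
  choices of \<open>y\<close> gives a contradiction. Hence \<open>p = 2\<close>, \<open>s = 1\<close>, \<open>e = 2\<close>.

  Then all squares are central. Either \<open>[x, G] \<subseteq> \<langle>x\<^sup>2\<rangle>\<close> for all \<open>x\<close>, which forces the quaternion
  group, or \<open>[x, G] = V\<close> for all noncentral \<open>x\<close>. In the latter case counting the pairs with
  \<open>x\<^sup>2 = y\<^sup>2\<close> gives \<open>|G| = q\<^sup>3\<close> for \<open>q = |V|\<close>. The \<open>q\<^sup>2\<close> elements \<open>g\<close> with \<open>[x, g] = x\<^sup>2\<close> take each value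
  \<open>g\<^sup>2\<close> in \<open>V\<close> other than \<open>1\<close> and \<open>x\<^sup>2\<close> equally often, and at least \<open>2q\<close> times because \<open>g \<mapsto> gx\<close>
  preserves the square; so \<open>q = 4\<close>, and the relations between suitable generators are determined.\<close>

section \<open>Words and transfer of their equations\<close>

text \<open>A bijective homomorphism out of \<open>H\<close> can be inverted as soon as products of
  \<open>H\<close> stay in \<open>H\<close>. So the concrete models can be mapped into the given
  group without first proving that they are groups.\<close>

lemma is_iso_symI:
  assumes \<phi>: "\<phi> \<in> iso H G"
    and closed: "\<And>x y. x \<in> carrier H \<Longrightarrow> y \<in> carrier H \<Longrightarrow> x \<otimes>\<^bsub>H\<^esub> y \<in> carrier H"
  shows "G \<cong> H"
proof -
  let ?\<psi> = "inv_into (carrier H) \<phi>"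
  have bij: "bij_betw \<phi> (carrier H) (carrier G)" and hom: "\<phi> \<in> hom H G"
    using \<phi> by (auto simp: iso_def)
  have inj: "inj_on \<phi> (carrier H)" and im: "\<phi> ` carrier H = carrier G"
    using bij by (auto simp: bij_betw_def)
  have "?\<psi> (a \<otimes>\<^bsub>G\<^esub> b) = ?\<psi> a \<otimes>\<^bsub>H\<^esub> ?\<psi> b" if "a \<in> carrier G" "b \<in> carrier G" for a b
  proof -
    have ab: "?\<psi> a \<in> carrier H" "?\<psi> b \<in> carrier H" "\<phi> (?\<psi> a) = a" "\<phi> (?\<psi> b) = b"
      using that im by (auto simp: inv_into_into f_inv_into_f)
    have "\<phi> (?\<psi> a \<otimes>\<^bsub>H\<^esub> ?\<psi> b) = a \<otimes>\<^bsub>G\<^esub> b"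
      using hom_mult[OF hom ab(1,2)] ab by simp
    then show ?thesis
      using inv_into_f_f[OF inj closed[OF ab(1,2)]] by simp
  qed
  then have "?\<psi> \<in> hom G H"
    using bij_betw_inv_into[OF bij] by (auto simp: hom_def bij_betw_def)
  then show ?thesis
    using bij_betw_inv_into[OF bij] by (auto simp: is_iso_def iso_def)
qed

text \<open>Group words in three letters. Regularity transports equations between values of such
  words, and this syntax lets one statement cover every equation used later.\<close>

datatype wd = X1 | X2 | X3 | One | Mul wd wd | Inv wd | Pow wd nat

primrec wval :: "('a, 'b) monoid_scheme \<Rightarrow> 'a \<Rightarrow> 'a \<Rightarrow> 'a \<Rightarrow> wd \<Rightarrow> 'a" where
  "wval G a b c X1 = a"
| "wval G a b c X2 = b"
| "wval G a b c X3 = c"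
| "wval G a b c One = \<one>\<^bsub>G\<^esub>"
| "wval G a b c (Mul v w) = wval G a b c v \<otimes>\<^bsub>G\<^esub> wval G a b c w"
| "wval G a b c (Inv w) = inv\<^bsub>G\<^esub> wval G a b c w"
| "wval G a b c (Pow w n) = wval G a b c w [^]\<^bsub>G\<^esub> n"

definition center :: "('a, 'b) monoid_scheme \<Rightarrow> 'a set" where
  "center G = {x \<in> carrier G. \<forall>g \<in> carrier G. x \<otimes>\<^bsub>G\<^esub> g = g \<otimes>\<^bsub>G\<^esub> x}"

context group
begin

lemma nat_pow_in_generate: "x \<in> generate G A \<Longrightarrow> x [^] (n::nat) \<in> generate G A"
  by (induction n) (auto intro: generate.one generate.eng)

lemma inv_in_generate:
  assumes "A \<subseteq> carrier G" "x \<in> generate G A"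
  shows "inv x \<in> generate G A"
  using generate_m_inv_closed[OF assms] .

lemma wval_in_generate:
  assumes "a \<in> carrier G" "b \<in> carrier G" "c \<in> carrier G"
  shows "wval G a b c w \<in> generate G {a, b, c}"
proof (induction w)
  case (Inv w)
  then show ?case using assms inv_in_generate[of "{a, b, c}"] by simp
qed (auto intro: generate.incl generate.one generate.eng nat_pow_in_generate)

text \<open>The isomorphism carries the value of each word to the value of the same word at the new
  letters; being injective, it preserves and reflects equality.\<close>

lemma wval_eq_transfer:
  assumes in_G: "a \<in> carrier G" "b \<in> carrier G" "c \<in> carrier G"
      "a' \<in> carrier G" "b' \<in> carrier G" "c' \<in> carrier G"
    and iso: "assign_iso G [a, b, c] [a', b', c']"
  shows "wval G a b c s = wval G a b c t \<longleftrightarrow> wval G a' b' c' s = wval G a' b' c' t"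
proof -
  let ?H = "generate G {a, b, c}" and ?K = "generate G {a', b', c'}"
  obtain \<phi> where \<phi>: "\<phi> \<in> iso (G\<lparr>carrier := ?H\<rparr>) (G\<lparr>carrier := ?K\<rparr>)"
    and nth: "\<forall>i < 3. \<phi> ([a, b, c] ! i) = [a', b', c'] ! i"
    using iso by (auto simp: assign_iso_def gen_sub_def numeral_3_eq_3)
  have val: "\<phi> a = a'" "\<phi> b = b'" "\<phi> c = c'"
    using nth[rule_format, of 0] nth[rule_format, of 1] nth[rule_format, of 2] by auto
  have HG: "?H \<subseteq> carrier G" "?K \<subseteq> carrier G"
    using in_G by (auto intro!: generate_incl)
  have inj: "inj_on \<phi> ?H" and im: "\<And>x. x \<in> ?H \<Longrightarrow> \<phi> x \<in> carrier G"
    and mult: "\<And>x y. x \<in> ?H \<Longrightarrow> y \<in> ?H \<Longrightarrow> \<phi> (x \<otimes> y) = \<phi> x \<otimes> \<phi> y"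
    using \<phi> HG by (auto simp: iso_def bij_betw_def hom_def)
  have one: "\<phi> \<one> = \<one>"
    using mult[of \<one> \<one>] im[of \<one>] by (auto simp: generate.one intro: l_cancel_one')
  have inv: "\<phi> (inv x) = inv (\<phi> x)" if "x \<in> ?H" for x
  proof -
    have "inv x \<in> ?H" using that in_G inv_in_generate[of "{a, b, c}"] by simp
    moreover have "x \<in> carrier G" using that HG by auto
    ultimately have "\<phi> (inv x) \<otimes> \<phi> x = \<one>"
      using mult[of "inv x" x] that one by simp
    then show ?thesis
      using \<open>inv x \<in> ?H\<close> that im by (metis inv_equality)
  qed
  have pow: "\<phi> (x [^] n) = \<phi> x [^] n" if "x \<in> ?H" for x and n :: nat
    using that one by (induction n) (auto simp: mult nat_pow_in_generate)
  have wH: "wval G a b c w \<in> ?H" for w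
    using wval_in_generate[OF in_G(1-3)] .
  have "\<phi> (wval G a b c w) = wval G a' b' c' w" for w
    by (induction w) (simp_all add: val one mult inv pow wH)
  then show ?thesis
    using inj wH by (metis inj_onD)
qed

lemma regular_transfer:
  assumes "two_tuple_regular G" "assign_iso G [a, b] [a', b']"
    and in_G: "a \<in> carrier G" "b \<in> carrier G" "a' \<in> carrier G" "b' \<in> carrier G"
  obtains \<Psi> where "bij_betw \<Psi> (carrier G) (carrier G)"
    and "\<And>g s t. g \<in> carrier G \<Longrightarrow>
      wval G a b g s = wval G a b g t \<longleftrightarrow> wval G a' b' (\<Psi> g) s = wval G a' b' (\<Psi> g) t"
proof -
  obtain \<Psi> where \<Psi>: "bij_betw \<Psi> (carrier G) (carrier G)"
    "\<And>g. g \<in> carrier G \<Longrightarrow> assign_iso G [a, b, g] [a', b', \<Psi> g]"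
    using assms unfolding two_tuple_regular_def by metis
  show thesis
  proof (rule that[OF \<Psi>(1)])
    fix g s t assume g: "g \<in> carrier G"
    then have "\<Psi> g \<in> carrier G" using \<Psi>(1) by (auto simp: bij_betw_def)
    then show "wval G a b g s = wval G a b g t \<longleftrightarrow>
        wval G a' b' (\<Psi> g) s = wval G a' b' (\<Psi> g) t"
      using wval_eq_transfer[OF in_G(1,2) g in_G(3,4) _ \<Psi>(2)[OF g]] by blast
  qed
qed

section \<open>Subgroups generated by two commuting elements\<close>

lemma comm_int_pow:
  assumes "a \<in> carrier G" "b \<in> carrier G" "a \<otimes> b = b \<otimes> a"
  shows "a [^] (i::int) \<otimes> b [^] (j::int) = b [^] j \<otimes> a [^] i"
proof -
  have *: "x \<otimes> y [^] (k::int) = y [^] k \<otimes> x"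
    if "x \<in> carrier G" "y \<in> carrier G" "x \<otimes> y = y \<otimes> x" for x y k
  proof -
    have n: "x \<otimes> y [^] (n::nat) = y [^] n \<otimes> x" for n
      using that by (induction n) (auto simp: m_assoc[symmetric], simp add: m_assoc)
    show ?thesis
    proof (cases k)
      case (nonneg n)
      then show ?thesis using n by (simp add: int_pow_int)
    next
      case (neg n)
      define z where "z = y [^] Suc n"
      have z: "z \<in> carrier G" "z \<otimes> x = x \<otimes> z" using that n[of "Suc n"] by (auto simp: z_def)
      have "x \<otimes> inv z = inv z \<otimes> (z \<otimes> x) \<otimes> inv z"
        using that z(1) by (simp add: m_assoc[symmetric])
      also have "\<dots> = inv z \<otimes> x"
        using that z by (simp add: m_assoc)
      finally show ?thesis using neg that by (simp add: int_pow_neg_int z_def del: nat_pow_Suc of_nat_Suc)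
    qed
  qed
  show ?thesis
    using *[of "a [^] i" b j] *[of b a i] assms by auto
qed

lemma comm_prod_int_pow_mult:
  assumes "a \<in> carrier G" "b \<in> carrier G" "a \<otimes> b = b \<otimes> a"
  shows "(a [^] (i::int) \<otimes> b [^] (j::int)) \<otimes> (a [^] (k::int) \<otimes> b [^] (l::int))
    = a [^] (i + k) \<otimes> b [^] (j + l)"
proof -
  have "(a [^] i \<otimes> b [^] j) \<otimes> (a [^] k \<otimes> b [^] l) = a [^] i \<otimes> (b [^] j \<otimes> a [^] k) \<otimes> b [^] l"
    using assms by (simp add: m_assoc)
  also have "\<dots> = a [^] i \<otimes> (a [^] k \<otimes> b [^] j) \<otimes> b [^] l"
    using comm_int_pow[OF assms] by simp
  finally show ?thesis using assms by (simp add: m_assoc int_pow_mult)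
qed

lemma generate_comm_pair:
  assumes "a \<in> carrier G" "b \<in> carrier G" "a \<otimes> b = b \<otimes> a"
  shows "generate G {a, b} = {a [^] i \<otimes> b [^] j |(i::int) (j::int). True}"
proof
  let ?S = "{a [^] i \<otimes> b [^] j |(i::int) (j::int). True}"
  have a: "a \<in> ?S" using assms int_pow_1[of a] by (intro CollectI exI[of _ 1] exI[of _ 0]) auto
  have b: "b \<in> ?S" using assms int_pow_1[of b] by (intro CollectI exI[of _ 0] exI[of _ 1]) auto
  have "subgroup ?S G"
  proof (rule subgroupI)
    show "?S \<subseteq> carrier G" using assms by auto
    show "?S \<noteq> {}" by auto
  next
    fix x assume "x \<in> ?S"
    then obtain i j :: int where x: "x = a [^] i \<otimes> b [^] j" by auto
    have "a [^] (-i) \<otimes> b [^] (-j) \<otimes> x = \<one>"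
      using comm_prod_int_pow_mult[OF assms] x by simp
    then have "inv x = a [^] (-i) \<otimes> b [^] (-j)"
      using assms x by (metis inv_equality int_pow_closed m_closed)
    then show "inv x \<in> ?S" by auto
  next
    fix x y assume "x \<in> ?S" "y \<in> ?S"
    then show "x \<otimes> y \<in> ?S" using comm_prod_int_pow_mult[OF assms] by force
  qed
  then show "generate G {a, b} \<subseteq> ?S"
    using a b generate_subgroup_incl by (metis empty_subsetI insert_subset)
  have "a [^] (k::int) \<in> generate G {a, b}" "b [^] k \<in> generate G {a, b}" for k
    using assms group.int_pow_closed[OF subgroup.subgroup_is_group[OF generate_is_subgroup is_group], of "{a,b}"]
      subgroup_int_pow_closed[OF generate_is_subgroup] generate.incl by (metis bot.extremum insertCI insert_subset)+
  then show "?S \<subseteq> generate G {a, b}" by (auto intro: generate.eng)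
qed

text \<open>For a commuting pair every element of the generated subgroup is some a^i b^j, so the
  pair is determined up to isomorphism by the exponents with a^i b^j = 1.\<close>

lemma assign_iso_comm_pair:
  assumes ab: "a \<in> carrier G" "b \<in> carrier G" "a \<otimes> b = b \<otimes> a"
    and cd: "c \<in> carrier G" "d \<in> carrier G" "c \<otimes> d = d \<otimes> c"
    and rel: "\<And>(i::int) (j::int). a [^] i \<otimes> b [^] j = \<one> \<longleftrightarrow> c [^] i \<otimes> d [^] j = \<one>"
  shows "assign_iso G [a, b] [c, d]"
proof -
  have eq_iff: "x [^] i \<otimes> y [^] j = x [^] k \<otimes> y [^] l \<longleftrightarrow> x [^] (i - k) \<otimes> y [^] (j - l) = \<one>"
    if "x \<in> carrier G" "y \<in> carrier G" "x \<otimes> y = y \<otimes> x" for x y and i j k l :: int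
  proof -
    have "x [^] (i - k) \<otimes> y [^] (j - l) \<otimes> (x [^] k \<otimes> y [^] l) = x [^] i \<otimes> y [^] j"
      using comm_prod_int_pow_mult[OF that] by simp
    then show ?thesis using that by (metis int_pow_closed l_cancel_one' m_closed r_cancel_one' r_one l_one)
  qed
  have rel': "a [^] i \<otimes> b [^] j = a [^] k \<otimes> b [^] l \<longleftrightarrow> c [^] i \<otimes> d [^] j = c [^] k \<otimes> d [^] l"
    for i j k l :: int
    using eq_iff[OF ab] eq_iff[OF cd] rel by simp
  define \<phi> where "\<phi> x = (THE y. \<exists>(i::int) (j::int). x = a [^] i \<otimes> b [^] j \<and> y = c [^] i \<otimes> d [^] j)" for x
  have \<phi>: "\<phi> (a [^] i \<otimes> b [^] j) = c [^] i \<otimes> d [^] j" for i j :: int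
    unfolding \<phi>_def by (rule the_equality) (use rel' in auto)
  note gens = generate_comm_pair[OF ab] generate_comm_pair[OF cd]
  have "\<phi> \<in> hom (gen_sub G [a, b]) (gen_sub G [c, d])"
    unfolding gen_sub_def list.set gens
    by (rule homI) (force simp: \<phi> comm_prod_int_pow_mult[OF ab] comm_prod_int_pow_mult[OF cd])+
  moreover have "bij_betw \<phi> (generate G {a, b}) (generate G {c, d})"
    unfolding gens bij_betw_def
  proof
    show "inj_on \<phi> {a [^] i \<otimes> b [^] j |(i::int) (j::int). True}"
      using rel' by (auto simp: inj_on_def \<phi>)
    show "\<phi> ` {a [^] i \<otimes> b [^] j |(i::int) (j::int). True} = {c [^] i \<otimes> d [^] j |(i::int) (j::int). True}"
      by (force simp: \<phi>)
  qed
  moreover have "\<phi> a = c" using \<phi>[of 1 0] ab cd by (simp add: int_pow_1)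
  moreover have "\<phi> b = d" using \<phi>[of 0 1] ab cd by (simp add: int_pow_1)
  ultimately show ?thesis
    by (auto simp: assign_iso_def gen_sub_def iso_def less_Suc_eq intro!: exI[of _ \<phi>])
qed

lemma assign_iso_same_ord:
  assumes "a \<in> carrier G" "c \<in> carrier G" "ord a = ord c"
  shows "assign_iso G [a, \<one>] [c, \<one>]"
  using assms by (intro assign_iso_comm_pair) (auto simp: int_pow_eq_id)

text \<open>If z^j is nontrivial, then p does not divide j, and Bezout coefficients for p and j give
  the exponent that recovers z.\<close>

lemma int_pow_prime_order_gen:
  fixes p :: nat
  assumes z: "z \<in> carrier G" "z [^] p = \<one>" and p: "Factorial_Ring.prime p"
    and j: "z [^] (j::int) \<noteq> \<one>"
  shows "\<exists>k::int. z = (z [^] j) [^] k"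
proof -
  have "\<not> int p dvd j"
  proof
    assume "int p dvd j"
    then obtain m where "j = int p * m" by auto
    then show False using j z by (simp add: int_pow_pow[symmetric] int_pow_int)
  qed
  then have "coprime (int p) j" using p by (simp add: prime_imp_coprime)
  then obtain a b where "int p * a + j * b = 1"
    using bezout_int[of "int p" j] by (metis coprime_iff_gcd_eq_1 mult.commute)
  then have "z = z [^] (int p * a + j * b)" using z by (simp add: int_pow_1)
  also have "\<dots> = (z [^] j) [^] b"
    using z by (simp add: int_pow_mult int_pow_pow[symmetric] int_pow_int)
  finally show ?thesis by blast
qed

text \<open>An element of order p outside <x> that commutes with x generates together with x the
  direct product of <x> and a group of order p, so only x and p enter the relations.\<close>

lemma assign_iso_prime_order:
  fixes p :: nat
  assumes x: "x \<in> carrier G" and p: "Factorial_Ring.prime p"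
    and z: "z \<in> carrier G" "z [^] p = \<one>" "x \<otimes> z = z \<otimes> x" "\<And>i::int. z \<noteq> x [^] i"
    and w: "w \<in> carrier G" "w [^] p = \<one>" "x \<otimes> w = w \<otimes> x" "\<And>i::int. w \<noteq> x [^] i"
  shows "assign_iso G [x, z] [x, w]"
proof -
  \<comment> \<open>Only the trivial relations hold: a nontrivial y^j = x^(-i) would have y as a
    power, placing y in <x>.\<close>
  have triv: "x [^] i \<otimes> y [^] j = \<one> \<longleftrightarrow> x [^] i = \<one> \<and> int p dvd j"
    if y: "y \<in> carrier G" "y [^] p = \<one>" "x \<otimes> y = y \<otimes> x" "\<And>i::int. y \<noteq> x [^] i" for y and i j :: int
  proof -
    have yp: "y [^] j = \<one> \<longleftrightarrow> int p dvd j"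
    proof
      assume "int p dvd j"
      then obtain m where "j = int p * m" by auto
      then show "y [^] j = \<one>" using y by (simp add: int_pow_pow[symmetric] int_pow_int)
    next
      assume j: "y [^] j = \<one>"
      have "ord y dvd p" using y by (simp add: pow_eq_id)
      moreover have "ord y \<noteq> 1" using y(4)[of 0] y(1) ord_eq_1 by (metis int_pow_0)
      ultimately have "ord y = p" using p by (metis prime_nat_iff)
      then show "int p dvd j" using j y by (simp add: int_pow_eq_id)
    qed
    moreover have "y [^] j = \<one>" if *: "x [^] i \<otimes> y [^] j = \<one>"
    proof (rule ccontr)
      assume "y [^] j \<noteq> \<one>"
      then obtain k :: int where k: "y = (y [^] j) [^] k"
        using int_pow_prime_order_gen[OF y(1,2) p] by blast
      have "y [^] j = x [^] (-i)"
        using * x y by (metis int_pow_closed int_pow_neg inv_equality inv_inv)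
      then show False using k x y(4)[of "-i * k"] by (simp add: int_pow_pow)
    qed
    ultimately show ?thesis using x y by auto
  qed
  show ?thesis
    using assms triv[OF z] triv[OF w] by (intro assign_iso_comm_pair) auto
qed

end

section \<open>Center and commutators\<close>

context group
begin

lemma center_closed: "z \<in> center G \<Longrightarrow> z \<in> carrier G"
  by (simp add: center_def)

lemma centerD: "z \<in> center G \<Longrightarrow> g \<in> carrier G \<Longrightarrow> z \<otimes> g = g \<otimes> z"
  by (simp add: center_def)

lemma center_left_commute:
  "z \<in> center G \<Longrightarrow> g \<in> carrier G \<Longrightarrow> h \<in> carrier G \<Longrightarrow> g \<otimes> (z \<otimes> h) = z \<otimes> (g \<otimes> h)"
  using centerD[of z g] by (simp add: center_closed m_assoc[symmetric])

lemma center_subgroup: "subgroup (center G) G"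
proof (rule subgroupI)
  show "center G \<subseteq> carrier G" by (auto simp: center_def)
  have "\<one> \<in> center G" by (simp add: center_def)
  then show "center G \<noteq> {}" by blast
next
  fix a assume a: "a \<in> center G"
  then have aG: "a \<in> carrier G" by (rule center_closed)
  have "inv a \<otimes> g = g \<otimes> inv a" if g: "g \<in> carrier G" for g
  proof -
    have "inv a \<otimes> g = inv a \<otimes> (g \<otimes> a) \<otimes> inv a"
      using aG g by (simp add: m_assoc)
    also have "\<dots> = g \<otimes> inv a"
      using aG g by (simp add: centerD[OF a g, symmetric] m_assoc[symmetric])
    finally show ?thesis .
  qed
  then show "inv a \<in> center G" using aG by (simp add: center_def)
next
  fix a b assume ab: "a \<in> center G" "b \<in> center G"
  have "a \<otimes> b \<otimes> g = g \<otimes> (a \<otimes> b)" if g: "g \<in> carrier G" for g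
    using ab g center_left_commute[OF ab(1) g, of b] centerD[OF ab(2) g]
    by (simp add: m_assoc center_closed)
  then show "a \<otimes> b \<in> center G"
    using center_closed[OF ab(1)] center_closed[OF ab(2)] unfolding center_def by blast
qed

lemmas center_m_closed = subgroup.m_closed[OF center_subgroup]
  and center_one = subgroup.one_closed[OF center_subgroup]
  and center_inv = subgroup.m_inv_closed[OF center_subgroup]

lemma center_pow: "z \<in> center G \<Longrightarrow> z [^] (n::nat) \<in> center G"
  by (induction n) (auto intro: center_m_closed center_one)

lemma center_normal: "center G \<lhd> G"
proof (rule normal_invI[OF center_subgroup])
  fix x h assume x: "x \<in> carrier G" and h: "h \<in> center G"
  have "x \<otimes> h \<otimes> inv x = h"
    using x center_closed[OF h] unfolding centerD[OF h x, symmetric] by (simp add: m_assoc)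
  then show "x \<otimes> h \<otimes> inv x \<in> center G" using h by simp
qed

definition cmt :: "'a \<Rightarrow> 'a \<Rightarrow> 'a" where
  "cmt x y = x \<otimes> y \<otimes> inv x \<otimes> inv y"

lemma cmt_closed [simp]: "x \<in> carrier G \<Longrightarrow> y \<in> carrier G \<Longrightarrow> cmt x y \<in> carrier G"
  by (simp add: cmt_def)

lemma cmt_swap:
  assumes "x \<in> carrier G" "y \<in> carrier G"
  shows "x \<otimes> y = cmt x y \<otimes> (y \<otimes> x)"
proof -
  have "inv y \<otimes> (y \<otimes> x) = x" using assms by (simp add: m_assoc[symmetric])
  then show ?thesis using assms by (simp add: cmt_def m_assoc)
qed

lemma cmt_unique:
  assumes "x \<in> carrier G" "y \<in> carrier G" "c \<in> carrier G" "x \<otimes> y = c \<otimes> (y \<otimes> x)"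
  shows "cmt x y = c"
proof -
  have "cmt x y \<otimes> (y \<otimes> x) = c \<otimes> (y \<otimes> x)" using cmt_swap[OF assms(1,2)] assms(4) by (rule trans[OF sym])
  then show ?thesis using assms(1-3) by simp
qed

lemma cmt_eq_one_iff:
  assumes "x \<in> carrier G" "y \<in> carrier G"
  shows "cmt x y = \<one> \<longleftrightarrow> x \<otimes> y = y \<otimes> x"
proof
  assume "cmt x y = \<one>"
  then show "x \<otimes> y = y \<otimes> x" using cmt_swap[OF assms] assms by simp
next
  assume "x \<otimes> y = y \<otimes> x"
  then show "cmt x y = \<one>" using assms by (intro cmt_unique) simp_all
qed

lemma inv_cmt: "x \<in> carrier G \<Longrightarrow> y \<in> carrier G \<Longrightarrow> inv (cmt x y) = cmt y x"
  by (simp add: cmt_def inv_mult_group m_assoc)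

lemma cmt_self [simp]: "x \<in> carrier G \<Longrightarrow> cmt x x = \<one>"
  by (simp add: cmt_eq_one_iff)

lemma cmt_center_left [simp]: "z \<in> center G \<Longrightarrow> g \<in> carrier G \<Longrightarrow> cmt z g = \<one>"
  by (simp add: cmt_eq_one_iff centerD center_closed)

lemma cmt_center_right [simp]: "z \<in> center G \<Longrightarrow> g \<in> carrier G \<Longrightarrow> cmt g z = \<one>"
  by (simp add: cmt_eq_one_iff centerD center_closed)

lemma cmt_one [simp]: "g \<in> carrier G \<Longrightarrow> cmt g \<one> = \<one>" "g \<in> carrier G \<Longrightarrow> cmt \<one> g = \<one>"
  by (simp_all add: cmt_eq_one_iff)

lemma center_iff_cmt: "x \<in> carrier G \<Longrightarrow> x \<in> center G \<longleftrightarrow> (\<forall>g \<in> carrier G. cmt x g = \<one>)"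
  unfolding center_def using cmt_eq_one_iff by blast

lemma cmt_mult_right:
  assumes x: "x \<in> carrier G" and g: "g \<in> carrier G" and h: "h \<in> carrier G" and c: "cmt x h \<in> center G"
  shows "cmt x (g \<otimes> h) = cmt x g \<otimes> cmt x h"
proof (rule cmt_unique)
  have "x \<otimes> (g \<otimes> h) = (x \<otimes> g) \<otimes> h" using x g h by (simp only: m_assoc)
  also have "\<dots> = cmt x g \<otimes> (g \<otimes> x) \<otimes> h" by (subst cmt_swap[OF x g]) (rule refl)
  also have "\<dots> = cmt x g \<otimes> (g \<otimes> (x \<otimes> h))" using x g h by (simp add: m_assoc)
  also have "x \<otimes> h = cmt x h \<otimes> (h \<otimes> x)" by (rule cmt_swap[OF x h])
  also have "g \<otimes> (cmt x h \<otimes> (h \<otimes> x)) = cmt x h \<otimes> (g \<otimes> (h \<otimes> x))"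
    using x g h by (simp only: center_left_commute[OF c] m_closed)
  finally show "x \<otimes> (g \<otimes> h) = cmt x g \<otimes> cmt x h \<otimes> (g \<otimes> h \<otimes> x)"
    using x g h by (simp add: m_assoc)
qed (use x g h in simp_all)

lemma cmt_mult_left:
  assumes x: "x \<in> carrier G" and y: "y \<in> carrier G" and g: "g \<in> carrier G" and c: "cmt y g \<in> center G"
  shows "cmt (x \<otimes> y) g = cmt x g \<otimes> cmt y g"
proof -
  have c': "cmt g y \<in> center G" using center_inv[OF c] inv_cmt[OF y g] by simp
  have "cmt g (x \<otimes> y) = cmt g x \<otimes> cmt g y" by (rule cmt_mult_right[OF g x y c'])
  also have "\<dots> = cmt g y \<otimes> cmt g x" using centerD[OF c'] g x by simp
  finally have "inv (cmt g (x \<otimes> y)) = inv (cmt g y \<otimes> cmt g x)" by simp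
  then show ?thesis using x y g by (simp add: inv_cmt inv_mult_group)
qed

lemma cmt_pow_left:
  assumes "x \<in> carrier G" "g \<in> carrier G" and c: "cmt x g \<in> center G"
  shows "cmt (x [^] (n::nat)) g = cmt x g [^] n"
proof (induction n)
  case (Suc n)
  then show ?case using assms cmt_mult_left[of "x [^] n" x g] by simp
qed (use assms in simp)

lemma cmt_pow_right:
  assumes "x \<in> carrier G" "g \<in> carrier G" and c: "cmt x g \<in> center G"
  shows "cmt x (g [^] (n::nat)) = cmt x g [^] n"
proof (induction n)
  case (Suc n)
  then show ?case using assms cmt_mult_right[of x "g [^] n" g] by simp
qed (use assms in simp)

text \<open>Collection in class two: moving one x to the left across y^n costs the commutator n
  times, and 0 + 1 + ... + (n-1) is n choose 2.\<close>

lemma pow_mult_cmt: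
  assumes "x \<in> carrier G" "y \<in> carrier G" and c: "cmt y x \<in> center G"
  shows "(x \<otimes> y) [^] (n::nat) = x [^] n \<otimes> y [^] n \<otimes> cmt y x [^] (n choose 2)"
proof (induction n)
  case (Suc n)
  let ?c = "cmt y x"
  have cG: "?c \<in> carrier G" using assms by simp
  have cp: "?c [^] (m::nat) \<in> center G" for m using center_pow[OF c] .
  let ?a = "x [^] n" and ?b = "y [^] n" and ?d = "?c [^] (n choose 2)" and ?e = "?c [^] n"
  have G: "?a \<in> carrier G" "?b \<in> carrier G" "?d \<in> carrier G" "?e \<in> carrier G"
    using assms cG by auto
  have "?b \<otimes> x = cmt ?b x \<otimes> (x \<otimes> ?b)" by (rule cmt_swap) (use assms G in auto)
  then have swap: "?b \<otimes> x = ?e \<otimes> (x \<otimes> ?b)"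
    unfolding cmt_pow_left[OF assms(2,1) c] .
  have de: "?d \<otimes> ?e = ?c [^] (Suc n choose 2)"
    using cG by (simp add: nat_pow_mult numeral_2_eq_2 add.commute)
  have "(x \<otimes> y) [^] Suc n = (?a \<otimes> ?b) \<otimes> ?d \<otimes> (x \<otimes> y)"
    by (simp add: Suc)
  also have "\<dots> = ?d \<otimes> (?a \<otimes> ?b) \<otimes> (x \<otimes> y)"
    by (subst centerD[OF cp]) (use G in simp_all)
  also have "\<dots> = ?d \<otimes> (?a \<otimes> ((?b \<otimes> x) \<otimes> y))"
    using assms(1,2) G by (simp add: m_assoc)
  also have "\<dots> = ?d \<otimes> (?a \<otimes> (?e \<otimes> (x \<otimes> ?b \<otimes> y)))"
    unfolding swap using assms(1,2) G by (simp add: m_assoc)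
  also have "\<dots> = ?d \<otimes> (?e \<otimes> (?a \<otimes> (x \<otimes> ?b \<otimes> y)))"
    by (subst center_left_commute[OF cp]) (use assms(1,2) G in auto)
  also have "\<dots> = (?d \<otimes> ?e) \<otimes> (x [^] Suc n \<otimes> y [^] Suc n)"
    using assms(1,2) G by (simp add: m_assoc)
  also have "\<dots> = x [^] Suc n \<otimes> y [^] Suc n \<otimes> ?c [^] (Suc n choose 2)"
    unfolding de by (rule centerD[OF cp]) (use assms(1,2) in auto)
  finally show ?case .
qed (use assms in \<open>simp add: numeral_2_eq_2\<close>)

text \<open>Class equation: conjugacy classes have p-power size, and if {1} were the only one of
  size one, p would divide |G| - 1 as well as |G|.\<close>

lemma p_group_center_nontrivial:
  fixes p :: nat
  assumes p: "Factorial_Ring.prime p" and fin: "finite (carrier G)" and card: "card (carrier G) = p ^ n"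
    and nontriv: "carrier G \<noteq> {\<one>}"
  shows "\<exists>x \<in> center G. x \<noteq> \<one>"
proof (rule ccontr)
  assume no: "\<not> ?thesis"
  define \<phi> where "\<phi> = (\<lambda>g. \<lambda>h \<in> carrier G. g \<otimes> h \<otimes> inv g)"
  interpret A: group_action G "carrier G" \<phi> unfolding \<phi>_def by (rule action_by_conjugation)
  let ?O = "orbits G (carrier G) \<phi>"
  have orb: "orbit G \<phi> x = (\<lambda>g. g \<otimes> x \<otimes> inv g) ` carrier G" if "x \<in> carrier G" for x
    using that by (auto simp: orbit_def \<phi>_def)
  have one: "orbit G \<phi> \<one> = {\<one>}" unfolding orb[OF one_closed] by auto
  have "orbit G \<phi> \<one> \<in> ?O" unfolding orbits_def by blast
  then have oneO: "{\<one>} \<in> ?O" unfolding one .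
  have O_eq: "?O = orbit G \<phi> ` carrier G" by (auto simp: orbits_def)
  then have finO: "finite ?O" using fin by simp
  have p_dvd: "p dvd card o'" if "o' \<in> ?O - {{\<one>}}" for o'
  proof -
    have o': "o' \<in> orbit G \<phi> ` carrier G" "o' \<noteq> {\<one>}" using that O_eq by auto
    from o'(1) obtain x where x: "x \<in> carrier G" "o' = orbit G \<phi> x" by (rule imageE) (rule that)
    have "x \<noteq> \<one>"
    proof
      assume "x = \<one>"
      then show False using o'(2) x(2) one by simp
    qed
    then have "x \<notin> center G" using no by blast
    then obtain g where g: "g \<in> carrier G" "x \<otimes> g \<noteq> g \<otimes> x" using x unfolding center_def by blast
    have "\<one> \<otimes> x \<otimes> inv \<one> \<in> o'" unfolding x(2) orb[OF x(1)] by (rule imageI) simp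
    then have mem: "x \<in> o'" using x(1) by simp
    have mem': "g \<otimes> x \<otimes> inv g \<in> o'" unfolding x(2) orb[OF x(1)] using g(1) by (rule imageI)
    have ne: "g \<otimes> x \<otimes> inv g \<noteq> x"
      using g(2) inv_solve_right'[OF x(1) m_closed[OF g(1) x(1)] g(1)] by simp
    have "card o' \<noteq> 1"
    proof
      assume "card o' = 1"
      then obtain y where "o' = {y}" by (auto simp: card_1_singleton_iff)
      then show False using mem mem' ne by blast
    qed
    moreover have "card o' dvd p ^ n"
      using dvd_triv_left[of "card o'"] unfolding x(2) card[symmetric] order_def[symmetric]
        A.orbit_stabilizer_theorem[OF x(1), symmetric] .
    then obtain i where "card o' = p ^ i" using divides_primepow_nat[OF p] by blast
    ultimately show ?thesis by (cases i) auto
  qed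
  have "p ^ n = (\<Sum>x\<in>carrier G. 1)" using card by simp
  also have "\<dots> = (\<Sum>o'\<in>?O. card o')"
    using A.disjoint_sum[OF fin, of "\<lambda>_. 1::nat"] by simp
  also have "\<dots> = 1 + (\<Sum>o'\<in>?O - {{\<one>}}. card o')"
    using sum.remove[OF finO oneO, of card] by simp
  finally have eq: "p ^ n = 1 + (\<Sum>o'\<in>?O - {{\<one>}}. card o')" .
  have "n \<noteq> 0"
  proof
    assume "n = 0"
    then obtain y where "carrier G = {y}" using card by (auto simp: card_1_singleton_iff)
    then show False using nontriv one_closed by auto
  qed
  then have "p dvd p ^ n" by simp
  moreover have "p dvd (\<Sum>o'\<in>?O - {{\<one>}}. card o')" by (rule dvd_sum) (use p_dvd in blast)
  ultimately have "p dvd 1" using eq by (metis dvd_add_left_iff)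
  then show False using p by simp
qed

text \<open>Pull back a nontrivial central element of the factor group by N. With N the center, this
  yields an element of the second center outside the center.\<close>

lemma p_group_next_central:
  fixes p :: nat
  assumes p: "Factorial_Ring.prime p" and fin: "finite (carrier G)" and card: "card (carrier G) = p ^ n"
    and N: "N \<lhd> G" "N \<noteq> carrier G"
  shows "\<exists>x \<in> carrier G - N. \<forall>g \<in> carrier G. cmt x g \<in> N"
proof -
  interpret N: normal N G by fact
  interpret Q: group "G Mod N" by (rule N.factorgroup_is_group)
  have "card (carrier (G Mod N)) dvd p ^ n"
    using lagrange[OF N.subgroup_axioms] card by (metis FactGroup_def dvd_triv_left order_def partial_object.select_convs(1))
  then obtain m where m: "card (carrier (G Mod N)) = p ^ m"
    using p divides_primepow_nat by blast
  have finQ: "finite (carrier (G Mod N))"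
    using fin by (simp add: FactGroup_def RCOSETS_def)
  have coset_eq: "a \<otimes> inv b \<in> N" if "a \<in> carrier G" "b \<in> carrier G" "N #> a = N #> b" for a b
  proof -
    have "a \<in> N #> b" using rcos_self[OF that(1) N.subgroup_axioms] that(3) by simp
    then show ?thesis
      using N.rcos_module_imp[OF is_group that(2)] by simp
  qed
  have Ncar: "N \<in> carrier (G Mod N)" and oneQ: "\<one>\<^bsub>G Mod N\<^esub> = N"
    using Q.one_closed by (auto simp: FactGroup_def)
  have "carrier (G Mod N) \<noteq> {\<one>\<^bsub>G Mod N\<^esub>}"
  proof
    assume *: "carrier (G Mod N) = {\<one>\<^bsub>G Mod N\<^esub>}"
    have "x \<in> N" if x: "x \<in> carrier G" for x
    proof -
      have "N #> x = N" using * x oneQ by (auto simp: FactGroup_def RCOSETS_def)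
      then show ?thesis using rcos_self[OF x N.subgroup_axioms] by simp
    qed
    then show False using N(2) N.subset by auto
  qed
  from Q.p_group_center_nontrivial[OF p finQ m this]
  obtain C where C: "C \<in> center (G Mod N)" "C \<noteq> N" using oneQ by auto
  then obtain x where x: "x \<in> carrier G" "C = N #> x"
    using Q.center_closed by (auto simp: FactGroup_def RCOSETS_def)
  have "x \<notin> N" using C x coset_join2 N.subgroup_axioms by blast
  moreover have "cmt x g \<in> N" if g: "g \<in> carrier G" for g
  proof -
    have "N #> g \<in> carrier (G Mod N)" using g by (auto simp: FactGroup_def RCOSETS_def)
    from Q.centerD[OF C(1) this] have "N #> (x \<otimes> g) = N #> (g \<otimes> x)"
      using x g N.rcos_sum by (simp add: FactGroup_def)
    then show ?thesis
      using coset_eq[of "x \<otimes> g" "g \<otimes> x"] x g by (simp add: cmt_def inv_mult_group m_assoc)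
  qed
  ultimately show ?thesis using x by blast
qed

end

section \<open>Two-tuple regular p-groups\<close>

abbreviation wcmt :: "wd \<Rightarrow> wd \<Rightarrow> wd" where
  "wcmt v w \<equiv> Mul (Mul (Mul v w) (Inv v)) (Inv w)"

context group
begin

text \<open>\<open>P\<close> is a predicate on the relation of word equality, so a single lemma
  transports every Boolean combination of word equations about the third letter, and with it the
  number of solutions.\<close>

lemma regular_bij:
  assumes "two_tuple_regular G" "assign_iso G [a, b] [a', b']"
    and in_G: "a \<in> carrier G" "b \<in> carrier G" "a' \<in> carrier G" "b' \<in> carrier G"
  obtains \<Psi> where "bij_betw \<Psi> {g \<in> carrier G. P (\<lambda>s t. wval G a b g s = wval G a b g t)}
      {g \<in> carrier G. P (\<lambda>s t. wval G a' b' g s = wval G a' b' g t)}"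
proof -
  let ?R = "\<lambda>g s t. wval G a b g s = wval G a b g t"
  let ?R' = "\<lambda>g s t. wval G a' b' g s = wval G a' b' g t"
  obtain \<Psi> where bij: "bij_betw \<Psi> (carrier G) (carrier G)"
    and \<Psi>: "\<And>g. g \<in> carrier G \<Longrightarrow> ?R g = ?R' (\<Psi> g)"
    by (rule regular_transfer[OF assms]) (auto simp: fun_eq_iff)
  have inj: "inj_on \<Psi> {g \<in> carrier G. P (?R g)}"
    by (rule inj_on_subset[of _ "carrier G"]) (use bij in \<open>auto simp: bij_betw_def\<close>)
  have "\<Psi> ` {g \<in> carrier G. P (?R g)} = {g \<in> carrier G. P (?R' g)}"
  proof
    show "\<Psi> ` {g \<in> carrier G. P (?R g)} \<subseteq> {g \<in> carrier G. P (?R' g)}"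
    proof
      fix h assume "h \<in> \<Psi> ` {g \<in> carrier G. P (?R g)}"
      then obtain g where g: "g \<in> carrier G" "P (?R g)" "h = \<Psi> g" by blast
      then show "h \<in> {g \<in> carrier G. P (?R' g)}"
        using bij_betwE[OF bij] \<Psi>[OF g(1)] by simp
    qed
    show "{g \<in> carrier G. P (?R' g)} \<subseteq> \<Psi> ` {g \<in> carrier G. P (?R g)}"
    proof
      fix h assume h: "h \<in> {g \<in> carrier G. P (?R' g)}"
      then have "h \<in> \<Psi> ` carrier G" using bij by (simp add: bij_betw_def)
      then obtain g where g: "g \<in> carrier G" "h = \<Psi> g" by blast
      then have "P (?R g)" using h \<Psi>[OF g(1)] by simp
      then show "h \<in> \<Psi> ` {g \<in> carrier G. P (?R g)}" using g by blast
    qed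
  qed
  then show thesis using inj by (intro that[of \<Psi>]) (simp add: bij_betw_def)
qed

lemma regular_card_eq:
  assumes "two_tuple_regular G" "assign_iso G [a, b] [a', b']"
    and in_G: "a \<in> carrier G" "b \<in> carrier G" "a' \<in> carrier G" "b' \<in> carrier G"
  shows "card {g \<in> carrier G. P (\<lambda>s t. wval G a b g s = wval G a b g t)} =
    card {g \<in> carrier G. P (\<lambda>s t. wval G a' b' g s = wval G a' b' g t)}"
  by (rule regular_bij[OF assms]) (rule bij_betw_same_card)

lemma regular_ex_iff:
  assumes "two_tuple_regular G" "assign_iso G [a, b] [a', b']"
    and in_G: "a \<in> carrier G" "b \<in> carrier G" "a' \<in> carrier G" "b' \<in> carrier G"
  shows "(\<exists>g \<in> carrier G. P (\<lambda>s t. wval G a b g s = wval G a b g t)) \<longleftrightarrow>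
    (\<exists>g \<in> carrier G. P (\<lambda>s t. wval G a' b' g s = wval G a' b' g t))"
proof -
  have *: "A = {} \<longleftrightarrow> B = {}" if "bij_betw f A B" for A B :: "'a set" and f
    using that by (auto simp: bij_betw_def)
  show ?thesis
    by (rule regular_bij[OF assms, of P]) (drule *, blast)
qed

lemma ord_eq_prime_power:
  fixes p :: nat
  assumes "Factorial_Ring.prime p" "x \<in> carrier G" "x [^] (p ^ Suc k) = \<one>" "x [^] (p ^ k) \<noteq> \<one>"
  shows "ord x = p ^ Suc k"
proof -
  have "ord x dvd p ^ Suc k" "\<not> ord x dvd p ^ k" using assms by (simp_all add: pow_eq_id)
  then obtain i where "i \<le> Suc k" "ord x = p ^ i" using assms(1) divides_primepow_nat by blast
  then show ?thesis using \<open>\<not> ord x dvd p ^ k\<close> by (metis le_SucE le_imp_power_dvd)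
qed

text \<open>In a cyclic group of order p^(k+1) the elements killed by p are the powers of y^(p^k),
  and each nontrivial one generates that subgroup.\<close>

lemma prime_order_power:
  fixes p :: nat and i :: int
  assumes p: "Factorial_Ring.prime p" and y: "y \<in> carrier G" "ord y = p ^ Suc k"
    and c: "(y [^] i) [^] p = \<one>" 
  shows "\<exists>l::int. i = int (p ^ k) * l" 
    and "y [^] i \<noteq> \<one> \<Longrightarrow> \<exists>m::int. y [^] (p ^ k) = (y [^] i) [^] m"
proof -
  have "y [^] (i * int p) = \<one>" using c y by (simp add: int_pow_pow[symmetric] int_pow_int)
  then have "int (p ^ Suc k) dvd i * int p" using y by (simp add: int_pow_eq_id)
  then have "int (p ^ k) dvd i" using p by (simp add: prime_gt_0_nat)
  then show *: "\<exists>l::int. i = int (p ^ k) * l" by (auto simp: dvd_def)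
  then obtain l where l: "i = int (p ^ k) * l" by blast
  let ?a = "y [^] (p ^ k)"
  have a: "?a \<in> carrier G" "?a [^] p = \<one>" 
    using y pow_ord_eq_1[of y] by (simp_all add: nat_pow_pow mult.commute)
  have yi: "y [^] i = ?a [^] l"
    using y unfolding l by (simp add: int_pow_pow[symmetric] int_pow_int[symmetric])
  assume "y [^] i \<noteq> \<one>"
  then show "\<exists>m::int. ?a = (y [^] i) [^] m"
    using int_pow_prime_order_gen[OF a p] unfolding yi by blast
qed

end

section \<open>Center, exponent and roots in a regular p-group\<close>

locale regular_p_group = group +
  fixes p :: nat
  assumes p_prime: "Factorial_Ring.prime p"
    and fin: "finite (carrier G)"
    and card_G: "\<exists>n. card (carrier G) = p ^ n"
    and regular: "two_tuple_regular G"
begin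

lemma p_gt_1: "1 < p" using p_prime by (rule prime_gt_1_nat)

lemma ord_prime_power: "x \<in> carrier G \<Longrightarrow> \<exists>i. ord x = p ^ i"
  using ord_dvd_group_order[of x] card_G divides_primepow_nat[OF p_prime] by (auto simp: order_def)

text \<open>Pairing each of two elements of the same order with 1 gives isomorphic pairs, so no
  existence statement of this form distinguishes the two elements.\<close>

lemma same_ord_ex_iff:
  assumes "a \<in> carrier G" "c \<in> carrier G" "ord a = ord c"
  shows "(\<exists>g \<in> carrier G. P (\<lambda>s t. wval G a \<one> g s = wval G a \<one> g t)) \<longleftrightarrow>
    (\<exists>g \<in> carrier G. P (\<lambda>s t. wval G c \<one> g s = wval G c \<one> g t))"
  by (rule regular_ex_iff[OF regular assign_iso_same_ord]) (use assms in auto)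

lemma central_transfer:
  assumes "x \<in> center G" "y \<in> carrier G" "ord y = ord x"
  shows "y \<in> center G"
proof -
  have x: "x \<in> carrier G" using assms center_closed by blast
  have "(\<exists>g \<in> carrier G. cmt x g \<noteq> \<one>) \<longleftrightarrow> (\<exists>g \<in> carrier G. cmt y g \<noteq> \<one>)"
    using same_ord_ex_iff[OF x assms(2) assms(3)[symmetric], of "\<lambda>e. \<not> e (wcmt X1 X3) One"]
    by (simp add: cmt_def)
  then show ?thesis using assms x center_iff_cmt by metis
qed

lemma ord_exponent_less: "x \<in> carrier G \<Longrightarrow> ord x = p ^ i \<Longrightarrow> i < card (carrier G)"
proof -
  assume x: "x \<in> carrier G" "ord x = p ^ i"
  have "i < 2 ^ i" by (rule less_exp)
  also have "\<dots> \<le> p ^ i" using p_gt_1 by (intro power_mono) auto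
  also have "\<dots> \<le> card (carrier G)" using ord_le_group_order[OF fin x(1)] x(2) by (simp add: order_def)
  finally show ?thesis .
qed

text \<open>Whether an element is central depends only on its order. With c central of the largest
  possible order p^s, the powers of c realize every smaller order.\<close>

lemma center_eq_torsion: "\<exists>s. \<forall>x \<in> carrier G. x \<in> center G \<longleftrightarrow> x [^] (p ^ s) = \<one>"
proof -
  let ?I = "{i. \<exists>x \<in> center G. ord x = p ^ i}"
  have fI: "finite ?I"
    by (rule finite_subset[of _ "{..<card (carrier G)}"]) (use ord_exponent_less center_closed in auto)
  have "ord \<one> = p ^ 0" by simp
  then have "0 \<in> ?I" using center_one by blast
  then have "Max ?I \<in> ?I" using fI Max_in by blast
  then obtain c where c: "c \<in> center G" "ord c = p ^ Max ?I" by auto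
  have cG: "c \<in> carrier G" using c center_closed by auto
  show ?thesis
  proof (rule exI[of _ "Max ?I"], intro ballI iffI)
    fix x assume x: "x \<in> carrier G" "x \<in> center G"
    obtain i where i: "ord x = p ^ i" using ord_prime_power x by blast
    then have "i \<le> Max ?I" using x fI by (intro Max_ge) auto
    then show "x [^] (p ^ Max ?I) = \<one>" using x i by (simp add: pow_eq_id le_imp_power_dvd)
  next
    fix x assume x: "x \<in> carrier G" "x [^] (p ^ Max ?I) = \<one>"
    then obtain i where i: "i \<le> Max ?I" "ord x = p ^ i"
      using divides_primepow_nat[OF p_prime] by (auto simp: pow_eq_id)
    have "ord (c [^] (p ^ (Max ?I - i))) = p ^ Max ?I div p ^ (Max ?I - i)"
      using ord_pow[OF cG, of "p ^ (Max ?I - i)"] c p_gt_1 by (simp add: le_imp_power_dvd)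
    also have "\<dots> = p ^ i" using i p_gt_1 by (simp add: power_diff[symmetric])
    also have "\<dots> = ord x" using i by simp
    finally show "x \<in> center G" by (rule central_transfer[OF center_pow[OF c(1)] x(1) sym])
  qed
qed

lemma exponent_ex: "\<exists>e. (\<forall>x \<in> carrier G. x [^] (p ^ e) = \<one>) \<and> (\<exists>y \<in> carrier G. ord y = p ^ e)"
proof -
  let ?I = "{i. \<exists>x \<in> carrier G. ord x = p ^ i}"
  have fI: "finite ?I"
    by (rule finite_subset[of _ "{..<card (carrier G)}"]) (use ord_exponent_less in auto)
  have "ord \<one> = p ^ 0" by simp
  then have "0 \<in> ?I" using one_closed by blast
  then have "Max ?I \<in> ?I" using fI Max_in by blast
  moreover have "x [^] (p ^ Max ?I) = \<one>" if x: "x \<in> carrier G" for x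
  proof -
    obtain i where i: "ord x = p ^ i" using ord_prime_power x by blast
    then have "i \<le> Max ?I" using x fI by (intro Max_ge) auto
    then show "x [^] (p ^ Max ?I) = \<one>" using x i by (simp add: pow_eq_id le_imp_power_dvd)
  qed
  ultimately show ?thesis by blast
qed

text \<open>Having a p^(e-j)-th root depends only on the order, and y^(p^(e-j)) is an element of
  order p^j that has one.\<close>

lemma root_ex:
  assumes y: "y \<in> carrier G" "ord y = p ^ e" and x: "x \<in> carrier G" "x [^] (p ^ i) = \<one>" and "i \<le> e"
  shows "\<exists>g \<in> carrier G. g [^] (p ^ (e - i)) = x"
proof -
  obtain j where j: "j \<le> i" "ord x = p ^ j"
    using x divides_primepow_nat[OF p_prime] by (auto simp: pow_eq_id)
  let ?z = "y [^] (p ^ (e - j))"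
  have "ord ?z = p ^ e div p ^ (e - j)"
    using ord_pow[OF y(1), of "p ^ (e - j)"] y p_gt_1 by (simp add: le_imp_power_dvd)
  also have "\<dots> = p ^ j" using j \<open>i \<le> e\<close> p_gt_1 by (simp add: power_diff[symmetric])
  finally have "ord ?z = ord x" using j by simp
  from same_ord_ex_iff[OF _ x(1) this, of "\<lambda>e'. e' (Pow X3 (p ^ (e - j))) X1"] y
  obtain g where g: "g \<in> carrier G" "g [^] (p ^ (e - j)) = x" by auto
  have "p ^ (e - j) = p ^ (i - j) * p ^ (e - i)" using j \<open>i \<le> e\<close> by (simp add: power_add[symmetric])
  then have "(g [^] (p ^ (i - j))) [^] (p ^ (e - i)) = x" using g by (simp add: nat_pow_pow)
  then show ?thesis using g by blast
qed

text \<open>The elements of order dividing \<open>p\<close> outside \<open>\<langle>x\<rangle>\<close> are indistinguishable over \<open>x\<close>.\<close>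

lemma definable_subgroup_full:
  assumes x: "x \<in> carrier G" and cen: "\<And>z. z \<in> carrier G \<Longrightarrow> z [^] p = \<one> \<Longrightarrow> z \<in> center G"
    and mult: "\<And>a b. a \<in> W \<Longrightarrow> b \<in> W \<Longrightarrow> a \<otimes> b \<in> W"
    and inv: "\<And>a. a \<in> W \<Longrightarrow> inv a \<in> W"
    and W: "W \<subseteq> {z \<in> carrier G. z [^] p = \<one>}"
    and defn: "\<And>z. z \<in> carrier G \<Longrightarrow> z [^] p = \<one> \<Longrightarrow>
      z \<in> W \<longleftrightarrow> (\<exists>g \<in> carrier G. P (\<lambda>s t. wval G x z g s = wval G x z g t))"
    and w: "w \<in> W" "\<And>i::int. w \<noteq> x [^] i"
    and z: "z \<in> carrier G" "z [^] p = \<one>"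
  shows "z \<in> W"
proof -
  have wG: "w \<in> carrier G" "w [^] p = \<one>" using w W by auto
  have out: "v \<in> W" if v: "v \<in> carrier G" "v [^] p = \<one>" "\<And>i::int. v \<noteq> x [^] i" for v
  proof -
    have "assign_iso G [x, w] [x, v]"
      by (rule assign_iso_prime_order[OF x p_prime wG _ w(2) v(1,2) _ v(3)])
        (use centerD cen wG v x in metis)+
    from regular_ex_iff[OF regular this x wG(1) x v(1), of P]
    show ?thesis using defn wG v w by simp
  qed
  show ?thesis
  proof (cases "\<exists>i::int. z = x [^] i")
    case True
    then obtain i :: int where i: "z = x [^] i" by blast
    \<comment> \<open>A z inside <x> is reached indirectly: z w lies outside <x>, hence in W, and
      dividing by w returns z.\<close>
    have c: "z \<otimes> w = w \<otimes> z" using centerD[OF cen[OF z]] wG by simp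
    have "(z \<otimes> w) [^] p = \<one>" using pow_mult_distrib[OF c] z wG by simp
    moreover have "z \<otimes> w \<noteq> x [^] j" for j :: int
    proof
      assume "z \<otimes> w = x [^] j"
      then have "w = inv (x [^] i) \<otimes> x [^] j" using i x wG by (simp add: inv_solve_left)
      then have "w = x [^] (- i + j)" unfolding int_pow_mult[OF x] int_pow_neg[OF x] .
      then show False using w by blast
    qed
    ultimately have "z \<otimes> w \<in> W" using out z wG by simp
    then have "(z \<otimes> w) \<otimes> inv w \<in> W" using mult inv w by blast
    then show ?thesis using z wG by (simp add: m_assoc)
  qed (use out z in blast)
qed

end

section \<open>Reduction to exponent four\<close>

text \<open>For odd p the factor 1/2 is harmless, and for p = 2 with s at least 2 a factor 2
  survives the halving. The excluded value 2 choose 2 = 1 is what leaves room for the exceptional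
  groups.\<close>

lemma prime_dvd_choose_two:
  fixes p :: nat
  assumes p: "Factorial_Ring.prime p" and s: "1 \<le> s" "\<not> (p = 2 \<and> s = 1)"
  shows "p dvd (p ^ s choose 2)"
proof (cases "p = 2")
  case True
  then obtain k where k: "s = Suc (Suc k)" using s by (cases s; cases "s - 1") auto
  have "(2 ^ s :: nat) choose 2 = 2 * 2 ^ k * (2 ^ s - 1)"
    unfolding choose_two k by simp
  then show ?thesis using True by simp
next
  case False
  have "even (p ^ s * (p ^ s - 1))" by (cases "even (p ^ s)") auto
  then have "2 * (p ^ s choose 2) = p ^ s * (p ^ s - 1)" unfolding choose_two by simp
  moreover have "p dvd p ^ s * (p ^ s - 1)" using s by (intro dvd_mult2 dvd_power) auto
  ultimately have "p dvd 2 * (p ^ s choose 2)" by simp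
  moreover have "\<not> p dvd 2" using False p by (metis primes_dvd_imp_eq two_is_prime_nat)
  ultimately show ?thesis using p by (simp add: prime_dvd_mult_iff)
qed

lemma (in group) int_pow_nat_pow:
  "y \<in> carrier G \<Longrightarrow> (y [^] (a::int)) [^] (n::nat) = y [^] (a * int n)"
  by (simp add: int_pow_pow[symmetric] int_pow_int)

text \<open>The center is the set of elements of order dividing p^s, and p^e is the largest order,
  so \<open>s < e\<close> expresses that the group is nonabelian. With \<open>1 \<le> s\<close> all
  elements of order p are central.\<close>

locale nonabelian_regular_p_group = regular_p_group +
  fixes s e :: nat
  assumes center_iff: "x \<in> carrier G \<Longrightarrow> x \<in> center G \<longleftrightarrow> x [^] (p ^ s) = \<one>"
    and s_pos: "1 \<le> s" and s_less: "s < e"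
    and exponent: "x \<in> carrier G \<Longrightarrow> x [^] (p ^ e) = \<one>"
    and top_ex: "\<exists>y \<in> carrier G. ord y = p ^ e"
begin

lemma pow_p_center: "z \<in> carrier G \<Longrightarrow> z [^] p = \<one> \<Longrightarrow> z \<in> center G"
proof -
  assume z: "z \<in> carrier G" "z [^] p = \<one>"
  have "p dvd p ^ s" using s_pos by (simp add: dvd_power)
  then obtain k where k: "p ^ s = p * k" by (auto simp: dvd_def)
  have "z [^] (p ^ s) = (z [^] p) [^] k" unfolding k nat_pow_pow[OF z(1)] by (rule refl)
  then show ?thesis unfolding center_iff[OF z(1)] z(2) by simp
qed

text \<open>The first torsion layer above the center. Its noncentral elements all have order exactly
  p^(s+1), so existence statements cannot tell them apart.\<close>

definition nxt :: "'a set" where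
  "nxt = {x \<in> carrier G. x [^] (p ^ Suc s) = \<one>}"

lemma nxt_closed: "x \<in> nxt \<Longrightarrow> x \<in> carrier G" by (simp add: nxt_def)

lemma pow_s_pow: "x \<in> carrier G \<Longrightarrow> (x [^] (p ^ s)) [^] p = x [^] (p ^ Suc s)"
  by (simp add: nat_pow_pow mult.commute)

lemma nxt_ord: "x \<in> nxt \<Longrightarrow> x \<notin> center G \<Longrightarrow> ord x = p ^ Suc s"
  using ord_eq_prime_power[OF p_prime] center_iff by (simp add: nxt_def)

text \<open>Among x, x^p, x^(p^2), ... the last noncentral term before the center is reached has a
  central p-th power, hence order dividing p^(s+1).\<close>

lemma noncentral_power_nxt:
  assumes x: "x \<in> carrier G" "x \<notin> center G"
  obtains k where "x [^] (p ^ k) \<in> nxt" "x [^] (p ^ k) \<notin> center G" "(x [^] (p ^ k)) [^] p \<in> center G"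
proof -
  define i where "i = (LEAST i. x [^] (p ^ i) \<in> center G)"
  have "x [^] (p ^ e) \<in> center G" using x exponent center_one by simp
  then have i: "x [^] (p ^ i) \<in> center G" unfolding i_def by (rule LeastI)
  have "i \<noteq> 0"
  proof
    assume "i = 0" then show False using i x by simp
  qed
  then obtain k where k: "i = Suc k" using not0_implies_Suc by blast
  have nk: "x [^] (p ^ k) \<notin> center G"
    using not_less_Least[of k "\<lambda>i. x [^] (p ^ i) \<in> center G"] k unfolding i_def by simp
  have cp: "(x [^] (p ^ k)) [^] p \<in> center G" using i x unfolding k by (simp add: nat_pow_pow mult.commute)
  then have "((x [^] (p ^ k)) [^] p) [^] (p ^ s) = \<one>" using center_iff x by simp
  then have "x [^] (p ^ k) \<in> nxt" using x by (simp add: nxt_def nat_pow_pow mult.assoc)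
  then show thesis using that nk cp by blast
qed

text \<open>One noncentral element z of \<open>nxt\<close> with this property suffices, since all of
  them have the same order. It is a power of an element of the second center: z^p is central, so
  [z,h]^p = [z^p,h] = 1.\<close>

lemma nxt_cmt_pow:
  assumes x: "x \<in> nxt" and g: "g \<in> carrier G"
  shows "cmt x g [^] p = \<one>"
proof (cases "x \<in> center G")
  case True
  then show ?thesis using g by simp
next
  case False
  obtain n where n: "card (carrier G) = p ^ n" using card_G by blast
  have "center G \<noteq> carrier G"
    using False nxt_closed[OF x] by blast
  then obtain y where y: "y \<in> carrier G" "y \<notin> center G" "\<And>g. g \<in> carrier G \<Longrightarrow> cmt y g \<in> center G"
    using p_group_next_central[OF p_prime fin n center_normal] by blast
  obtain k where k: "y [^] (p ^ k) \<in> nxt" "y [^] (p ^ k) \<notin> center G" "(y [^] (p ^ k)) [^] p \<in> center G"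
    using noncentral_power_nxt[OF y(1,2)] by blast
  let ?z = "y [^] (p ^ k)"
  have z: "?z \<in> carrier G" using y by simp
  have zc: "cmt ?z h [^] p = \<one>" if h: "h \<in> carrier G" for h
  proof -
    have "cmt ?z h \<in> center G"
      using cmt_pow_left[OF y(1) h y(3)[OF h]] center_pow[OF y(3)[OF h]] by simp
    from cmt_pow_left[OF z h this, of p] show ?thesis using k(3) h by simp
  qed
  have "ord ?z = ord x" using nxt_ord[OF k(1,2)] nxt_ord[OF x False] by simp
  from same_ord_ex_iff[OF z nxt_closed[OF x] this, of "\<lambda>r. \<not> r (Pow (wcmt X1 X3) p) One"]
  have "(\<exists>g \<in> carrier G. cmt ?z g [^] p \<noteq> \<one>) \<longleftrightarrow> (\<exists>g \<in> carrier G. cmt x g [^] p \<noteq> \<one>)"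
    by (simp add: cmt_def)
  then show ?thesis using zc g by blast
qed

lemma nxt_cmt_center: "x \<in> nxt \<Longrightarrow> g \<in> carrier G \<Longrightarrow> cmt x g \<in> center G"
  using nxt_cmt_pow pow_p_center nxt_closed by simp

lemma top_noncentral: "y \<in> carrier G \<Longrightarrow> ord y = p ^ e \<Longrightarrow> y \<notin> center G"
  using power_dvd_imp_le[of p e s] s_less p_gt_1 by (auto simp: center_iff pow_eq_id)

text \<open>A p^(e-1)-th root g of v exists by \<open>root_ex\<close>, and g^(p^(e-1-s)) is the
  required root.\<close>

lemma root_s:
  assumes "v \<in> carrier G" "v [^] p = \<one>"
  shows "\<exists>x \<in> nxt. x [^] (p ^ s) = v"
proof -
  obtain y where "y \<in> carrier G" "ord y = p ^ e" using top_ex by blast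
  from root_ex[OF this assms(1), of 1] obtain g where g: "g \<in> carrier G" "g [^] (p ^ (e - 1)) = v"
    using assms s_less by auto
  have "p ^ (e - 1) = p ^ (e - 1 - s) * p ^ s" using s_less by (simp add: power_add[symmetric])
  then have "(g [^] (p ^ (e - 1 - s))) [^] (p ^ s) = v" using g by (simp add: nat_pow_pow)
  moreover from this have "g [^] (p ^ (e - 1 - s)) \<in> nxt"
    using g assms pow_s_pow[of "g [^] (p ^ (e - 1 - s))"] by (simp add: nxt_def)
  ultimately show ?thesis by blast
qed

end

text \<open>The additional assumption of this locale is contradictory, and it holds
  unless \<open>p = 2\<close>, \<open>s = 1\<close>, \<open>e = 2\<close>.\<close>

locale power_hom_p_group = nonabelian_regular_p_group +
  assumes pow_hom: "x \<in> nxt \<Longrightarrow> y \<in> nxt \<Longrightarrow> (x \<otimes> y) [^] (p ^ s) = x [^] (p ^ s) \<otimes> y [^] (p ^ s)"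
begin

lemma nxt_mult: "x \<in> nxt \<Longrightarrow> y \<in> nxt \<Longrightarrow> x \<otimes> y \<in> nxt"
proof -
  assume x: "x \<in> nxt" and y: "y \<in> nxt"
  let ?a = "x [^] (p ^ s)" and ?b = "y [^] (p ^ s)"
  have xy: "x \<in> carrier G" "y \<in> carrier G" using x y nxt_closed by auto
  have ab: "?a [^] p = \<one>" "?b [^] p = \<one>" using x y pow_s_pow by (auto simp: nxt_def)
  then have "?a \<otimes> ?b = ?b \<otimes> ?a" using centerD[OF pow_p_center] xy by simp
  then have "(?a \<otimes> ?b) [^] p = ?a [^] p \<otimes> ?b [^] p" using xy by (intro pow_mult_distrib) auto
  then have "(x \<otimes> y) [^] (p ^ Suc s) = \<one>"
    using pow_s_pow[of "x \<otimes> y"] pow_hom[OF x y] xy ab by simp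
  then show ?thesis using xy by (simp add: nxt_def)
qed

lemma nxt_inv: "x \<in> nxt \<Longrightarrow> inv x \<in> nxt"
  by (simp add: nxt_def nat_pow_inv)

text \<open>By \<open>pow_hom\<close> the quotient x x'^(-1) has trivial p^s-th power, so it is
  central and contributes nothing to the commutator. Thus [x,y] is a function of x^(p^s).\<close>

lemma pow_eq_cmt_eq:
  assumes x: "x \<in> nxt" and x': "x' \<in> nxt" and y: "y \<in> carrier G" and eq: "x [^] (p ^ s) = x' [^] (p ^ s)"
  shows "cmt x y = cmt x' y"
proof -
  have G: "x \<in> carrier G" "x' \<in> carrier G" using x x' nxt_closed by auto
  have "(x \<otimes> inv x') [^] (p ^ s) = \<one>"
    using pow_hom[OF x nxt_inv[OF x']] eq G by (simp add: nat_pow_inv)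
  then have z: "x \<otimes> inv x' \<in> center G" using center_iff G by simp
  have "cmt x y = cmt ((x \<otimes> inv x') \<otimes> x') y" using G by (simp add: m_assoc)
  also have "\<dots> = cmt (x \<otimes> inv x') y \<otimes> cmt x' y"
    using G y nxt_cmt_center[OF x' y] by (intro cmt_mult_left) auto
  finally show ?thesis using z y G by simp
qed

text \<open>With \<open>r\<close> choosing p^s-th roots, v to [r v, y] is a self-map of the finite
  set V of elements killed by p. Were it onto, it would be injective, yet both 1 and x^(p^s) go to
  1.\<close>

lemma cmt_not_full:
  assumes y: "y \<in> carrier G" and x: "x \<in> nxt" "x \<notin> center G" "cmt x y = \<one>"
  shows "\<exists>v \<in> carrier G. v [^] p = \<one> \<and> (\<forall>x' \<in> nxt. cmt x' y \<noteq> v)"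
proof (rule ccontr)
  assume no: "\<not> ?thesis"
  let ?V = "{v \<in> carrier G. v [^] p = \<one>}"
  have "\<forall>v \<in> ?V. \<exists>x. x \<in> nxt \<and> x [^] (p ^ s) = v" using root_s by blast
  from bchoice[OF this] obtain r where r: "\<And>v. v \<in> ?V \<Longrightarrow> r v \<in> nxt \<and> r v [^] (p ^ s) = v"
    by blast
  have pV: "x' [^] (p ^ s) \<in> ?V" if "x' \<in> nxt" for x'
    using that pow_s_pow[of x'] by (auto simp: nxt_def)
  have F: "cmt (r (x' [^] (p ^ s))) y = cmt x' y" if x': "x' \<in> nxt" for x'
    using pow_eq_cmt_eq[OF _ x' y] r[OF pV[OF x']] by blast
  have "?V \<subseteq> (\<lambda>v. cmt (r v) y) ` ?V"
  proof
    fix v assume v: "v \<in> ?V"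
    then obtain x' where x': "x' \<in> nxt" "cmt x' y = v" using no by blast
    then have "v = cmt (r (x' [^] (p ^ s))) y" using F by simp
    then show "v \<in> (\<lambda>v. cmt (r v) y) ` ?V" using pV[OF x'(1)] by blast
  qed
  then have inj: "inj_on (\<lambda>v. cmt (r v) y) ?V"
    using fin by (intro finite_surj_inj) auto
  have oneV: "\<one> \<in> ?V" by simp
  have one: "\<one> \<in> nxt" "\<one> [^] (p ^ s) = \<one>" by (auto simp: nxt_def)
  have "cmt (r \<one>) y = cmt (r (x [^] (p ^ s))) y" using F[OF x(1)] F[OF one(1)] one(2) x(3) y by simp
  then have "x [^] (p ^ s) = \<one>" using inj_onD[OF inj _ oneV pV[OF x(1)]] by simp
  then show False using x center_iff nxt_closed by blast
qed

text \<open>The commutators of \<open>nxt\<close> with y form a subgroup of V definable from y. If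
  it left <y>, it would be all of V by \<open>definable_subgroup_full\<close>; but a power of y is a
  noncentral element of \<open>nxt\<close> commuting with y, so \<open>cmt_not_full\<close> excludes
  this.\<close>

lemma cmt_in_cyclic:
  assumes y: "y \<in> carrier G" and x: "x \<in> nxt"
  shows "\<exists>i::int. cmt x y = y [^] i"
proof (rule ccontr)
  assume no: "\<not> ?thesis"
  have "y \<notin> center G"
  proof
    assume "y \<in> center G"
    then have "cmt x y = y [^] (0::int)" using nxt_closed[OF x] y by simp
    then show False using no by blast
  qed
  then obtain k where k: "y [^] (p ^ k) \<in> nxt" "y [^] (p ^ k) \<notin> center G"
    using noncentral_power_nxt[OF y] by blast
  have "y [^] (p ^ k) \<otimes> y = y \<otimes> y [^] (p ^ k)" using y by (simp add: nat_pow_comm[of y _ 1, simplified])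
  then have "cmt (y [^] (p ^ k)) y = \<one>" using y by (simp add: cmt_eq_one_iff)
  then obtain v where v: "v \<in> carrier G" "v [^] p = \<one>" "\<And>x'. x' \<in> nxt \<Longrightarrow> cmt x' y \<noteq> v"
    using cmt_not_full[OF y k] by blast
  let ?W = "(\<lambda>x. cmt x y) ` nxt"
  have "v \<in> ?W"
  \<comment> \<open>The predicate says that the third letter lies in \<open>nxt\<close> and that its
    commutator with y is the second letter.\<close>
  proof (rule definable_subgroup_full[OF y pow_p_center,
        where P = "\<lambda>r. r (Pow X3 (p ^ Suc s)) One \<and> r (wcmt X3 X1) X2"])
    fix a b assume "a \<in> ?W" "b \<in> ?W"
    then obtain x1 x2 where x12: "x1 \<in> nxt" "x2 \<in> nxt" "a = cmt x1 y" "b = cmt x2 y" by blast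
    then have "a \<otimes> b = cmt (x1 \<otimes> x2) y"
      using cmt_mult_left[of x1 x2 y] nxt_cmt_center nxt_closed y by simp
    then show "a \<otimes> b \<in> ?W" using nxt_mult x12 by blast
  next
    fix a assume "a \<in> ?W"
    then obtain x1 where x1: "x1 \<in> nxt" "a = cmt x1 y" by blast
    have G: "x1 \<in> carrier G" using x1 nxt_closed by blast
    have "cmt (inv x1 \<otimes> x1) y = cmt (inv x1) y \<otimes> cmt x1 y"
      using nxt_cmt_center[OF x1(1) y] G y by (intro cmt_mult_left) auto
    then have "cmt (inv x1) y \<otimes> a = \<one>" using G y x1 by simp
    then have "inv a = cmt (inv x1) y" using G y x1 by (intro inv_equality) auto
    then show "inv a \<in> ?W" using nxt_inv x1 by blast
  next
    show "?W \<subseteq> {z \<in> carrier G. z [^] p = \<one>}" using nxt_cmt_pow y nxt_closed by auto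
  next
    fix z assume "z \<in> carrier G" "z [^] p = \<one>"
    show "z \<in> ?W \<longleftrightarrow> (\<exists>g \<in> carrier G. wval G y z g (Pow X3 (p ^ Suc s)) = wval G y z g One \<and>
        wval G y z g (wcmt X3 X1) = wval G y z g X2)"
      unfolding nxt_def by (auto simp: cmt_def simp del: power_Suc)
  next
    show "cmt x y \<in> ?W" using x by blast
    show "\<And>i::int. cmt x y \<noteq> y [^] i" using no by blast
  qed (use v in auto)
  then show False using v by blast
qed

text \<open>Here \<open>nxt\<close> is the whole group, so a nontrivial [x,y] lies in <x> and in
  <y>. Then x^(p^s) is a power of [x,y], hence equals z^(p^s) for a power z of y, and [x,y] = [z,y]
  = 1.\<close>

lemma exponent_eq_Suc_s_False:
  assumes e: "e = Suc s"
  shows False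
proof -
  obtain y where y: "y \<in> carrier G" "ord y = p ^ e" using top_ex by blast
  have nxt: "x \<in> nxt" if "x \<in> carrier G" for x
    using exponent[OF that] that e by (simp add: nxt_def)
  have ync: "y \<notin> center G" using top_noncentral y by blast
  then obtain x where x: "x \<in> carrier G" "cmt y x \<noteq> \<one>" using center_iff_cmt y by blast
  then have xnc: "x \<notin> center G" using y by auto
  have ox: "ord x = p ^ Suc s" and oy: "ord y = p ^ Suc s" using nxt_ord nxt x y xnc ync by auto
  obtain i :: int where i: "cmt x y = y [^] i" using cmt_in_cyclic[OF y(1) nxt[OF x(1)]] by blast
  obtain j :: int where j: "cmt y x = x [^] j" using cmt_in_cyclic[OF x(1) nxt[OF y(1)]] by blast
  have ci: "(y [^] i) [^] p = \<one>" using nxt_cmt_pow[OF nxt[OF x(1)] y(1)] i by simp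
  have cj: "(x [^] j) [^] p = \<one>" using nxt_cmt_pow[OF nxt[OF y(1)] x(1)] j by simp
  have "x [^] j = inv (y [^] i)" using inv_cmt[OF x(1) y(1)] i j by simp
  then have ji: "x [^] j = y [^] (- i)" using y by (simp add: int_pow_neg)
  have "x [^] j \<noteq> \<one>" using x j by simp
  then obtain m :: int where m: "x [^] (p ^ s) = (x [^] j) [^] m"
    using prime_order_power(2)[OF p_prime x(1) ox cj] by blast
  obtain l where l: "i = int (p ^ s) * l" using prime_order_power(1)[OF p_prime y(1) oy ci] by blast
  \<comment> \<open>The exponent is chosen so that z^(p^s) = y^(-i m) = x^(p^s).\<close>
  define z where "z = y [^] (- l * m)"
  have z: "z \<in> carrier G" using y by (simp add: z_def)
  have "x [^] (p ^ s) = y [^] (- l * m * int (p ^ s))"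
    using y(1) unfolding m ji l by (simp add: int_pow_pow algebra_simps)
  also have "\<dots> = z [^] (p ^ s)"
    unfolding z_def int_pow_nat_pow[OF y(1)] by (rule refl)
  finally have "cmt x y = cmt z y" using pow_eq_cmt_eq[OF nxt nxt y(1)] x z by blast
  moreover have "cmt z y = \<one>"
    using comm_int_pow[OF y(1) y(1) refl, of "- l * m" 1] y z by (simp add: cmt_eq_one_iff z_def int_pow_1)
  moreover have "cmt y x = inv (cmt x y)" using inv_cmt x y by simp
  ultimately show False using x by simp
qed

text \<open>Such a g is a p-th power h^p, and [x,h^p] = [x,h]^p = 1.\<close>

lemma cmt_low_order:
  assumes "x \<in> nxt" "g \<in> carrier G" "g [^] (p ^ (e - 1)) = \<one>"
  shows "cmt x g = \<one>"
proof -
  obtain y where "y \<in> carrier G" "ord y = p ^ e" using top_ex by blast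
  from root_ex[OF this assms(2,3)] obtain h where h: "h \<in> carrier G" "h [^] p = g"
    using s_less by auto
  then have "cmt x g = cmt x h [^] p"
    using cmt_pow_right[of x h p] nxt_cmt_center assms nxt_closed by simp
  then show ?thesis using nxt_cmt_pow assms h by simp
qed

text \<open>The p^s-th powers of elements of \<open>nxt\<close> that commute with y form a subgroup
  of V definable from y. Were it not inside <y>, it would contain x0^(p^s), and x0 would share its
  commutator with an element commuting with y.\<close>

lemma commuting_power_in_cyclic:
  assumes y: "y \<in> carrier G" and x0: "x0 \<in> nxt" "cmt x0 y \<noteq> \<one>"
    and x: "x \<in> nxt" "cmt x y = \<one>"
  shows "\<exists>i::int. x [^] (p ^ s) = y [^] i"
proof (rule ccontr)
  assume no: "\<not> ?thesis"
  let ?W = "(\<lambda>x. x [^] (p ^ s)) ` {x \<in> nxt. cmt x y = \<one>}"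
  have "x0 [^] (p ^ s) \<in> ?W"
  proof (rule definable_subgroup_full[OF y pow_p_center,
        where P = "\<lambda>r. r (Pow X3 (p ^ s)) X2 \<and> r (wcmt X3 X1) One"])
    fix a b assume "a \<in> ?W" "b \<in> ?W"
    then obtain x1 x2 where x12: "x1 \<in> nxt" "x2 \<in> nxt" "cmt x1 y = \<one>" "cmt x2 y = \<one>"
      "a = x1 [^] (p ^ s)" "b = x2 [^] (p ^ s)" by blast
    then have "cmt (x1 \<otimes> x2) y = \<one>"
      using cmt_mult_left[OF nxt_closed nxt_closed y nxt_cmt_center[OF _ y], of x1 x2] y by simp
    moreover have "a \<otimes> b = (x1 \<otimes> x2) [^] (p ^ s)" using pow_hom x12 by simp
    ultimately show "a \<otimes> b \<in> ?W" using nxt_mult x12 by blast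
  next
    fix a assume "a \<in> ?W"
    then obtain x1 where x1: "x1 \<in> nxt" "cmt x1 y = \<one>" "a = x1 [^] (p ^ s)" by blast
    have G: "x1 \<in> carrier G" using x1 nxt_closed by blast
    have "cmt (inv x1 \<otimes> x1) y = cmt (inv x1) y \<otimes> cmt x1 y"
      using nxt_cmt_center[OF x1(1) y] G y by (intro cmt_mult_left) auto
    then have "cmt (inv x1) y = \<one>" using G y x1 by simp
    moreover have "inv a = (inv x1) [^] (p ^ s)" using x1 G by (simp add: nat_pow_inv)
    ultimately show "inv a \<in> ?W" using nxt_inv x1 by blast
  next
    show "?W \<subseteq> {z \<in> carrier G. z [^] p = \<one>}" using pow_s_pow by (auto simp: nxt_def)
  next
    fix z assume z: "z \<in> carrier G" "z [^] p = \<one>"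
    have "g \<in> nxt" if "g \<in> carrier G" "g [^] (p ^ s) = z" for g
      using that z pow_s_pow[of g] by (simp add: nxt_def)
    then show "z \<in> ?W \<longleftrightarrow> (\<exists>g \<in> carrier G. wval G y z g (Pow X3 (p ^ s)) = wval G y z g X2 \<and>
        wval G y z g (wcmt X3 X1) = wval G y z g One)"
      using nxt_closed by (auto simp: cmt_def)
  next
    show "x [^] (p ^ s) \<in> ?W" using x by blast
    show "\<And>i::int. x [^] (p ^ s) \<noteq> y [^] i" using no by blast
  qed (use x0 pow_s_pow in \<open>auto simp: nxt_def\<close>)
  then obtain x1 where "x1 \<in> nxt" "cmt x1 y = \<one>" "x0 [^] (p ^ s) = x1 [^] (p ^ s)" by blast
  then show False using pow_eq_cmt_eq[OF x0(1) _ y] x0 by simp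
qed

text \<open>Choose y1 and y2 of order p^e whose cyclic groups meet trivially, neither commuting with
  all of \<open>nxt\<close>. A noncentral x in \<open>nxt\<close> commuting with y1 y2 then commutes
  with both, and x^(p^s) lies in both cyclic groups, so x is central after all.\<close>

lemma exponent_gt_Suc_s_False:
  assumes e: "Suc s < e"
  shows False
proof -
  have e1: "Suc (e - 1) = e" using e by simp
  obtain y0 where y0: "y0 \<in> carrier G" "ord y0 = p ^ e" using top_ex by blast
  have "y0 \<notin> center G" using top_noncentral y0 by blast
  then obtain k where k: "y0 [^] (p ^ k) \<in> nxt" "y0 [^] (p ^ k) \<notin> center G"
    using noncentral_power_nxt[OF y0(1)] by blast
  define x0 where "x0 = y0 [^] (p ^ k)"
  have x0: "x0 \<in> nxt" "x0 \<notin> center G" "x0 \<in> carrier G" using k nxt_closed by (auto simp: x0_def)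
  then obtain y1 where y1: "y1 \<in> carrier G" "cmt x0 y1 \<noteq> \<one>" using center_iff_cmt by blast
  then have "y1 [^] (p ^ (e - 1)) \<noteq> \<one>" using cmt_low_order x0 by blast
  then have oy1: "ord y1 = p ^ Suc (e - 1)"
    using ord_eq_prime_power[OF p_prime y1(1)] exponent[OF y1(1)] e1 by metis
  have x0p: "(x0 [^] (p ^ s)) [^] p = \<one>" using x0 pow_s_pow by (simp add: nxt_def)
  \<comment> \<open>If x0^(p^s) lay in <y1>, it would be the p^s-th power of a power x1 of y1,
    giving [x0,y1] = [x1,y1] = 1.\<close>
  have v_notin: "x0 [^] (p ^ s) \<noteq> y1 [^] i" for i :: int
  proof
    assume i: "x0 [^] (p ^ s) = y1 [^] i"
    then obtain l where l: "i = int (p ^ (e - 1)) * l"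
      using prime_order_power(1)[OF p_prime y1(1) oy1] x0p by metis
    define x1 where "x1 = y1 [^] (int (p ^ (e - 1 - s)) * l)"
    have x1: "x1 \<in> carrier G" using y1 by (simp add: x1_def)
    have "p ^ (e - 1) = p ^ (e - 1 - s) * p ^ s" using e by (simp add: power_add[symmetric])
    then have "i = int (p ^ (e - 1 - s)) * l * int (p ^ s)" using l by simp
    then have eq: "x0 [^] (p ^ s) = x1 [^] (p ^ s)"
      unfolding i x1_def int_pow_nat_pow[OF y1(1)] by simp
    then have "x1 \<in> nxt" using x0p x1 pow_s_pow[OF x1] by (simp add: nxt_def)
    then have "cmt x0 y1 = cmt x1 y1" using pow_eq_cmt_eq x0 y1 eq by blast
    moreover have "cmt x1 y1 = \<one>"
      using comm_int_pow[OF y1(1) y1(1) refl, of "int (p ^ (e - 1 - s)) * l" 1] y1(1) x1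
      by (simp add: cmt_eq_one_iff x1_def int_pow_1)
    ultimately show False using y1 by simp
  qed
  define v where "v = x0 [^] (p ^ s)"
  have v: "v \<in> carrier G" "v [^] (p ^ 1) = \<one>" "v \<noteq> \<one>"
    using x0 x0p v_notin[of 0] by (auto simp: v_def)
  \<comment> \<open>With v as the p^(e-1)-th power of y2, every nontrivial subgroup of <y2> contains
    v, which is not in <y1>.\<close>
  obtain y2 where y2: "y2 \<in> carrier G" "y2 [^] (p ^ (e - 1)) = v"
    using root_ex[OF y0 v(1,2)] e by auto
  have oy2: "ord y2 = p ^ Suc (e - 1)"
    using ord_eq_prime_power[OF p_prime y2(1)] exponent[OF y2(1)] e1 y2(2) v(3) by metis
  have "\<exists>g \<in> carrier G. wval G y1 \<one> g (Pow X3 (p ^ Suc s)) = \<one> \<and> wval G y1 \<one> g (wcmt X3 X1) \<noteq> \<one>"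
    using x0 y1 by (intro bexI[of _ x0]) (auto simp: nxt_def cmt_def)
  then have "\<exists>g \<in> carrier G. wval G y2 \<one> g (Pow X3 (p ^ Suc s)) = \<one> \<and> wval G y2 \<one> g (wcmt X3 X1) \<noteq> \<one>"
    using same_ord_ex_iff[OF y1(1) y2(1) oy1[folded oy2],
        of "\<lambda>r. r (Pow X3 (p ^ Suc s)) One \<and> \<not> r (wcmt X3 X1) One"] by simp
  then obtain x2 where x2: "x2 \<in> nxt" "cmt x2 y2 \<noteq> \<one>" by (auto simp: nxt_def cmt_def)
  define w where "w = y1 \<otimes> y2"
  have w: "w \<in> carrier G" using y1 y2 by (simp add: w_def)
  obtain x where x: "x \<in> nxt" "x \<notin> center G" "cmt x w = \<one>"
  proof (cases "w \<in> center G")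
    case True
    then show thesis using that x0 by simp
  next
    case False
    then obtain k where "w [^] (p ^ k) \<in> nxt" "w [^] (p ^ k) \<notin> center G"
      using noncentral_power_nxt[OF w] by blast
    moreover have "cmt (w [^] (p ^ k)) w = \<one>"
      using comm_int_pow[OF w w refl, of "int (p ^ k)" 1] w by (simp only: cmt_eq_one_iff int_pow_1 int_pow_int nat_pow_closed)
    ultimately show thesis using that by blast
  qed
  have xG: "x \<in> carrier G" using x nxt_closed by blast
  obtain i :: int where i: "cmt x y1 = y1 [^] i" using cmt_in_cyclic[OF y1(1) x(1)] by blast
  obtain j :: int where j: "cmt x y2 = y2 [^] j" using cmt_in_cyclic[OF y2(1) x(1)] by blast
  have prod: "cmt x y1 \<otimes> cmt x y2 = \<one>"
    using x(3) cmt_mult_right[OF xG y1(1) y2(1) nxt_cmt_center[OF x(1) y2(1)]] by (simp add: w_def)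
  have no_common: "c = \<one>" if c: "c = y1 [^] i" "c = y2 [^] j" "c [^] p = \<one>" for c and i j :: int
  proof (rule ccontr)
    assume "c \<noteq> \<one>"
    then obtain m :: int where "v = c [^] m"
      using prime_order_power(2)[OF p_prime y2(1) oy2, of j] c y2(2) by auto
    then have "v = y1 [^] (i * m)" using c y1 by (simp add: int_pow_pow)
    then show False using v_notin by (simp add: v_def)
  qed
  \<comment> \<open>The commutators [x,y1] and [x,y2] are mutually inverse, so each lies in both
    cyclic groups.\<close>
  have "y2 [^] j = inv (y1 [^] i)"
    using prod y1 y2 unfolding i j by (metis int_pow_closed inv_equality inv_inv)
  then have "cmt x y2 = y1 [^] (- i)" using j y1 by (simp add: int_pow_neg)
  then have c2: "cmt x y2 = \<one>" using no_common j nxt_cmt_pow[OF x(1) y2(1)] by metis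
  then have c1: "cmt x y1 = \<one>" using prod xG y1 by simp
  obtain a :: int where a: "x [^] (p ^ s) = y1 [^] a"
    using commuting_power_in_cyclic[OF y1(1) x0(1) y1(2) x(1) c1] by blast
  obtain b :: int where b: "x [^] (p ^ s) = y2 [^] b"
    using commuting_power_in_cyclic[OF y2(1) x2 x(1) c2] by blast
  have "(x [^] (p ^ s)) [^] p = \<one>" using x xG pow_s_pow by (simp add: nxt_def)
  then have "x [^] (p ^ s) = \<one>" using no_common a b by metis
  then show False using x center_iff xG by blast
qed

end

context nonabelian_regular_p_group
begin

text \<open>For other exponents the p^s-th power map is a homomorphism on \<open>nxt\<close>, so the
  contradictory locale applies. For e = s + 1 the commutator term vanishes because p divides p^s
  choose 2; for larger e the elements of \<open>nxt\<close> are p-th powers and therefore commute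
  with each other.\<close>

theorem exceptional_exponents: "p = 2 \<and> s = 1 \<and> e = 2"
proof (rule ccontr)
  assume no: "\<not> ?thesis"
  have e: "e = Suc s \<or> Suc s < e" using s_less by auto
  have hom: "(x \<otimes> y) [^] (p ^ s) = x [^] (p ^ s) \<otimes> y [^] (p ^ s)" if x: "x \<in> nxt" and y: "y \<in> nxt" for x y
  proof -
    have G: "x \<in> carrier G" "y \<in> carrier G" using x y nxt_closed by auto
    show ?thesis
    proof (cases "e = Suc s")
      case True
      then have "p dvd (p ^ s choose 2)" using no s_pos by (intro prime_dvd_choose_two p_prime) auto
      then obtain k where k: "p ^ s choose 2 = p * k" by (auto simp: dvd_def)
      have c: "cmt y x \<in> center G" "cmt y x [^] p = \<one>"
        using nxt_cmt_center[OF y] nxt_cmt_pow[OF y] G by auto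
      have "cmt y x [^] (p ^ s choose 2) = (cmt y x [^] p) [^] k"
        unfolding k using G by (intro nat_pow_pow[symmetric]) auto
      then show ?thesis using pow_mult_cmt[OF G c(1), of "p ^ s"] c(2) G by simp
    next
      case False
      then have "Suc s < e" using e by simp
      then have "Suc s \<le> e - 1" by simp
      then obtain d where d: "e - 1 = Suc s + d" using le_Suc_ex by blast
      have "y [^] (p ^ (e - 1)) = (y [^] (p ^ Suc s)) [^] (p ^ d)"
        unfolding d power_add nat_pow_pow[OF G(2)] by (rule refl)
      then have y1: "y [^] (p ^ (e - 1)) = \<one>" using y by (simp add: nxt_def)
      obtain z where "z \<in> carrier G" "ord z = p ^ e" using top_ex by blast
      from root_ex[OF this G(2) y1] obtain h where h: "h \<in> carrier G" "h [^] p = y"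
        using s_less by auto
      then have "cmt x y = cmt x h [^] p"
        using cmt_pow_right[OF G(1) h(1) nxt_cmt_center[OF x h(1)], of p] by simp
      then have "x \<otimes> y = y \<otimes> x" using nxt_cmt_pow[OF x h(1)] G by (simp add: cmt_eq_one_iff)
      then show ?thesis using G by (intro pow_mult_distrib)
    qed
  qed
  interpret power_hom_p_group G p s e by unfold_locales (rule hom)
  show False using e exponent_eq_Suc_s_False exponent_gt_Suc_s_False by blast
qed

end

section \<open>The quaternion group\<close>

lemma (in group) central_product:
  assumes c: "c \<in> center G" "d \<in> center G" and r: "r \<in> carrier G" "t \<in> carrier G"
  shows "(c \<otimes> r) \<otimes> (d \<otimes> t) = (c \<otimes> d) \<otimes> (r \<otimes> t)"
proof -
  have G: "c \<in> carrier G" "d \<in> carrier G" using c center_closed by auto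
  have "(c \<otimes> r) \<otimes> (d \<otimes> t) = c \<otimes> (r \<otimes> (d \<otimes> t))" using G r by (simp add: m_assoc)
  also have "\<dots> = c \<otimes> (d \<otimes> (r \<otimes> t))" using center_left_commute[OF c(2) r] by simp
  finally show ?thesis using G r by (simp add: m_assoc)
qed

section \<open>Squares and commutators in exponent four\<close>

locale exceptional_2_group = nonabelian_regular_p_group G 2 1 2 for G (structure)
begin

definition sq :: "'a \<Rightarrow> 'a" where "sq x = x \<otimes> x"

lemma sq_closed [simp]: "x \<in> carrier G \<Longrightarrow> sq x \<in> carrier G"
  by (simp add: sq_def)

lemma pow_2_eq_sq: "x \<in> carrier G \<Longrightarrow> x [^] (2::nat) = sq x"
  by (simp add: sq_def numeral_2_eq_2)

lemma center_iff_sq: "x \<in> carrier G \<Longrightarrow> x \<in> center G \<longleftrightarrow> sq x = \<one>"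
  using center_iff[of x] pow_2_eq_sq[of x] by simp

lemma nxt_eq_carrier: "nxt = carrier G"
  unfolding nxt_def using exponent by auto

lemma sq_center [simp]: "x \<in> carrier G \<Longrightarrow> sq x \<in> center G"
proof -
  assume x: "x \<in> carrier G"
  have "sq (sq x) = x [^] ((2::nat) ^ 2)"
    using x by (simp add: pow_2_eq_sq[symmetric] nat_pow_pow)
  then show ?thesis using exponent[OF x] x center_iff_sq by simp
qed

lemma sq_central: "z \<in> center G \<Longrightarrow> sq z = \<one>"
  using center_iff_sq center_closed by blast

lemma central_mult_self: "z \<in> center G \<Longrightarrow> z \<otimes> z = \<one>"
  using sq_central by (simp add: sq_def)

lemma central_mult_cancel: "z \<in> center G \<Longrightarrow> g \<in> carrier G \<Longrightarrow> z \<otimes> (z \<otimes> g) = g"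
  by (simp add: m_assoc[symmetric] central_mult_self center_closed)

lemma inv_central: "z \<in> center G \<Longrightarrow> inv z = z"
  using central_mult_self center_closed by (metis inv_equality)

lemma cmt_center [simp]: "x \<in> carrier G \<Longrightarrow> y \<in> carrier G \<Longrightarrow> cmt x y \<in> center G"
  using nxt_cmt_center nxt_eq_carrier by simp

lemma cmt_sym: "x \<in> carrier G \<Longrightarrow> y \<in> carrier G \<Longrightarrow> cmt x y = cmt y x"
  using inv_cmt[of x y] inv_central[of "cmt x y"] by simp

lemma cmt_prod_left:
  "x \<in> carrier G \<Longrightarrow> y \<in> carrier G \<Longrightarrow> g \<in> carrier G \<Longrightarrow> cmt (x \<otimes> y) g = cmt x g \<otimes> cmt y g"
  by (rule cmt_mult_left) auto

lemma cmt_prod_right: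
  "x \<in> carrier G \<Longrightarrow> g \<in> carrier G \<Longrightarrow> h \<in> carrier G \<Longrightarrow> cmt x (g \<otimes> h) = cmt x g \<otimes> cmt x h"
  by (rule cmt_mult_right) auto

text \<open>Since 2 choose 2 = 1, squaring induces a quadratic map from G modulo its center to the
  center, with \<open>cmt\<close> as the associated bilinear form.\<close>

lemma sq_prod: "x \<in> carrier G \<Longrightarrow> y \<in> carrier G \<Longrightarrow> sq (x \<otimes> y) = sq x \<otimes> sq y \<otimes> cmt x y"
  using pow_mult_cmt[of x y 2] cmt_sym[of x y] by (simp add: pow_2_eq_sq)

lemma sq_prod_central: "x \<in> carrier G \<Longrightarrow> z \<in> center G \<Longrightarrow> sq (x \<otimes> z) = sq x"
  by (simp add: sq_prod center_closed sq_central)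

lemma sq_root_ex: "z \<in> center G \<Longrightarrow> \<exists>x \<in> carrier G. sq x = z"
  using root_s[of z] pow_2_eq_sq sq_central[of z] center_closed[of z] nxt_eq_carrier by auto

lemma noncentral_ord: "x \<in> carrier G \<Longrightarrow> x \<notin> center G \<Longrightarrow> ord x = 4"
  using nxt_ord[of x] nxt_eq_carrier by simp

lemma noncentral_ex: "\<exists>x \<in> carrier G. x \<notin> center G"
  using top_ex top_noncentral by blast

text \<open>A central power of x has order at most two, so i is even, as x has order 4.\<close>

lemma central_power:
  fixes i :: int
  assumes x: "x \<in> carrier G" "x \<notin> center G" and "x [^] i \<in> center G"
  shows "x [^] i = \<one> \<or> x [^] i = sq x"
proof -
  have "(x [^] i) [^] (2::nat) = \<one>" using assms sq_central pow_2_eq_sq by simp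
  then obtain l where "i = int (2 ^ 1) * l"
    using prime_order_power(1)[OF p_prime x(1), of 1] noncentral_ord[OF x] by auto
  then have i: "i = 2 * l" by simp
  have x2: "x [^] (2::int) = sq x" using pow_2_eq_sq[OF x(1)] int_pow_int[of G x 2] by simp
  have "x [^] i = sq x [^] l" unfolding i x2[symmetric] using x by (simp add: int_pow_pow)
  moreover have "ord (sq x) dvd 2"
    using sq_central[OF sq_center[OF x(1)]] pow_2_eq_sq[of "sq x"] x by (simp add: pow_eq_id[symmetric])
  then have "int (ord (sq x)) dvd 2" by (metis int_dvd_int_iff of_nat_numeral)
  moreover have "l = 2 * (l div 2) \<or> l - 1 = 2 * ((l - 1) div 2)" by presburger
  ultimately have "int (ord (sq x)) dvd l \<or> int (ord (sq x)) dvd l - 1" by (metis dvd_mult2)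
  then have "sq x [^] l = \<one> \<or> sq x [^] l = sq x"
    using int_pow_eq[of "sq x" 1 l] int_pow_eq_id[of "sq x" l] x by (auto simp: int_pow_1)
  with \<open>x [^] i = sq x [^] l\<close> show ?thesis by simp
qed

text \<open>The image [x,G] is a subgroup definable from x. Its elements are central, and the only
  central powers of x are 1 and x^2, so [x,g] lies outside <x> and
  \<open>definable_subgroup_full\<close> applies.\<close>

lemma cmt_full:
  assumes x: "x \<in> carrier G" and g: "g \<in> carrier G" "cmt x g \<noteq> \<one>" "cmt x g \<noteq> sq x"
    and z: "z \<in> center G"
  shows "\<exists>h \<in> carrier G. cmt x h = z"
proof -
  let ?W = "cmt x ` carrier G"
  have xnc: "x \<notin> center G" using g by auto
  have "z \<in> ?W"
  proof (rule definable_subgroup_full[OF x pow_p_center, where P = "\<lambda>r. r (wcmt X1 X3) X2"])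
    fix a b assume "a \<in> ?W" "b \<in> ?W"
    then obtain g h where "g \<in> carrier G" "h \<in> carrier G" "a = cmt x g" "b = cmt x h" by blast
    then have "a \<otimes> b = cmt x (g \<otimes> h)" "g \<otimes> h \<in> carrier G" using x cmt_prod_right by auto
    then show "a \<otimes> b \<in> ?W" by blast
  next
    fix a assume "a \<in> ?W"
    moreover from this have "inv a = a" using x inv_central by auto
    ultimately show "inv a \<in> ?W" by simp
  next
    show "?W \<subseteq> {z \<in> carrier G. z [^] (2::nat) = \<one>}"
      using x sq_central by (auto simp: pow_2_eq_sq)
  next
    fix z assume "z \<in> carrier G" "z [^] (2::nat) = \<one>"
    show "z \<in> ?W \<longleftrightarrow> (\<exists>g \<in> carrier G. wval G x z g (wcmt X1 X3) = wval G x z g X2)"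
      by (auto simp: cmt_def)
  next
    show "cmt x g \<in> ?W" using g by blast
    show "\<And>i::int. cmt x g \<noteq> x [^] i" using central_power[OF x xnc] cmt_center[OF x g(1)] g by metis
    show "z \<in> carrier G" using z center_closed by blast
    show "z [^] (2::nat) = \<one>" using z center_closed by (simp add: pow_2_eq_sq sq_central)
  qed auto
  then show ?thesis by blast
qed

text \<open>All noncentral elements have order 4, so the dichotomy between the two exceptional
  groups does not depend on the element at which it is tested.\<close>

lemma cmt_small_iff:
  assumes "x \<in> carrier G" "x \<notin> center G" "y \<in> carrier G" "y \<notin> center G"
  shows "(\<exists>g \<in> carrier G. cmt x g \<noteq> \<one> \<and> cmt x g \<noteq> sq x) \<longleftrightarrow>
    (\<exists>g \<in> carrier G. cmt y g \<noteq> \<one> \<and> cmt y g \<noteq> sq y)"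
  using same_ord_ex_iff[of x y "\<lambda>r. \<not> r (wcmt X1 X3) One \<and> \<not> r (wcmt X1 X3) (Mul X1 X1)"]
    assms noncentral_ord by (simp add: cmt_def sq_def)

end

locale small_commutators = exceptional_2_group +
  assumes small: "x \<in> carrier G \<Longrightarrow> g \<in> carrier G \<Longrightarrow> cmt x g = \<one> \<or> cmt x g = sq x"
begin

lemma noncommuting_eq:
  assumes "x \<in> carrier G" "y \<in> carrier G" "cmt x y \<noteq> \<one>"
  shows "cmt x y = sq x" "sq y = sq x"
  using small[of x y] small[of y x] assms cmt_sym[of x y] by auto

text \<open>For noncommuting x and y one has x^2 = y^2 = [x,y] = z. All noncentral squares equal z,
  so the center is {1,z}, and 1, x, y, x y represent its cosets.\<close>

theorem iso_Q8: "G \<cong> Q8"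
proof -
  obtain x where x: "x \<in> carrier G" "x \<notin> center G" using noncentral_ex by blast
  then obtain y where y: "y \<in> carrier G" "cmt x y \<noteq> \<one>" using center_iff_cmt by blast
  define z where "z = sq x"
  have z: "z \<in> center G" "z \<in> carrier G" using x center_closed by (auto simp: z_def)
  have xx: "sq x = z" and yy: "sq y = z" and xy: "cmt x y = z" and yx: "cmt y x = z"
    using noncommuting_eq[OF x(1) y] cmt_sym[OF x(1) y(1)] by (auto simp: z_def)
  have z1: "z \<noteq> \<one>" using xy y by simp
  have zz: "z \<otimes> z = \<one>" using z central_mult_self by blast
  \<comment> \<open>Otherwise g commutes with x and y. Then g x also has a square different from z,
    so it too commutes with y, which would force [x,y] = 1.\<close>
  have squares: "sq g = z" if g: "g \<in> carrier G" "g \<notin> center G" for g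
  proof (rule ccontr)
    assume ne: "sq g \<noteq> z"
    have gx: "cmt g x = \<one>" using noncommuting_eq(2)[OF g(1) x(1)] ne xx by auto
    have gy: "cmt g y = \<one>" using noncommuting_eq(2)[OF g(1) y(1)] ne yy by auto
    have "sq (g \<otimes> x) = sq g \<otimes> z" using sq_prod[OF g(1) x(1)] gx xx z g by simp
    moreover have "sq g \<noteq> \<one>" using g center_iff_sq by blast
    ultimately have "sq (g \<otimes> x) \<noteq> z" using g z by simp
    then have "cmt (g \<otimes> x) y = \<one>"
      using noncommuting_eq(2)[of "g \<otimes> x" y] g x y yy by auto
    then have "cmt x y = \<one>" using cmt_prod_left[OF g(1) x(1) y(1)] gy x y by simp
    then show False using y by simp
  qed
  have centre: "c = \<one> \<or> c = z" if c: "c \<in> center G" for c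
  proof -
    obtain g where "g \<in> carrier G" "sq g = c" using sq_root_ex[OF c] by blast
    then show ?thesis using squares[of g] center_iff_sq[of g] by auto
  qed
  \<comment> \<open>A noncentral g commuting with x has (g x)^2 = z z = 1, so g x is central, and
    together with [g,y] = 1 this gives [x,y] = 1.\<close>
  have both: "g \<in> center G" if g: "g \<in> carrier G" "cmt g x = \<one>" "cmt g y = \<one>" for g
  proof (rule ccontr)
    assume nc: "g \<notin> center G"
    have "sq (g \<otimes> x) = \<one>" using sq_prod[OF g(1) x(1)] g(2) xx squares[OF g(1) nc] z zz by simp
    then have c: "g \<otimes> x \<in> center G" using center_iff_sq g x by simp
    then have "cmt (g \<otimes> x) y = \<one>" using y by simp
    then have "cmt x y = \<one>" using cmt_prod_left[OF g(1) x(1) y(1)] g x y by simp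
    then show False using y by simp
  qed
  define c where "c s = (if s then z else \<one>)" for s :: bool
  define r where "r u = (if u = 0 then \<one> else if u = 1 then x else if u = 2 then y else x \<otimes> y)" for u :: nat
  have c_cen: "c s \<in> center G" "c s \<in> carrier G" for s using z center_one by (auto simp: c_def)
  have c_mult: "c s \<otimes> c t = c (s \<noteq> t)" for s t using z zz by (auto simp: c_def)
  have r_closed: "r u \<in> carrier G" for u using x y by (auto simp: r_def)
  have xx': "x \<otimes> x = z" and yy': "y \<otimes> y = z" using xx yy by (auto simp: sq_def)
  have yx': "y \<otimes> x = z \<otimes> (x \<otimes> y)" using cmt_swap[OF y(1) x(1)] yx by simp
  have t13: "x \<otimes> (x \<otimes> y) = z \<otimes> y" using x y xx' by (simp add: m_assoc[symmetric])
  have t32: "(x \<otimes> y) \<otimes> y = z \<otimes> x" using x y yy' centerD[OF z(1) x(1)] by (simp add: m_assoc)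
  have t23: "y \<otimes> (x \<otimes> y) = x"
  proof -
    have "y \<otimes> (x \<otimes> y) = (y \<otimes> x) \<otimes> y" using x y by (simp add: m_assoc)
    also have "\<dots> = z \<otimes> ((x \<otimes> y) \<otimes> y)" unfolding yx' using x y z by (simp add: m_assoc)
    finally show ?thesis unfolding t32 using central_mult_cancel[OF z(1) x(1)] by simp
  qed
  have t31: "(x \<otimes> y) \<otimes> x = y"
  proof -
    have "(x \<otimes> y) \<otimes> x = x \<otimes> (y \<otimes> x)" using x y by (simp add: m_assoc)
    also have "\<dots> = z \<otimes> (x \<otimes> (x \<otimes> y))"
      unfolding yx' by (rule center_left_commute[OF z(1)]) (use x y in auto)
    finally show ?thesis unfolding t13 using central_mult_cancel[OF z(1) y(1)] by simp
  qed
  have t33: "(x \<otimes> y) \<otimes> (x \<otimes> y) = z"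
    using sq_prod[OF x(1) y(1)] xx yy xy z zz by (simp add: sq_def)
  have r_mult: "r u \<otimes> r v = c (q8_neg u v) \<otimes> r (xor u v)" if uv: "u < 4" "v < 4" for u v
  proof -
    have "u = 0 \<or> u = 1 \<or> u = 2 \<or> u = 3" "v = 0 \<or> v = 1 \<or> v = 2 \<or> v = 3" using uv by auto
    then show ?thesis
      using x(1) y(1) z(2) by (elim disjE) (simp_all add: r_def c_def q8_neg_def xx' yy' yx' t13 t32 t23 t31 t33)
  qed
  define \<phi> where "\<phi> = (\<lambda>(s, u). c s \<otimes> r u)"
  have xor4: "xor u v < 4" if "u < 4" "v < 4" for u v :: nat
  proof -
    have "u = 0 \<or> u = 1 \<or> u = 2 \<or> u = 3" "v = 0 \<or> v = 1 \<or> v = 2 \<or> v = 3" using that by auto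
    then show ?thesis by (elim disjE) simp_all
  qed
  have hom: "\<phi> \<in> hom Q8 G"
  proof (rule homI)
    show "\<phi> a \<in> carrier G" for a using c_cen r_closed by (auto simp: \<phi>_def split: prod.split)
    fix a b assume "a \<in> carrier Q8" "b \<in> carrier Q8"
    then obtain s u t v where ab: "a = (s, u)" "b = (t, v)" "u < 4" "v < 4" by (auto simp: Q8_def)
    have "\<phi> a \<otimes> \<phi> b = (c s \<otimes> c t) \<otimes> (r u \<otimes> r v)"
      unfolding ab \<phi>_def prod.case by (rule central_product) (use c_cen r_closed in auto)
    also have "\<dots> = c s \<otimes> (c t \<otimes> c (q8_neg u v)) \<otimes> r (xor u v)"
      unfolding r_mult[OF ab(3,4)] using c_cen r_closed by (simp only: m_assoc m_closed)
    also have "\<dots> = \<phi> (a \<otimes>\<^bsub>Q8\<^esub> b)" unfolding c_mult by (simp add: ab \<phi>_def Q8_def)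
    finally show "\<phi> (a \<otimes>\<^bsub>Q8\<^esub> b) = \<phi> a \<otimes> \<phi> b" by simp
  qed
  have cmt_r: "cmt (c s \<otimes> r u) g = cmt (r u) g" if "g \<in> carrier G" for s u g
    using that c_cen r_closed cmt_prod_left[of "c s" "r u" g] by simp
  have cr: "cmt (r 0) x = \<one>" "cmt (r 0) y = \<one>" "cmt (r 1) x = \<one>" "cmt (r 1) y = z"
      "cmt (r 2) x = z" "cmt (r 2) y = \<one>" "cmt (r 3) x = z" "cmt (r 3) y = z"
    using x y z xy yx cmt_prod_left[OF x(1) y(1)] by (simp_all add: r_def)
  have "inj_on \<phi> (carrier Q8)"
  proof (rule inj_onI)
    fix a b assume "a \<in> carrier Q8" "b \<in> carrier Q8" and eq: "\<phi> a = \<phi> b"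
    then obtain s u t v where ab: "a = (s, u)" "b = (t, v)" "u < 4" "v < 4" by (auto simp: Q8_def)
    have eq': "c s \<otimes> r u = c t \<otimes> r v" using eq ab by (simp add: \<phi>_def)
    have "cmt (r u) x = cmt (r v) x" "cmt (r u) y = cmt (r v) y"
      using cmt_r[OF x(1), of s u] cmt_r[OF x(1), of t v] cmt_r[OF y(1), of s u] cmt_r[OF y(1), of t v]
      unfolding eq' by simp_all
    moreover have "u = 0 \<or> u = 1 \<or> u = 2 \<or> u = 3" "v = 0 \<or> v = 1 \<or> v = 2 \<or> v = 3" using ab by auto
    ultimately have uv: "u = v" using cr z1 z1[symmetric] by (elim disjE) simp_all
    then have "c s = c t" using eq' c_cen r_closed by simp
    then have "s = t" using z1 z1[symmetric] by (simp add: c_def split: if_splits)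
    then show "a = b" using ab uv by simp
  qed
  moreover have "\<phi> ` carrier Q8 = carrier G"
  proof
    show "\<phi> ` carrier Q8 \<subseteq> carrier G" using hom by (auto simp: hom_def)
    show "carrier G \<subseteq> \<phi> ` carrier Q8"
    proof
      fix g assume g: "g \<in> carrier G"
      \<comment> \<open>An element is located modulo the center by its commutators with x and y,
        which take all four pairs of values on the representatives.\<close>
      have "\<exists>u < 4. cmt (r u) x = cmt g x \<and> cmt (r u) y = cmt g y"
      proof -
        have "cmt g x = \<one> \<or> cmt g x = z" "cmt g y = \<one> \<or> cmt g y = z"
          using centre g x y by auto
        then show ?thesis
          by (elim disjE) (use cr in \<open>(intro exI[of _ 0] exI[of _ 1] exI[of _ 2] exI[of _ 3], simp; fail)+\<close>)
      qed
      then obtain u where u: "u < 4" "cmt (r u) x = cmt g x" "cmt (r u) y = cmt g y" by blast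
      have one: "cmt g h \<otimes> cmt g h = \<one>" if "h \<in> carrier G" for h
        using that g central_mult_self by simp
      have "cmt (g \<otimes> r u) x = \<one>" "cmt (g \<otimes> r u) y = \<one>"
        using u cmt_prod_left[OF g r_closed] one x y by simp_all
      then have "g \<otimes> r u \<in> center G" using both[of "g \<otimes> r u"] g r_closed by simp
      moreover have ru: "sq (r u) \<in> center G" using r_closed by simp
      ultimately have d: "(g \<otimes> r u) \<otimes> sq (r u) \<in> center G" using center_m_closed by blast
      \<comment> \<open>Since (r u)^4 = 1, the central factor g (r u)^3 times r u returns g.\<close>
      have "((g \<otimes> r u) \<otimes> sq (r u)) \<otimes> r u = g \<otimes> sq (sq (r u))"
        using g r_closed by (simp add: sq_def m_assoc)
      then have "((g \<otimes> r u) \<otimes> sq (r u)) \<otimes> r u = g" using sq_central[OF ru] g by simp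
      moreover obtain s where "(g \<otimes> r u) \<otimes> sq (r u) = c s"
        using centre[OF d] c_def by metis
      ultimately have "\<phi> (s, u) = g" by (simp add: \<phi>_def)
      moreover have "(s, u) \<in> carrier Q8" using u by (simp add: Q8_def)
      ultimately show "g \<in> \<phi> ` carrier Q8" by blast
    qed
  qed
  ultimately have "\<phi> \<in> iso Q8 G" using hom by (simp add: iso_def bij_betw_def)
  then show ?thesis
    by (rule is_iso_symI) (use xor4 in \<open>auto simp: Q8_def\<close>)
qed

end

section \<open>Coordinates on the Suzuki group\<close>

text \<open>The numbers 1 and 6 form a basis over GF(2) of the subfield GF(4) = {0, 1, 6, 7} of
  GF(16).\<close>

definition bits :: "bool \<Rightarrow> bool \<Rightarrow> nat" where
  "bits m n = xor (if m then 1 else 0) (if n then 6 else 0)"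

text \<open>\<open>cx\<close>, \<open>cy\<close>, \<open>cg\<close>, \<open>ch\<close> are the coordinates of an element of GF(16) with respect to the
  basis 1, 7, 2, 12 over GF(2); \<open>base a\<close> completes \<open>a\<close> to an element of the group, and the fibre
  over \<open>a\<close> is a coset of GF(4) = \<open>{0, 1, 6, 7}\<close>.\<close>

definition cx :: "nat \<Rightarrow> bool" where "cx a = (bit a 0 \<noteq> (bit a 2 \<noteq> bit a 3))"
definition cy :: "nat \<Rightarrow> bool" where "cy a = (bit a 2 \<noteq> bit a 3)"
definition cg :: "nat \<Rightarrow> bool" where "cg a = (bit a 1 \<noteq> (bit a 2 \<noteq> bit a 3))"
definition ch :: "nat \<Rightarrow> bool" where "ch a = bit a 3"

definition base :: "nat \<Rightarrow> nat" where
  "base a = [0, 2, 10, 11, 15, 9, 15, 10, 3, 15, 4, 11, 2, 10, 15, 4] ! a"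

text \<open>In \<open>G64\<close> the elements (1,2), (7,10), (2,10), (12,2) play the parts of x, y,
  g, h, and (a, \<open>base a\<close>) is their ordered product with exponents \<open>cx a\<close>,
  \<open>cy a\<close>, \<open>cg a\<close>, \<open>ch a\<close>. Collecting the product of two such
  elements leaves a central factor, whose coordinates are \<open>cocycle_u\<close> and
  \<open>cocycle_v\<close>.\<close>

definition cocycle_u :: "nat \<Rightarrow> nat \<Rightarrow> bool" where
  "cocycle_u a c = (((cg a \<and> cx c) \<noteq> (cg a \<and> cy c)) \<noteq> ((ch a \<and> cy c) \<noteq> ((cx a \<and> cx c) \<noteq> (ch a \<and> ch c))))"

definition cocycle_v :: "nat \<Rightarrow> nat \<Rightarrow> bool" where
  "cocycle_v a c = (((ch a \<and> cx c) \<noteq> (cg a \<and> cy c)) \<noteq> ((cy a \<and> cy c) \<noteq> (cg a \<and> cg c)))"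

lemma coord_table:
  "\<not> cx 0" "\<not> cy 0" "\<not> cg 0" "\<not> ch 0"
  "cx 1" "\<not> cy 1" "\<not> cg 1" "\<not> ch 1"
  "\<not> cx 2" "\<not> cy 2" "cg 2" "\<not> ch 2"
  "cx 3" "\<not> cy 3" "cg 3" "\<not> ch 3"
  "cx 4" "cy 4" "cg 4" "\<not> ch 4"
  "\<not> cx 5" "cy 5" "cg 5" "\<not> ch 5"
  "cx 6" "cy 6" "\<not> cg 6" "\<not> ch 6"
  "\<not> cx 7" "cy 7" "\<not> cg 7" "\<not> ch 7"
  "cx 8" "cy 8" "cg 8" "ch 8"
  "\<not> cx 9" "cy 9" "cg 9" "ch 9"
  "cx 10" "cy 10" "\<not> cg 10" "ch 10"
  "\<not> cx 11" "cy 11" "\<not> cg 11" "ch 11"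
  "\<not> cx 12" "\<not> cy 12" "\<not> cg 12" "ch 12"
  "cx 13" "\<not> cy 13" "\<not> cg 13" "ch 13"
  "\<not> cx 14" "\<not> cy 14" "cg 14" "ch 14"
  "cx 15" "\<not> cy 15" "cg 15" "ch 15"
  by (simp_all add: cx_def cy_def cg_def ch_def bit_0 bit_Suc_0_iff)

lemmas coord_values = coord_table[simplified]

abbreviation "below16 \<equiv> [0, 1, 2, 3, 4, 5, 6, 7, 8, 9, 10, 11, 12, 13, 14, 15 :: nat]"

lemma all_below16:
  assumes "list_all P below16" "a < 16"
  shows "P a"
proof -
  have "below16 = [0..<16]" by code_simp
  then show ?thesis using assms by (simp add: list_all_iff)
qed

lemma all_below16_2: "list_all (\<lambda>a. list_all (P a) below16) below16 \<Longrightarrow> a < 16 \<Longrightarrow> c < 16 \<Longrightarrow> P a c"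
  using all_below16[of "\<lambda>a. list_all (P a) below16"] all_below16[of "P a"] by blast

lemmas gf16_eval = gf16_mul_def gf16_red_def bit_0 bit_Suc_0_iff
  numeral_2_eq_2[symmetric] numeral_3_eq_3[symmetric]

lemma gf16_pow_4: "gf16_pow a 4 = gf16_mul a (gf16_mul a (gf16_mul a (gf16_mul a 1)))"
  by (simp add: gf16_pow_def numeral_eq_Suc)

lemma gf16_pow_5: "gf16_pow a 5 = gf16_mul a (gf16_pow a 4)"
  by (simp add: gf16_pow_def numeral_eq_Suc)

text \<open>The map a to a^4 is the nontrivial automorphism of GF(16) over GF(4), so a^5 = a a^4 is
  the norm to GF(4).\<close>

lemma gf16_pow_4_table:
  "gf16_pow 0 4 = 0" "gf16_pow 1 4 = 1" "gf16_pow 2 4 = 3" "gf16_pow 3 4 = 2"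
  "gf16_pow 4 4 = 5" "gf16_pow 5 4 = 4" "gf16_pow 6 4 = 6" "gf16_pow 7 4 = 7"
  "gf16_pow 8 4 = 15" "gf16_pow 9 4 = 14" "gf16_pow 10 4 = 12" "gf16_pow 11 4 = 13"
  "gf16_pow 12 4 = 10" "gf16_pow 13 4 = 11" "gf16_pow 14 4 = 9" "gf16_pow 15 4 = 8"
  by (simp_all add: gf16_pow_4 gf16_eval)

lemmas gf16_pow_4_values = gf16_pow_4_table[simplified]

lemma gf16_pow_5_table:
  "gf16_pow 0 5 = 0" "gf16_pow 1 5 = 1" "gf16_pow 2 5 = 6" "gf16_pow 3 5 = 6"
  "gf16_pow 4 5 = 7" "gf16_pow 5 5 = 7" "gf16_pow 6 5 = 7" "gf16_pow 7 5 = 6"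
  "gf16_pow 8 5 = 1" "gf16_pow 9 5 = 7" "gf16_pow 10 5 = 1" "gf16_pow 11 5 = 6"
  "gf16_pow 12 5 = 1" "gf16_pow 13 5 = 6" "gf16_pow 14 5 = 7" "gf16_pow 15 5 = 1"
  by (simp_all add: gf16_pow_5 gf16_pow_4_values gf16_eval)

lemmas gf16_pow_5_values = gf16_pow_5_table[simplified]

lemma cocycle_eq:
  assumes "a < 16" "c < 16"
  shows "xor (xor (base a) (base c)) (xor (gf16_mul a (gf16_pow c 4)) (base (xor a c)))
    = bits (cocycle_u a c) (cocycle_v a c)"
proof -
  have "list_all (\<lambda>a. list_all (\<lambda>c. xor (xor (base a) (base c))
      (xor (gf16_mul a (gf16_pow c 4)) (base (xor a c))) = bits (cocycle_u a c) (cocycle_v a c)) below16) below16"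
    unfolding list.pred_inject
    by (intro conjI TrueI; simp add: gf16_eval gf16_pow_4_values base_def bits_def cocycle_u_def cocycle_v_def
        coord_values)
  from all_below16_2[OF this assms] show ?thesis .
qed

text \<open>The trace b + b^4 is additive with kernel GF(4), so the solutions of the unitarity
  condition for a fixed a form the coset of GF(4) through \<open>base a\<close>.\<close>

lemma fibre_iff:
  assumes "a < 16" "b < 16"
  shows "xor b (gf16_pow b 4) = gf16_pow a 5 \<longleftrightarrow> xor b (base a) \<in> {0, 1, 6, 7}"
proof -
  have "list_all (\<lambda>a. list_all (\<lambda>b. xor b (gf16_pow b 4) = gf16_pow a 5 \<longleftrightarrow> xor b (base a) \<in> {0, 1, 6, 7})
      below16) below16"
    unfolding list.pred_inject
    by (intro conjI TrueI; simp add: gf16_pow_4_values gf16_pow_5_values base_def numeral_2_eq_2[symmetric] numeral_3_eq_3[symmetric])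
  from all_below16_2[OF this assms] show ?thesis .
qed

lemma coord_xor:
  "cx (xor a c) = (cx a \<noteq> cx c)" "cy (xor a c) = (cy a \<noteq> cy c)"
  "cg (xor a c) = (cg a \<noteq> cg c)" "ch (xor a c) = (ch a \<noteq> ch c)"
  by (auto simp: cx_def cy_def cg_def ch_def bit_xor_iff)

lemma coord_inj:
  assumes "a < 16" "c < 16" "cx a = cx c" "cy a = cy c" "cg a = cg c" "ch a = ch c"
  shows "a = c"
proof -
  have "xor (xor (if cx a then 1 else 0) (if cy a then 7 else 0)) (xor (if cg a then 2 else 0) (if ch a then 12 else 0)) = a"
    if "a < 16" for a
    using that
    by (rule all_below16[where a = a, rotated]) (simp add: cx_def cy_def cg_def ch_def bit_0 bit_Suc_0_iff)
  from this[OF assms(1)] this[OF assms(2)] show ?thesis unfolding assms(3-6) by simp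
qed

lemma xor_less_16: "a < 16 \<Longrightarrow> c < 16 \<Longrightarrow> xor a c < (16::nat)"
  by (rule all_below16_2[where P = "\<lambda>a c. xor a c < 16"]) simp_all

lemma base_less_16: "a < 16 \<Longrightarrow> base a < 16"
  by (rule all_below16[where P = "\<lambda>a. base a < 16"]) (simp_all add: base_def)

lemma bits_xor: "xor (bits m n) (bits m' n') = bits (m \<noteq> m') (n \<noteq> n')"
  by (cases m; cases n; cases m'; cases n') (simp_all add: bits_def)

lemma bits_bit: "bit (bits m n) 0 = m" "bit (bits m n) 1 = n"
  by (cases m; cases n; simp add: bits_def bit_0 bit_Suc_0_iff)+

lemma range_bits: "s \<in> {0, 1, 6, 7} \<longleftrightarrow> (\<exists>m n. s = bits m n)"
proof -
  have "bits False False = 0" "bits True False = 1" "bits False True = 6" "bits True True = 7"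
    by (simp_all add: bits_def)
  then show ?thesis unfolding ex_bool_eq by (simp only: insert_iff empty_iff) blast
qed

lemma xor_left_cancel: "xor a (xor a b) = (b::nat)"
  by (simp add: xor.assoc[symmetric])

lemma carrier_G64: "carrier G64 = (\<lambda>(a, m, n). (a, xor (base a) (bits m n))) ` ({..<16} \<times> UNIV \<times> UNIV)"
proof (intro equalityI subsetI)
  fix p assume "p \<in> carrier G64"
  then obtain a b where p: "p = (a, b)" "a < 16" "b < 16" "xor b (gf16_pow b 4) = gf16_pow a 5"
    by (auto simp: G64_def)
  then obtain m n where "xor b (base a) = bits m n" using fibre_iff range_bits by metis
  then have "b = xor (base a) (bits m n)" by (metis xor.commute xor_left_cancel)
  then show "p \<in> (\<lambda>(a, m, n). (a, xor (base a) (bits m n))) ` ({..<16} \<times> UNIV \<times> UNIV)"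
    using p by (intro image_eqI[of _ _ "(a, m, n)"]) simp_all
next
  fix p assume "p \<in> (\<lambda>(a, m, n). (a, xor (base a) (bits m n))) ` ({..<16} \<times> UNIV \<times> UNIV)"
  then obtain a m n where p: "p = (a, xor (base a) (bits m n))" "a < 16" by auto
  have "bits m n < 16" by (simp add: bits_def)
  then have b: "xor (base a) (bits m n) < 16" using p base_less_16 xor_less_16 by blast
  have "xor (xor (base a) (bits m n)) (base a) = bits m n" by (metis xor.commute xor_left_cancel)
  then show "p \<in> carrier G64"
    using p b fibre_iff[OF p(2) b] range_bits[of "bits m n"] by (auto simp: G64_def)
qed

lemma card_G64: "card (carrier G64) = 64"
proof -
  have "m = m' \<and> n = n'" if "xor (base a) (bits m n) = xor (base a) (bits m' n')" for a m n m' n'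
  proof -
    have "bits m n = bits m' n'" using that by (metis xor_left_cancel)
    then have "bit (bits m n) 0 = bit (bits m' n') 0" "bit (bits m n) 1 = bit (bits m' n') 1" by simp_all
    then show ?thesis unfolding bits_bit by simp
  qed
  note cancel = this
  have "inj_on (\<lambda>(a, m, n). (a, xor (base a) (bits m n))) ({..<16::nat} \<times> UNIV \<times> UNIV)"
  proof (rule inj_onI)
    fix s t :: "nat \<times> bool \<times> bool"
    obtain a m n a' m' n' where st: "s = (a, m, n)" "t = (a', m', n')" by (metis prod_cases3)
    assume "(\<lambda>(a, m, n). (a, xor (base a) (bits m n))) s = (\<lambda>(a, m, n). (a, xor (base a) (bits m n))) t"
    then have eq: "a = a'" "xor (base a) (bits m n) = xor (base a') (bits m' n')" unfolding st by auto
    show "s = t" using eq(1) cancel[OF eq(2)[folded eq(1)]] unfolding st by simp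
  qed
  then show ?thesis unfolding carrier_G64 by (simp add: card_image card_cartesian_product del: UNIV_Times_UNIV)
qed

lemma mult_G64:
  assumes "a < 16" "c < 16"
  shows "(a, xor (base a) (bits m n)) \<otimes>\<^bsub>G64\<^esub> (c, xor (base c) (bits m' n')) =
    (xor a c, xor (base (xor a c)) (bits ((m \<noteq> m') \<noteq> cocycle_u a c) ((n \<noteq> n') \<noteq> cocycle_v a c)))"
proof -
  have "xor (xor (xor (base a) (bits m n)) (xor (base c) (bits m' n'))) (gf16_mul a (gf16_pow c 4))
    = xor (base (xor a c)) (xor (xor (bits m n) (bits m' n'))
        (xor (xor (base a) (base c)) (xor (gf16_mul a (gf16_pow c 4)) (base (xor a c)))))"
    by (simp add: ac_simps xor_left_cancel)
  then show ?thesis unfolding cocycle_eq[OF assms] bits_xor by (simp add: G64_def)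
qed

section \<open>Counting square roots\<close>

text \<open>In the application q is the order of the center, C that of a centralizer and K the
  number of square roots of a nontrivial central element. Eliminating K leaves q (C - 1) (C - q^2) =
  0.\<close>

lemma square_count_arith:
  fixes q C K :: int
  assumes "q * C = q + (q - 1) * K" "q * q + (q * C - q) * K = q * (q * C) + (q * C - q) * C"
    and "1 < q" "C \<noteq> 1"
  shows "C = q * q" "K = q * q + q"
proof -
  have K: "(q - 1) * K = q * C - q" using assms(1) by simp
  have "(q - 1) * (q * q + (q * C - q) * K) = (q - 1) * (q * q) + (q * C - q) * (q * C - q)"
    unfolding K[symmetric] by (simp add: algebra_simps)
  then have "(q - 1) * (q * (q * C) + (q * C - q) * C) = (q - 1) * (q * q) + (q * C - q) * (q * C - q)"
    unfolding assms(2) .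
  then have "(C - 1) * (q * (C - q * q)) = 0" by (simp add: algebra_simps)
  then show C: "C = q * q" using assms by auto
  have "(q - 1) * (K - (q * q + q)) = 0" using K unfolding C by (simp add: algebra_simps)
  then show "K = q * q + q" using assms by simp
qed

text \<open>The quaternion group satisfies \<open>full\<close> as well; \<open>big\<close> separates
  the cases by giving the center a third element.\<close>

locale full_commutators = exceptional_2_group +
  assumes full: "x \<in> carrier G \<Longrightarrow> x \<notin> center G \<Longrightarrow> z \<in> center G \<Longrightarrow> \<exists>g \<in> carrier G. cmt x g = z"
    and big: "x \<in> carrier G \<Longrightarrow> x \<notin> center G \<Longrightarrow> \<exists>z \<in> center G. z \<noteq> \<one> \<and> z \<noteq> sq x"
begin

definition fib :: "'a \<Rightarrow> 'a \<Rightarrow> 'a set" where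
  "fib x z = {g \<in> carrier G. cmt x g = z}"

lemma finite_subset_carrier: "A \<subseteq> carrier G \<Longrightarrow> finite A"
  using fin finite_subset by blast

lemma finite_center: "finite (center G)"
  by (rule finite_subset_carrier) (use center_closed in blast)

lemma finite_fib: "finite (fib x z)"
  by (rule finite_subset_carrier) (auto simp: fib_def)

lemma inj_mult_right: "g \<in> carrier G \<Longrightarrow> A \<subseteq> carrier G \<Longrightarrow> inj_on (\<lambda>h. h \<otimes> g) A"
  by (rule inj_onI) (metis right_cancel subsetD)

lemma inj_mult_left: "g \<in> carrier G \<Longrightarrow> A \<subseteq> carrier G \<Longrightarrow> inj_on (\<lambda>h. g \<otimes> h) A"
  by (rule inj_onI) (metis l_cancel subsetD)

lemma sq_ne_one: "x \<in> carrier G \<Longrightarrow> x \<notin> center G \<Longrightarrow> sq x \<noteq> \<one>"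
  using center_iff_sq by blast

text \<open>The map [x, .] is a homomorphism onto the center with kernel
  \<open>fib x \<one>\<close>, the centralizer of x, so its fibres are cosets of that
  centralizer.\<close>

lemma card_fib:
  assumes x: "x \<in> carrier G" "x \<notin> center G" and z: "z \<in> center G"
  shows "card (fib x z) = card (fib x \<one>)"
proof -
  obtain g where g: "g \<in> carrier G" "cmt x g = z" using full[OF x z] by blast
  have zG: "z \<in> carrier G" using z center_closed by blast
  have "(\<lambda>h. h \<otimes> g) ` fib x \<one> = fib x z"
  proof
    show "(\<lambda>h. h \<otimes> g) ` fib x \<one> \<subseteq> fib x z"
      using x g zG by (auto simp: fib_def cmt_prod_right)
    show "fib x z \<subseteq> (\<lambda>h. h \<otimes> g) ` fib x \<one>"
    proof
      fix h assume h: "h \<in> fib x z"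
      then have hG: "h \<in> carrier G" "cmt x h = z" by (auto simp: fib_def)
      have "cmt x (h \<otimes> inv g \<otimes> g) = cmt x (h \<otimes> inv g) \<otimes> cmt x g"
        using x g hG by (intro cmt_prod_right) auto
      moreover have eq: "h \<otimes> inv g \<otimes> g = h" using g hG by (simp add: m_assoc)
      ultimately have "cmt x (h \<otimes> inv g) = \<one>" using hG g zG x by simp
      then have "h \<otimes> inv g \<in> fib x \<one>" using hG g by (simp add: fib_def)
      then show "h \<in> (\<lambda>h. h \<otimes> g) ` fib x \<one>" using eq by (metis imageI)
    qed
  qed
  moreover have "inj_on (\<lambda>h. h \<otimes> g) (fib x \<one>)"
    by (rule inj_mult_right[OF g(1)]) (auto simp: fib_def)
  ultimately show ?thesis by (metis card_image)
qed

lemma card_carrier_fib: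
  assumes x: "x \<in> carrier G" "x \<notin> center G"
  shows "card (carrier G) = card (center G) * card (fib x \<one>)"
proof -
  have "(\<Sum>z\<in>center G. \<Sum>g | g \<in> carrier G \<and> cmt x g = z. 1) = (\<Sum>g\<in>carrier G. (1::nat))"
    using fin finite_center x by (intro sum.group) auto
  moreover have "(\<Sum>g | g \<in> carrier G \<and> cmt x g = z. 1) = card (fib x \<one>)" if "z \<in> center G" for z
    using card_fib[OF x that] by (simp add: fib_def)
  ultimately show ?thesis by simp
qed

definition roots :: "'a \<Rightarrow> 'a set" where
  "roots z = {g \<in> carrier G. sq g = z}"

lemma roots_one: "roots \<one> = center G"
  unfolding roots_def using center_iff_sq center_closed by blast

lemma central_ord: "z \<in> center G \<Longrightarrow> z \<noteq> \<one> \<Longrightarrow> ord z = 2"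
  using ord_eq_prime_power[OF p_prime, of z 0] sq_central[of z] center_closed[of z] pow_2_eq_sq[of z] by simp

lemma card_roots:
  assumes "z \<in> center G" "z \<noteq> \<one>" "w \<in> center G" "w \<noteq> \<one>"
  shows "card (roots z) = card (roots w)"
proof -
  have G: "z \<in> carrier G" "w \<in> carrier G" using assms center_closed by auto
  have "ord z = ord w" using assms central_ord by simp
  from regular_card_eq[OF regular assign_iso_same_ord[OF G this], of "\<lambda>r. r (Mul X3 X3) X1"]
  show ?thesis using G by (simp add: roots_def sq_def)
qed

lemma card_center_ge_3: "3 \<le> card (center G)"
proof -
  obtain x where x: "x \<in> carrier G" "x \<notin> center G" using noncentral_ex by blast
  obtain z where z: "z \<in> center G" "z \<noteq> \<one>" "z \<noteq> sq x" using big[OF x] by blast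
  have "card {\<one>, sq x, z} = 3" using z sq_ne_one[OF x] by simp
  moreover have "{\<one>, sq x, z} \<subseteq> center G" using z x center_one by simp
  ultimately show ?thesis using card_mono[OF finite_center] by metis
qed

text \<open>Pairs (y,t) with (y t)^2 = y^2 are counted in two ways. Together with the count of all
  elements by their squares, this gives two equations for the centralizer order C and the number K
  of roots.\<close>

lemma card_values:
  assumes x: "x \<in> carrier G" "x \<notin> center G"
  defines "q \<equiv> card (center G)"
  shows "card (fib x z) = (if z \<in> center G then q * q else 0)"
    and "z \<in> center G \<Longrightarrow> z \<noteq> \<one> \<Longrightarrow> card (roots z) = q * q + q"
    and "card (carrier G) = q * (q * q)"
proof -
  define C where "C = card (fib x \<one>)"
  define K where "K = card (roots (sq x))"
  define N where "N = card (carrier G)"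
  have q3: "3 \<le> q" unfolding q_def by (rule card_center_ge_3)
  have N: "N = q * C" unfolding N_def q_def C_def by (rule card_carrier_fib[OF x])
  have sqx: "sq x \<in> center G" "sq x \<noteq> \<one>" using x sq_ne_one by auto
  have K: "card (roots z) = K" if "z \<in> center G" "z \<noteq> \<one>" for z
    unfolding K_def by (rule card_roots) (use that sqx in auto)
  have C: "card (fib y \<one>) = C" if "y \<in> carrier G" "y \<notin> center G" for y
    using card_carrier_fib[OF that] N q3 unfolding N_def[symmetric] q_def[symmetric] by simp
  have cG: "center G \<subseteq> carrier G" using center_closed by blast
  have N_eq: "N = q + (q - 1) * K"
  proof -
    have "(\<Sum>z\<in>center G. \<Sum>g | g \<in> carrier G \<and> sq g = z. 1) = (\<Sum>g\<in>carrier G. (1::nat))"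
      using fin finite_center by (intro sum.group) auto
    then have "N = (\<Sum>z\<in>center G. card (roots z))" by (simp add: N_def roots_def)
    also have "\<dots> = card (roots \<one>) + (\<Sum>z\<in>center G - {\<one>}. card (roots z))"
      by (rule sum.remove[OF finite_center center_one])
    also have "(\<Sum>z\<in>center G - {\<one>}. card (roots z)) = (\<Sum>z\<in>center G - {\<one>}. K)"
      by (rule sum.cong) (use K in auto)
    finally show ?thesis unfolding roots_one using center_one by (simp add: q_def card_Diff_singleton)
  qed
  have split_sum: "(\<Sum>g\<in>carrier G. if g \<in> center G then a else b) = q * a + (N - q) * b" for a b :: nat
  proof -
    have "(\<Sum>g\<in>carrier G. if g \<in> center G then a else b) =
      (\<Sum>g\<in>carrier G - center G. if g \<in> center G then a else b) + (\<Sum>g\<in>center G. if g \<in> center G then a else b)"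
      by (rule sum.subset_diff[OF cG fin])
    then show ?thesis using card_Diff_subset[OF finite_center cG] by (simp add: q_def N_def)
  qed
  have left: "card {t \<in> carrier G. sq (y \<otimes> t) = sq y} = (if y \<in> center G then q else K)"
    if y: "y \<in> carrier G" for y
  proof -
    have "(\<lambda>t. y \<otimes> t) ` {t \<in> carrier G. sq (y \<otimes> t) = sq y} = roots (sq y)"
    proof
      show "(\<lambda>t. y \<otimes> t) ` {t \<in> carrier G. sq (y \<otimes> t) = sq y} \<subseteq> roots (sq y)"
        using y by (auto simp: roots_def)
      show "roots (sq y) \<subseteq> (\<lambda>t. y \<otimes> t) ` {t \<in> carrier G. sq (y \<otimes> t) = sq y}"
      proof
        fix h assume h: "h \<in> roots (sq y)"
        then have hG: "h \<in> carrier G" "sq h = sq y" by (auto simp: roots_def)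
        have "h = y \<otimes> (inv y \<otimes> h)" using y hG by (simp add: m_assoc[symmetric])
        then show "h \<in> (\<lambda>t. y \<otimes> t) ` {t \<in> carrier G. sq (y \<otimes> t) = sq y}"
          using y hG by (intro image_eqI[of _ _ "inv y \<otimes> h"]) auto
      qed
    qed
    moreover have "inj_on (\<lambda>t. y \<otimes> t) {t \<in> carrier G. sq (y \<otimes> t) = sq y}"
      by (rule inj_mult_left[OF y]) auto
    ultimately have "card {t \<in> carrier G. sq (y \<otimes> t) = sq y} = card (roots (sq y))"
      by (metis card_image)
    then show ?thesis
      using y K[OF sq_center[OF y] sq_ne_one] roots_one sq_central[of y] by (simp add: q_def)
  qed
  \<comment> \<open>For fixed t the condition reads [t,y] = t^2, so the set is a fibre of the
    commutator map of t.\<close>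
  have right: "card {y \<in> carrier G. sq (y \<otimes> t) = sq y} = (if t \<in> center G then N else C)"
    if t: "t \<in> carrier G" for t
  proof -
    have iff: "sq (y \<otimes> t) = sq y \<longleftrightarrow> cmt t y = sq t" if y: "y \<in> carrier G" for y
    proof -
      have "sq (y \<otimes> t) = sq y \<otimes> (sq t \<otimes> cmt t y)"
        using y t sq_prod[OF y t] cmt_sym[OF y t] by (simp add: m_assoc)
      then have "sq (y \<otimes> t) = sq y \<longleftrightarrow> sq t \<otimes> cmt t y = \<one>" using y t by simp
      moreover have "sq t \<otimes> cmt t y = \<one> \<longleftrightarrow> cmt t y = sq t"
      proof
        assume "sq t \<otimes> cmt t y = \<one>"
        then have "sq t \<otimes> (sq t \<otimes> cmt t y) = sq t" using t by simp
        then show "cmt t y = sq t" using central_mult_cancel[of "sq t" "cmt t y"] y t by simp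
      qed (use t central_mult_self in simp)
      ultimately show ?thesis by simp
    qed
    then have eq: "{y \<in> carrier G. sq (y \<otimes> t) = sq y} = fib t (sq t)" by (auto simp: fib_def)
    show ?thesis
    proof (cases "t \<in> center G")
      case True
      then have "fib t (sq t) = carrier G" by (auto simp: fib_def sq_central)
      then show ?thesis using eq True by (simp add: N_def)
    next
      case False
      then show ?thesis using eq card_fib[OF t False sq_center[OF t]] C[OF t False] by simp
    qed
  qed
  have "(\<Sum>y\<in>carrier G. card {t \<in> carrier G. sq (y \<otimes> t) = sq y}) =
      (\<Sum>t\<in>carrier G. if t \<in> center G then N else C)"
    by (rule sum_multicount_gen[OF fin fin]) (use right in simp)
  moreover have "(\<Sum>y\<in>carrier G. card {t \<in> carrier G. sq (y \<otimes> t) = sq y}) =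
      (\<Sum>y\<in>carrier G. if y \<in> center G then q else K)"
    by (rule sum.cong) (use left in simp_all)
  ultimately have pairs: "q * q + (N - q) * K = q * N + (N - q) * C"
    unfolding split_sum by simp
  have qN: "q \<le> N" unfolding q_def N_def by (rule card_mono[OF fin cG])
  have "int N = int q * int C" using N by simp
  moreover have "int N = int q + (int q - 1) * int K" using N_eq q3 by (simp add: of_nat_diff)
  moreover have "int (q * q + (N - q) * K) = int (q * N + (N - q) * C)" using pairs by simp
  then have "int q * int q + (int N - int q) * int K = int q * int N + (int N - int q) * int C"
    using qN by (simp add: of_nat_diff)
  \<comment> \<open>The solution C = 1 of the final equation is excluded: x and 1 are distinct
    elements of the centralizer.\<close>
  moreover have "C \<noteq> 1"
  proof
    assume "C = 1"
    then obtain a where "fib x \<one> = {a}" unfolding C_def by (auto simp: card_1_singleton_iff)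
    moreover have "x \<in> fib x \<one>" "\<one> \<in> fib x \<one>" using x by (auto simp: fib_def)
    ultimately have "x = \<one>" by auto
    then show False using x center_one by simp
  qed
  ultimately have "int C = int q * int q" "int K = int q * int q + int q"
    using square_count_arith[of "int q" "int C" "int K"] q3 by auto
  then have CK: "C = q * q" "K = q * q + q" by (simp_all flip: of_nat_mult of_nat_add)
  have "fib x z = {}" if "z \<notin> center G" using that x by (auto simp: fib_def)
  then show "card (fib x z) = (if z \<in> center G then q * q else 0)"
    using card_fib[OF x, of z] CK by (simp add: C_def)
  show "z \<in> center G \<Longrightarrow> z \<noteq> \<one> \<Longrightarrow> card (roots z) = q * q + q" using K CK by simp
  show "card (carrier G) = q * (q * q)" using N CK by (simp add: N_def)
qed

text \<open>The condition [x,g] = x^2 says that (g x)^2 = g^2, so right multiplication by x maps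
  this set to itself.\<close>

definition froots :: "'a \<Rightarrow> 'a \<Rightarrow> 'a set" where
  "froots x z = {g \<in> carrier G. cmt x g = sq x \<and> sq g = z}"

lemma finite_froots: "finite (froots x z)"
  by (rule finite_subset_carrier) (auto simp: froots_def)

text \<open>Both z and w lie outside <x>, whose only central elements are 1 and x^2, so the pairs
  (x,z) and (x,w) are indistinguishable.\<close>

lemma card_froots_eq:
  assumes x: "x \<in> carrier G" "x \<notin> center G"
    and z: "z \<in> center G" "z \<noteq> \<one>" "z \<noteq> sq x" and w: "w \<in> center G" "w \<noteq> \<one>" "w \<noteq> sq x"
  shows "card (froots x z) = card (froots x w)"
proof -
  have G: "z \<in> carrier G" "w \<in> carrier G" using z w center_closed by auto
  have no: "v \<noteq> x [^] i" if "v \<in> center G" "v \<noteq> \<one>" "v \<noteq> sq x" for v and i :: int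
    using central_power[OF x, of i] that by metis
  have "assign_iso G [x, z] [x, w]"
  proof (rule assign_iso_prime_order[OF x(1) p_prime])
    show "z [^] (2::nat) = \<one>" "w [^] (2::nat) = \<one>"
      using z w G sq_central by (simp_all add: pow_2_eq_sq)
    show "x \<otimes> z = z \<otimes> x" "x \<otimes> w = w \<otimes> x" using centerD[OF z(1) x(1)] centerD[OF w(1) x(1)] by simp_all
  qed (use G no[OF z] no[OF w] in blast)+
  from regular_card_eq[OF regular this x(1) G(1) x(1) G(2),
      of "\<lambda>r. r (wcmt X1 X3) (Mul X1 X1) \<and> r (Mul X3 X3) X2"]
  show ?thesis by (simp add: froots_def cmt_def sq_def)
qed

text \<open>The cosets of g and g x by the center both lie in the set, and they are disjoint because
  x is noncentral.\<close>

lemma card_froots_ge: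
  assumes x: "x \<in> carrier G" "x \<notin> center G" and g: "g \<in> froots x z"
  shows "2 * card (center G) \<le> card (froots x z)"
proof -
  have gG: "g \<in> carrier G" "cmt x g = sq x" "sq g = z" using g by (auto simp: froots_def)
  have xx: "sq x \<otimes> sq x = \<one>" using x central_mult_self by simp
  have cG: "center G \<subseteq> carrier G" using center_closed by blast
  have zG: "z \<in> carrier G" using gG by auto
  have gx: "g \<otimes> x \<in> carrier G" "cmt x (g \<otimes> x) = sq x" "sq (g \<otimes> x) = z"
    using x gG cmt_prod_right[OF x(1) gG(1) x(1)] sq_prod[OF gG(1) x(1)] cmt_sym[OF gG(1) x(1)] xx zG
    by (simp_all add: m_assoc)
  have coset: "(\<lambda>c. h \<otimes> c) ` center G \<subseteq> froots x z"
    if "h \<in> carrier G" "cmt x h = sq x" "sq h = z" for h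
    using that x cG by (auto simp: froots_def cmt_prod_right sq_prod_central)
  have card: "card ((\<lambda>c. h \<otimes> c) ` center G) = card (center G)" if "h \<in> carrier G" for h
    by (rule card_image) (rule inj_mult_left[OF that cG])
  have disj: "(\<lambda>c. g \<otimes> c) ` center G \<inter> (\<lambda>c. g \<otimes> x \<otimes> c) ` center G = {}"
  proof (rule ccontr)
    assume "\<not> ?thesis"
    then obtain c d where cd: "c \<in> center G" "d \<in> center G" "g \<otimes> c = g \<otimes> x \<otimes> d" by blast
    then have G: "c \<in> carrier G" "d \<in> carrier G" using cG by auto
    have "g \<otimes> c = g \<otimes> (x \<otimes> d)" using cd(3) gG x G by (simp add: m_assoc)
    then have c: "c = x \<otimes> d" using gG x G by simp
    have "sq (x \<otimes> d) = sq x" using sq_prod_central x cd by simp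
    then show False using c sq_central[OF cd(1)] sq_ne_one[OF x] by simp
  qed
  have "2 * card (center G) = card ((\<lambda>c. g \<otimes> c) ` center G \<union> (\<lambda>c. g \<otimes> x \<otimes> c) ` center G)"
    using card_Un_disjoint[OF _ _ disj] finite_center card[OF gG(1)] card[OF gx(1)] by simp
  also have "\<dots> \<le> card (froots x z)"
    by (rule card_mono[OF finite_froots]) (use coset[OF gG] coset[OF gx] in blast)
  finally show ?thesis .
qed

text \<open>If one such set were empty, then [x,g] = x^2 would force g^2 = x^2, and by regularity
  the same would hold for every noncentral y in place of x. Counting the square roots of u = x^2
  then gives q^2 \<le> 2 q for the order q of the center, against q \<ge> 3.\<close>

lemma froots_nonempty:
  assumes x: "x \<in> carrier G" "x \<notin> center G" and z: "z \<in> center G" "z \<noteq> \<one>" "z \<noteq> sq x"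
  shows "froots x z \<noteq> {}"
proof
  assume empty: "froots x z = {}"
  let ?q = "card (center G)" and ?u = "sq x"
  have all: "sq g = sq x" if "g \<in> carrier G" "cmt x g = sq x" for g
  proof (rule ccontr)
    assume ne: "sq g \<noteq> sq x"
    have "g \<notin> center G" using that x sq_ne_one[OF x] by auto
    then have "card (froots x (sq g)) = card (froots x z)"
      using card_froots_eq[OF x _ _ ne z] that sq_ne_one by simp
    then have "froots x (sq g) = {}" using empty finite_froots by (simp add: card_eq_0_iff)
    then show False using that by (auto simp: froots_def)
  qed
  have all': "sq g = sq y" if y: "y \<in> carrier G" "y \<notin> center G" and g: "g \<in> carrier G" "cmt y g = sq y" for y g
  proof (rule ccontr)
    assume "sq g \<noteq> sq y"
    then have "\<exists>g \<in> carrier G. cmt x g = sq x \<and> sq g \<noteq> sq x"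
      using same_ord_ex_iff[of x y "\<lambda>r. r (wcmt X1 X3) (Mul X1 X1) \<and> \<not> r (Mul X3 X3) (Mul X1 X1)"]
        x y g noncentral_ord by (auto simp: cmt_def sq_def)
    then show False using all by blast
  qed
  have u: "?u \<in> center G" "?u \<noteq> \<one>" "?u \<in> carrier G" using x sq_ne_one by auto
  obtain g where g: "g \<in> carrier G" "cmt x g = ?u" using full[OF x u(1)] by blast
  have sg: "sq g = ?u" using all g by blast
  have gnc: "g \<notin> center G" using g u x by auto
  have cG: "center G \<subseteq> carrier G" using center_closed by blast
  let ?Z = "(\<lambda>c. g \<otimes> c) ` center G"
  have cardZ: "card ?Z = ?q" by (rule card_image) (rule inj_mult_left[OF g(1) cG])
  have disj: "fib g ?u \<inter> ?Z = {}"
    using u g cG by (auto simp: fib_def cmt_prod_right)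
  \<comment> \<open>Since g^2 = u, both the fibre of g over u and the coset of g consist of roots of
    u. They have q^2 and q elements and are disjoint, because [g, g c] = 1 for central c; so u has
    no other roots.\<close>
  have sub: "fib g ?u \<union> ?Z \<subseteq> roots ?u"
    using all'[OF g(1) gnc] sg g cG by (auto simp: fib_def roots_def sq_prod_central)
  have "card (fib g ?u \<union> ?Z) = card (roots ?u)"
    using card_Un_disjoint[OF finite_fib _ disj] finite_center cardZ card_values(1)[OF g(1) gnc]
      card_values(2)[OF x u(1,2)] u by simp
  then have roots: "roots ?u = fib g ?u \<union> ?Z"
    using card_subset_eq[OF _ sub] finite_subset_carrier[of "roots ?u"] by (auto simp: roots_def)
  have "fib x ?u \<subseteq> roots ?u" using all by (auto simp: fib_def roots_def)
  then have cover: "fib x ?u \<subseteq> ?Z \<union> (fib x ?u \<inter> fib g ?u)" using roots by blast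
  \<comment> \<open>For h in both fibres g h x squares to 1, so it is central, and the intersection
    has at most q elements.\<close>
  have "inj_on (\<lambda>h. g \<otimes> h \<otimes> x) (fib x ?u \<inter> fib g ?u)"
    by (rule inj_onI) (use g x in \<open>auto simp: fib_def\<close>)
  moreover have "(\<lambda>h. g \<otimes> h \<otimes> x) ` (fib x ?u \<inter> fib g ?u) \<subseteq> center G"
  proof
    fix k assume "k \<in> (\<lambda>h. g \<otimes> h \<otimes> x) ` (fib x ?u \<inter> fib g ?u)"
    then obtain h where h: "k = g \<otimes> h \<otimes> x" "h \<in> carrier G" "cmt x h = ?u" "cmt g h = ?u"
      by (auto simp: fib_def)
    have uu: "?u \<otimes> ?u = \<one>" using central_mult_self[OF u(1)] .
    have "sq h = ?u" using all h by blast
    then have 1: "sq (g \<otimes> h) = ?u" using sq_prod[OF g(1) h(2)] sg h uu u by simp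
    have 2: "cmt (g \<otimes> h) x = \<one>"
      using cmt_prod_left[OF g(1) h(2) x(1)] cmt_sym[OF g(1) x(1)] cmt_sym[OF h(2) x(1)] g h uu by simp
    have "sq k = \<one>" unfolding h(1) using sq_prod[of "g \<otimes> h" x] 1 2 uu g h x by simp
    then show "k \<in> center G" using center_iff_sq g h x by simp
  qed
  ultimately have "card (fib x ?u \<inter> fib g ?u) \<le> ?q"
    using finite_center card_inj_on_le by blast
  moreover have "card (fib x ?u) \<le> card ?Z + card (fib x ?u \<inter> fib g ?u)"
  proof -
    have "card (fib x ?u) \<le> card (?Z \<union> (fib x ?u \<inter> fib g ?u))"
      by (rule card_mono[OF _ cover]) (use finite_center finite_fib in auto)
    then show ?thesis using card_Un_le order_trans by blast
  qed
  moreover have "card (fib x ?u) = ?q * ?q" using card_values(1)[OF x] u by simp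
  ultimately have "?q * ?q \<le> 2 * ?q" unfolding cardZ by linarith
  then show False using card_center_ge_3 unfolding mult_le_cancel2 by linarith
qed

text \<open>The q^2 elements g with [x,g] = x^2 include at least 2 q roots for each of the q - 2
  central values other than 1 and x^2, so 2 (q - 2) \<le> q. The order q = 3 is impossible in a
  2-group.\<close>

lemma card_center: "card (center G) = 4"
proof -
  let ?q = "card (center G)"
  obtain x where x: "x \<in> carrier G" "x \<notin> center G" using noncentral_ex by blast
  have q3: "3 \<le> ?q" by (rule card_center_ge_3)
  have two: "{\<one>, sq x} \<subseteq> center G" "card {\<one>, sq x} = 2" using x center_one sq_ne_one[OF x] by auto
  have "card (fib x (sq x)) = (\<Sum>z\<in>center G. \<Sum>g | g \<in> fib x (sq x) \<and> sq g = z. (1::nat))"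
    using finite_fib finite_center by (subst sum.group) (auto simp: fib_def)
  also have "\<dots> = (\<Sum>z\<in>center G. card (froots x z))"
    by (rule sum.cong) (auto simp: froots_def fib_def intro: arg_cong[where f = card])
  also have "\<dots> \<ge> (\<Sum>z\<in>center G - {\<one>, sq x}. card (froots x z))"
    by (rule sum_mono2) (use finite_center in auto)
  finally have "(\<Sum>z\<in>center G - {\<one>, sq x}. card (froots x z)) \<le> ?q * ?q"
    using card_values(1)[OF x] x by simp
  moreover have "(\<Sum>z\<in>center G - {\<one>, sq x}. 2 * ?q) \<le> (\<Sum>z\<in>center G - {\<one>, sq x}. card (froots x z))"
  proof (rule sum_mono)
    fix z assume "z \<in> center G - {\<one>, sq x}"
    then obtain g where "g \<in> froots x z" using froots_nonempty[OF x] by blast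
    then show "2 * ?q \<le> card (froots x z)" by (rule card_froots_ge[OF x])
  qed
  moreover have "card (center G - {\<one>, sq x}) = ?q - 2"
    using card_Diff_subset[OF _ two(1)] two(2) by simp
  then have "(\<Sum>z\<in>center G - {\<one>, sq x}. 2 * ?q) = (?q - 2) * (2 * ?q)" by simp
  ultimately have "(?q - 2) * (2 * ?q) \<le> ?q * ?q" by linarith
  then have "((?q - 2) * 2) * ?q \<le> ?q * ?q" by (simp only: mult.assoc)
  then have "(?q - 2) * 2 \<le> ?q" using q3 unfolding mult_le_cancel2 by linarith
  then have "?q = 3 \<or> ?q = 4" using q3 by auto
  moreover have "?q \<noteq> 3"
  proof
    assume "?q = 3"
    then have "3 dvd card (carrier G)" using card_carrier_fib[OF x] by simp
    then obtain n where "(3::nat) dvd 2 ^ n" using card_G by auto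
    then obtain i where i: "3 = (2::nat) ^ i" using divides_primepow_nat[OF p_prime] by blast
    then have "odd ((2::nat) ^ i)" by (metis odd_numeral)
    then have "i = 0" by simp
    then show False using i by simp
  qed
  ultimately show ?thesis by blast
qed

lemma card_carrier: "card (carrier G) = 64"
  using card_values(3) noncentral_ex card_center by auto

end

section \<open>The Suzuki group\<close>

context exceptional_2_group
begin

text \<open>Exponents are truth values because all squares are central and can be split off;
  addition of exponents becomes inequality of truth values.\<close>

definition pw :: "'a \<Rightarrow> bool \<Rightarrow> 'a" where
  "pw a i = (if i then a else \<one>)"

lemma pw_closed [simp]: "a \<in> carrier G \<Longrightarrow> pw a i \<in> carrier G"
  by (simp add: pw_def)

lemma pw_center [simp]: "a \<in> center G \<Longrightarrow> pw a i \<in> center G"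
  by (simp add: pw_def center_one)

lemma cmt_pw: "a \<in> carrier G \<Longrightarrow> b \<in> carrier G \<Longrightarrow> cmt (pw a i) (pw b j) = pw (cmt a b) (i \<and> j)"
  by (simp add: pw_def)

lemma cmt_pw_left: "a \<in> carrier G \<Longrightarrow> b \<in> carrier G \<Longrightarrow> cmt (pw a i) b = pw (cmt a b) i"
  by (simp add: pw_def)

lemma pw_pair_mult:
  assumes a: "a \<in> carrier G" and b: "b \<in> carrier G" and c: "cmt a b = \<one>"
  shows "(pw a i \<otimes> pw b j) \<otimes> (pw a i' \<otimes> pw b j') =
    (pw (sq a) (i \<and> i') \<otimes> pw (sq b) (j \<and> j')) \<otimes> (pw a (i \<noteq> i') \<otimes> pw b (j \<noteq> j'))"
proof -
  have G: "pw a i \<in> carrier G" "pw b j \<in> carrier G" "pw a i' \<in> carrier G" "pw b j' \<in> carrier G"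
    using a b by auto
  have merge: "pw d k \<otimes> pw d k' = pw (sq d) (k \<and> k') \<otimes> pw d (k \<noteq> k')" if "d \<in> carrier G" for d k k'
    using that by (simp add: pw_def sq_def)
  have swap: "pw b j \<otimes> pw a i' = pw a i' \<otimes> pw b j"
    using a b c cmt_eq_one_iff[OF a b] by (simp add: pw_def)
  have "(pw a i \<otimes> pw b j) \<otimes> (pw a i' \<otimes> pw b j') = pw a i \<otimes> ((pw b j \<otimes> pw a i') \<otimes> pw b j')"
    using G by (simp only: m_assoc m_closed)
  also have "\<dots> = (pw a i \<otimes> pw a i') \<otimes> (pw b j \<otimes> pw b j')"
    unfolding swap using G by (simp only: m_assoc m_closed)
  also have "\<dots> = (pw (sq a) (i \<and> i') \<otimes> pw a (i \<noteq> i')) \<otimes> (pw (sq b) (j \<and> j') \<otimes> pw b (j \<noteq> j'))"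
    unfolding merge[OF a] merge[OF b] ..
  also have "\<dots> = (pw (sq a) (i \<and> i') \<otimes> pw (sq b) (j \<and> j')) \<otimes> (pw a (i \<noteq> i') \<otimes> pw b (j \<noteq> j'))"
    by (rule central_product) (use a b in auto)
  finally show ?thesis .
qed

end

text \<open>The relations determine the product of any two normal forms x^i y^j g^k h^l up to order
  and central factors. The order 64 supplies surjectivity once the elements so described are known
  to be distinct.\<close>

locale g64_relations = exceptional_2_group +
  fixes x y g h u v
  assumes in_G: "x \<in> carrier G" "y \<in> carrier G" "g \<in> carrier G" "h \<in> carrier G"
    and uv_center: "u \<in> center G" "v \<in> center G"
    and uv_ne: "u \<noteq> \<one>" "v \<noteq> \<one>" "u \<noteq> v"
    and squares: "sq x = u" "sq y = v" "sq g = v" "sq h = u"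
    and commutators: "cmt x y = \<one>" "cmt g h = \<one>" "cmt x g = u" "cmt y g = u \<otimes> v" "cmt x h = v" "cmt y h = u"
    and card_64: "card (carrier G) = 64"
begin

definition cc :: "bool \<Rightarrow> bool \<Rightarrow> 'a" where
  "cc m n = pw u m \<otimes> pw v n"

lemma cc_center [simp]: "cc m n \<in> center G"
  using uv_center by (simp add: cc_def center_m_closed)

lemma cc_closed [simp]: "cc m n \<in> carrier G"
  using cc_center center_closed by blast

lemma uv_closed: "u \<in> carrier G" "v \<in> carrier G"
  using uv_center center_closed by auto

lemma cc_mult: "cc m n \<otimes> cc m' n' = cc (m \<noteq> m') (n \<noteq> n')"
proof -
  have "cmt u v = \<one>" using uv_center uv_closed by simp
  from pw_pair_mult[OF uv_closed this, of m n m' n'] show ?thesis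
    using uv_center uv_closed by (simp add: cc_def sq_central pw_def)
qed

lemma uv_ne_one: "u \<otimes> v \<noteq> \<one>"
  using uv_ne uv_closed central_mult_cancel[OF uv_center(1) uv_closed(2)] by auto

lemma cc_inj: "cc m n = cc m' n' \<longleftrightarrow> m = m' \<and> n = n'"
proof
  assume eq: "cc m n = cc m' n'"
  have "cc (m \<noteq> m') (n \<noteq> n') = cc m n \<otimes> cc m n" unfolding cc_mult[symmetric] eq ..
  then have "cc (m \<noteq> m') (n \<noteq> n') = \<one>" using central_mult_self[OF cc_center] by simp
  then show "m = m' \<and> n = n'"
    using uv_ne uv_ne_one uv_closed by (simp add: cc_def pw_def split: if_splits)
qed simp

lemma pw_cc: "pw u m = cc m False" "pw v n = cc False n" "pw (u \<otimes> v) m = cc m m"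
  using uv_closed by (simp_all add: cc_def pw_def)

definition rep :: "bool \<Rightarrow> bool \<Rightarrow> bool \<Rightarrow> bool \<Rightarrow> 'a" where
  "rep i j k l = (pw x i \<otimes> pw y j) \<otimes> (pw g k \<otimes> pw h l)"

lemma rep_closed [simp]: "rep i j k l \<in> carrier G"
  using in_G by (simp add: rep_def)

lemma commutators': "cmt y x = \<one>" "cmt h g = \<one>" "cmt g x = u" "cmt g y = u \<otimes> v" "cmt h x = v" "cmt h y = u"
  using commutators cmt_sym in_G by auto

text \<open>The only reordering across blocks moves the block in g and h past the block in x and y,
  at the cost of their commutator; squares of repeated letters supply the other central factors. The
  result matches \<open>cocycle_u\<close> and \<open>cocycle_v\<close>.\<close>

lemma rep_mult:
  "rep i j k l \<otimes> rep i' j' k' l' =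
    cc (((k \<and> i') \<noteq> (k \<and> j')) \<noteq> ((l \<and> j') \<noteq> ((i \<and> i') \<noteq> (l \<and> l'))))
       (((l \<and> i') \<noteq> (k \<and> j')) \<noteq> ((j \<and> j') \<noteq> (k \<and> k'))) \<otimes>
    rep (i \<noteq> i') (j \<noteq> j') (k \<noteq> k') (l \<noteq> l')"
proof -
  let ?A = "pw x i \<otimes> pw y j" and ?B = "pw g k \<otimes> pw h l"
  let ?A' = "pw x i' \<otimes> pw y j'" and ?B' = "pw g k' \<otimes> pw h l'"
  let ?A'' = "pw x (i \<noteq> i') \<otimes> pw y (j \<noteq> j')" and ?B'' = "pw g (k \<noteq> k') \<otimes> pw h (l \<noteq> l')"
  let ?c = "cc (i \<and> i') (j \<and> j')" and ?d = "cc (l \<and> l') (k \<and> k')" and ?e = "cmt ?B ?A'"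
  have G: "?A \<in> carrier G" "?B \<in> carrier G" "?A' \<in> carrier G" "?B' \<in> carrier G"
      "?A'' \<in> carrier G" "?B'' \<in> carrier G" using in_G by auto
  have e: "?e \<in> center G" "?e \<in> carrier G" using G by auto
  have AA: "?A \<otimes> ?A' = ?c \<otimes> ?A''"
    using pw_pair_mult[OF in_G(1,2) commutators(1)] squares by (simp add: cc_def)
  have BB: "?B \<otimes> ?B' = ?d \<otimes> ?B''"
    using pw_pair_mult[OF in_G(3,4) commutators(2)] squares uv_center
      centerD[of "pw u (l \<and> l')" "pw v (k \<and> k')"] uv_closed by (simp add: cc_def)
  have "?e = (pw u (k \<and> i') \<otimes> pw v (l \<and> i')) \<otimes> (pw (u \<otimes> v) (k \<and> j') \<otimes> pw u (l \<and> j'))"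
    using in_G by (simp add: cmt_prod_left cmt_prod_right cmt_pw commutators')
  then have e_eq: "?e = (cc (k \<and> i') False \<otimes> cc False (l \<and> i')) \<otimes> (cc (k \<and> j') (k \<and> j') \<otimes> cc (l \<and> j') False)"
    unfolding pw_cc .
  have "rep i j k l \<otimes> rep i' j' k' l' = ?A \<otimes> ((?B \<otimes> ?A') \<otimes> ?B')"
    unfolding rep_def using G by (simp only: m_assoc m_closed)
  also have "\<dots> = ?A \<otimes> ((?e \<otimes> (?A' \<otimes> ?B)) \<otimes> ?B')"
    by (subst cmt_swap[OF G(2,3)]) (rule refl)
  also have "\<dots> = ?A \<otimes> (?e \<otimes> (?A' \<otimes> ?B \<otimes> ?B'))"
    using G e by (simp only: m_assoc m_closed)
  also have "\<dots> = ?e \<otimes> (?A \<otimes> (?A' \<otimes> ?B \<otimes> ?B'))"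
    by (rule center_left_commute[OF e(1)]) (use G in auto)
  also have "\<dots> = ?e \<otimes> ((?A \<otimes> ?A') \<otimes> (?B \<otimes> ?B'))"
    using G by (simp only: m_assoc m_closed)
  also have "\<dots> = ?e \<otimes> ((?c \<otimes> ?d) \<otimes> (?A'' \<otimes> ?B''))"
    unfolding AA BB by (subst central_product) (use G in auto)
  also have "\<dots> = (?e \<otimes> (?c \<otimes> ?d)) \<otimes> rep (i \<noteq> i') (j \<noteq> j') (k \<noteq> k') (l \<noteq> l')"
    unfolding rep_def using G e by (simp only: m_assoc m_closed cc_closed)
  also have "?e \<otimes> (?c \<otimes> ?d) = cc (((k \<and> i') \<noteq> (k \<and> j')) \<noteq> ((l \<and> j') \<noteq> ((i \<and> i') \<noteq> (l \<and> l'))))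
       (((l \<and> i') \<noteq> (k \<and> j')) \<noteq> ((j \<and> j') \<noteq> (k \<and> k')))"
    unfolding e_eq cc_mult by (rule arg_cong2[where f = cc]) argo+
  finally show ?thesis .
qed

text \<open>Commutators with x and h read off all four exponents, so normal forms with different
  exponents lie in different cosets of the center.\<close>

lemma cmt_rep:
  "cmt (rep i j k l) x = cc k l" "cmt (rep i j k l) h = cc j i"
  using in_G commutators commutators' uv_closed centerD[of "pw u j" "pw v i"] uv_center
  by (simp_all add: rep_def cmt_prod_left cmt_pw_left cc_def) (simp_all add: pw_def)

text \<open>The first coordinate gives the exponents of the normal form; the second, relative to
  \<open>base\<close>, is an element of GF(4) whose bits 0 and 1 are the exponents of u and
  v.\<close>

definition point :: "nat \<times> nat \<Rightarrow> 'a" where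
  "point p = cc (bit (xor (base (fst p)) (snd p)) 0) (bit (xor (base (fst p)) (snd p)) 1) \<otimes>
    rep (cx (fst p)) (cy (fst p)) (cg (fst p)) (ch (fst p))"

lemma point_eq: "point (a, xor (base a) (bits m n)) = cc m n \<otimes> rep (cx a) (cy a) (cg a) (ch a)"
  by (simp only: point_def fst_conv snd_conv xor_left_cancel bits_bit)

lemma G64_cases:
  assumes "p \<in> carrier G64"
  obtains a m n where "p = (a, xor (base a) (bits m n))" "a < 16"
  using assms unfolding carrier_G64 by auto

theorem iso_G64: "G \<cong> G64"
proof (rule is_iso_symI)
  have hom: "point \<in> hom G64 G"
  proof (rule homI)
    fix p assume "p \<in> carrier G64"
    then obtain a m n where "p = (a, xor (base a) (bits m n))" by (rule G64_cases)
    then show "point p \<in> carrier G" by (simp only: point_eq m_closed cc_closed rep_closed)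
  next
    fix p q assume "p \<in> carrier G64" "q \<in> carrier G64"
    then obtain a m n c m' n' where pq: "p = (a, xor (base a) (bits m n))" "a < 16"
      "q = (c, xor (base c) (bits m' n'))" "c < 16" by (metis G64_cases)
    let ?r = "\<lambda>a. rep (cx a) (cy a) (cg a) (ch a)"
    have "point p \<otimes> point q = (cc m n \<otimes> cc m' n') \<otimes> (?r a \<otimes> ?r c)"
      unfolding pq point_eq by (rule central_product) auto
    also have "?r a \<otimes> ?r c = cc (cocycle_u a c) (cocycle_v a c) \<otimes> ?r (xor a c)"
      unfolding rep_mult cocycle_u_def cocycle_v_def coord_xor ..
    also have "(cc m n \<otimes> cc m' n') \<otimes> (cc (cocycle_u a c) (cocycle_v a c) \<otimes> ?r (xor a c))
      = ((cc m n \<otimes> cc m' n') \<otimes> cc (cocycle_u a c) (cocycle_v a c)) \<otimes> ?r (xor a c)"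
      by (simp only: m_assoc m_closed cc_closed rep_closed)
    also have "\<dots> = point (p \<otimes>\<^bsub>G64\<^esub> q)"
      unfolding pq mult_G64[OF pq(2,4)] point_eq cc_mult ..
    finally show "point (p \<otimes>\<^bsub>G64\<^esub> q) = point p \<otimes> point q" by simp
  qed
  have inj: "inj_on point (carrier G64)"
  proof (rule inj_onI)
    fix p q assume "p \<in> carrier G64" "q \<in> carrier G64" and eq: "point p = point q"
    then obtain a m n c m' n' where pq: "p = (a, xor (base a) (bits m n))" "a < 16"
      "q = (c, xor (base c) (bits m' n'))" "c < 16" by (metis G64_cases)
    let ?r = "\<lambda>a. rep (cx a) (cy a) (cg a) (ch a)"
    have eq': "cc m n \<otimes> ?r a = cc m' n' \<otimes> ?r c" using eq unfolding pq point_eq .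
    have cmt_r: "cmt (cc m n \<otimes> ?r a) t = cmt (?r a) t" if "t \<in> carrier G" for m n a t
      using that cmt_prod_left[of "cc m n" "?r a" t] by simp
    have "cc (cg a) (ch a) = cc (cg c) (ch c)"
      using cmt_r[OF in_G(1), of m n a] cmt_r[OF in_G(1), of m' n' c] unfolding eq' cmt_rep by simp
    moreover have "cc (cy a) (cx a) = cc (cy c) (cx c)"
      using cmt_r[OF in_G(4), of m n a] cmt_r[OF in_G(4), of m' n' c] unfolding eq' cmt_rep by simp
    ultimately have ac: "a = c" using coord_inj[OF pq(2,4)] unfolding cc_inj by blast
    then have "cc m n = cc m' n'" using eq' by simp
    then show "p = q" using ac unfolding cc_inj pq by simp
  qed
  have "point ` carrier G64 = carrier G"
  proof (rule card_subset_eq[OF fin])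
    show "point ` carrier G64 \<subseteq> carrier G" using hom by (auto simp: hom_def)
    show "card (point ` carrier G64) = card (carrier G)"
      using card_image[OF inj] card_G64 card_64 by simp
  qed
  then show "point \<in> iso G64 G" using hom inj by (simp add: iso_def bij_betw_def)
next
  fix p q assume "p \<in> carrier G64" "q \<in> carrier G64"
  then obtain a m n c m' n' where pq: "p = (a, xor (base a) (bits m n))" "a < 16"
    "q = (c, xor (base c) (bits m' n'))" "c < 16" by (metis G64_cases)
  show "p \<otimes>\<^bsub>G64\<^esub> q \<in> carrier G64"
    unfolding pq mult_G64[OF pq(2,4)] carrier_G64
    using xor_less_16[OF pq(2,4)]
    by (intro image_eqI[of _ _ "(xor a c, (m \<noteq> m') \<noteq> cocycle_u a c, (n \<noteq> n') \<noteq> cocycle_v a c)"]) simp_all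
qed

end

section \<open>Choosing generators in the group of order 64\<close>

context full_commutators
begin

lemma card_fib_one: "x \<in> carrier G \<Longrightarrow> x \<notin> center G \<Longrightarrow> card (fib x \<one>) = 16"
  using card_values(1)[of x \<one>] card_center center_one by simp

lemma card_coset: "t \<in> carrier G \<Longrightarrow> card ((\<lambda>c. t \<otimes> c) ` center G) = 4"
  using card_image[OF inj_mult_left[of t "center G"]] card_center center_closed by auto

text \<open>All squares are central, so s t can stand for the quotient of s by t modulo the
  center.\<close>

lemma cosets_disjoint:
  assumes s: "s \<in> carrier G" and t: "t \<in> carrier G" and "s \<otimes> t \<notin> center G"
  shows "(\<lambda>c. s \<otimes> c) ` center G \<inter> (\<lambda>c. t \<otimes> c) ` center G = {}"
proof (rule ccontr)
  assume "\<not> ?thesis"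
  then obtain c d where cd: "c \<in> center G" "d \<in> center G" "s \<otimes> c = t \<otimes> d" by blast
  have G: "c \<in> carrier G" "d \<in> carrier G" using cd center_closed by auto
  have "s = s \<otimes> (c \<otimes> c)" using central_mult_self[OF cd(1)] s by simp
  also have "\<dots> = t \<otimes> (d \<otimes> c)" using cd(3) s t G by (simp add: m_assoc[symmetric])
  finally have "s \<otimes> t = t \<otimes> (d \<otimes> c) \<otimes> t" by simp
  also have "\<dots> = (d \<otimes> c) \<otimes> t \<otimes> t"
    by (subst centerD[OF center_m_closed[OF cd(2,1)] t, symmetric]) (rule refl)
  also have "\<dots> = (d \<otimes> c) \<otimes> sq t" using t G by (simp only: sq_def m_assoc m_closed)
  finally have "s \<otimes> t \<in> center G" using cd t center_m_closed by simp
  then show False using assms by simp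
qed

text \<open>The centralizer of x has 16 elements, while the center and its coset by x cover only
  8.\<close>

lemma cent_independent_ex:
  assumes x: "x \<in> carrier G" "x \<notin> center G"
  shows "\<exists>y \<in> carrier G. cmt x y = \<one> \<and> y \<notin> center G \<and> x \<otimes> y \<notin> center G"
proof (rule ccontr)
  assume no: "\<not> ?thesis"
  have "fib x \<one> \<subseteq> center G \<union> (\<lambda>c. x \<otimes> c) ` center G"
  proof
    fix y assume "y \<in> fib x \<one>"
    then have y: "y \<in> carrier G" "cmt x y = \<one>" by (auto simp: fib_def)
    show "y \<in> center G \<union> (\<lambda>c. x \<otimes> c) ` center G"
    proof (cases "y \<in> center G")
      case False
      then have xy: "x \<otimes> y \<in> center G" using no y by blast
      have "x \<otimes> (sq x \<otimes> (x \<otimes> y)) = (sq x \<otimes> sq x) \<otimes> y"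
        using x y center_left_commute[OF sq_center[OF x(1)] x(1), of "x \<otimes> y"]
        by (simp add: sq_def m_assoc)
      then have "y = x \<otimes> (sq x \<otimes> (x \<otimes> y))" using central_mult_self x y by simp
      moreover have "sq x \<otimes> (x \<otimes> y) \<in> center G" using xy x center_m_closed by simp
      ultimately show ?thesis by blast
    qed simp
  qed
  then have "card (fib x \<one>) \<le> card (center G \<union> (\<lambda>c. x \<otimes> c) ` center G)"
    using finite_center by (intro card_mono) auto
  also have "\<dots> \<le> card (center G) + card ((\<lambda>c. x \<otimes> c) ` center G)" by (rule card_Un_le)
  finally show False using card_fib_one[OF x] card_coset[OF x(1)] card_center by simp
qed

text \<open>The cosets of 1, x, y and x y are disjoint and have 4 elements each, which exhausts the
  centralizer of order 16.\<close>

lemma cent_cases: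
  assumes x: "x \<in> carrier G" "x \<notin> center G"
    and y: "y \<in> carrier G" "cmt x y = \<one>" "y \<notin> center G" "x \<otimes> y \<notin> center G"
    and a: "a \<in> carrier G" "cmt x a = \<one>"
  obtains t c where "t = \<one> \<or> t = x \<or> t = y \<or> t = x \<otimes> y" "c \<in> center G" "a = t \<otimes> c"
proof -
  let ?K = "\<lambda>t. (\<lambda>c. t \<otimes> c) ` center G"
  let ?U = "(?K \<one> \<union> ?K x) \<union> (?K y \<union> ?K (x \<otimes> y))"
  have G: "x \<otimes> y \<in> carrier G" using x y by simp
  have xy: "y \<otimes> x = x \<otimes> y" using cmt_eq_one_iff[OF x(1) y(1)] y by simp
  have cancel: "\<And>r c. r \<in> carrier G \<Longrightarrow> c \<in> center G \<Longrightarrow> c \<otimes> r \<in> center G \<Longrightarrow> r \<in> center G"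
    using central_mult_cancel center_m_closed by metis
  have "x \<otimes> (x \<otimes> y) = sq x \<otimes> y" using x y by (simp add: sq_def m_assoc)
  then have n1: "x \<otimes> (x \<otimes> y) \<notin> center G" using cancel[of y "sq x"] x y by auto
  have "y \<otimes> (x \<otimes> y) = (y \<otimes> x) \<otimes> y" using x y by (simp add: m_assoc)
  also have "\<dots> = x \<otimes> sq y" unfolding xy using x y by (simp add: sq_def m_assoc)
  also have "\<dots> = sq y \<otimes> x" using centerD[OF sq_center[OF y(1)] x(1)] by simp
  finally have n2: "y \<otimes> (x \<otimes> y) \<notin> center G" using cancel[of x "sq y"] x y by auto
  have d: "?K \<one> \<inter> ?K x = {}" "?K y \<inter> ?K (x \<otimes> y) = {}" "?K \<one> \<inter> ?K y = {}"
      "?K \<one> \<inter> ?K (x \<otimes> y) = {}" "?K x \<inter> ?K y = {}" "?K x \<inter> ?K (x \<otimes> y) = {}"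
    by (rule cosets_disjoint; use x y n1 n2 in simp)+
  have fK: "finite (?K t)" for t using finite_center by (rule finite_imageI)
  have "card (?K \<one> \<union> ?K x) = 8" "card (?K y \<union> ?K (x \<otimes> y)) = 8"
    unfolding card_Un_disjoint[OF fK fK d(1)] card_Un_disjoint[OF fK fK d(2)]
      card_coset[OF one_closed] card_coset[OF x(1)] card_coset[OF y(1)] card_coset[OF G] by simp_all
  moreover have "(?K \<one> \<union> ?K x) \<inter> (?K y \<union> ?K (x \<otimes> y)) = {}"
    unfolding Int_Un_distrib Int_Un_distrib2 d by simp
  moreover have "finite (?K \<one> \<union> ?K x)" "finite (?K y \<union> ?K (x \<otimes> y))" using fK by simp_all
  ultimately have card: "card ?U = 16" using card_Un_disjoint[of "?K \<one> \<union> ?K x" "?K y \<union> ?K (x \<otimes> y)"] by linarith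
  have K: "?K t \<subseteq> fib x \<one>" if "t \<in> carrier G" "cmt x t = \<one>" for t
    using that x center_closed by (auto simp: fib_def cmt_prod_right)
  have "cmt x (x \<otimes> y) = \<one>" using cmt_prod_right[OF x(1) x(1) y(1)] x y by simp
  then have "?U \<subseteq> fib x \<one>"
    using K[OF one_closed] K[OF x(1)] K[OF y(1,2)] K[OF G] x by simp
  then have "?U = fib x \<one>"
    using card_subset_eq[OF finite_fib] card_fib_one[OF x] card by presburger
  moreover have "a \<in> fib x \<one>" using a by (simp add: fib_def)
  ultimately have "a \<in> ?U" by (simp only:)
  then show thesis using that by blast
qed

text \<open>With x and y commuting and independent modulo the center, g is taken from
  \<open>froots\<close> and h from the centralizer of g. Excluding all but one value for each
  remaining square and commutator yields the relations of \<open>g64_relations\<close>.\<close>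

theorem iso_G64: "G \<cong> G64"
proof -
  obtain x where x: "x \<in> carrier G" "x \<notin> center G" using noncentral_ex by blast
  obtain y where y: "y \<in> carrier G" "cmt x y = \<one>" "y \<notin> center G" "x \<otimes> y \<notin> center G"
    using cent_independent_ex[OF x] by blast
  define u where "u = sq x"
  define v where "v = sq y"
  define w where "w = u \<otimes> v"
  have u: "u \<in> center G" "u \<noteq> \<one>" and v: "v \<in> center G" "v \<noteq> \<one>"
    using x y sq_ne_one by (auto simp: u_def v_def)
  have w: "w \<in> center G" unfolding w_def using u v center_m_closed by blast
  have G: "u \<in> carrier G" "v \<in> carrier G" "w \<in> carrier G" using u v w center_closed by auto
  have sq_xy: "sq (x \<otimes> y) = w" using sq_prod[OF x(1) y(1)] y G by (simp add: u_def v_def w_def)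
  then have w1: "w \<noteq> \<one>" using sq_ne_one[of "x \<otimes> y"] x y by simp
  have uu: "u \<otimes> u = \<one>" and vv: "v \<otimes> v = \<one>" and ww: "w \<otimes> w = \<one>"
    using central_mult_self u v w by auto
  have uw: "u \<otimes> w = v" unfolding w_def using central_mult_cancel[OF u(1) G(2)] .
  have wu: "w \<otimes> u = v" using centerD[OF w G(1)] uw by simp
  have vu: "v \<otimes> u = w" using centerD[OF v(1) G(1)] by (simp add: w_def)
  have wv: "w \<otimes> v = u" using vv G by (simp add: w_def m_assoc)
  have vw: "v \<otimes> w = u" using centerD[OF v(1) G(3)] wv by simp
  have uv: "u \<noteq> v" using uu w1 by (auto simp: w_def)
  have uw_ne: "u \<noteq> w" and vw_ne: "v \<noteq> w" using uu uw vw vv u v by auto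
  note table = uu vv ww uw wu vu wv vw w_def[symmetric]
  have cen: "c = \<one> \<or> c = u \<or> c = v \<or> c = w" if c: "c \<in> center G" for c
  proof -
    have "card {\<one>, u, v, w} = 4" using u v w1 uv uw_ne vw_ne by simp
    moreover have "{\<one>, u, v, w} \<subseteq> center G" using u v w center_one by simp
    ultimately have "{\<one>, u, v, w} = center G"
      using card_subset_eq[OF finite_center] card_center by simp
    then show ?thesis using c by blast
  qed
  \<comment> \<open>The elements x, y and x y have the same centralizer, generated by x, y and the
    center.\<close>
  have A: "cmt x a = \<one>" "cmt y a = \<one>" if a: "a \<in> carrier G"
    and or: "cmt x a = \<one> \<or> cmt y a = \<one> \<or> cmt (x \<otimes> y) a = \<one>" for a
  proof -
    have yx: "cmt y x = \<one>" using cmt_sym[OF x(1) y(1)] y by simp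
    have yx_ne: "y \<otimes> x \<notin> center G" using cmt_eq_one_iff[OF x(1) y(1)] y by simp
    have xyx: "cmt (x \<otimes> y) x = \<one>" using cmt_prod_left[OF x(1) y(1) x(1)] yx x by simp
    have "(x \<otimes> y) \<otimes> x = u \<otimes> y"
      using cmt_eq_one_iff[of "x \<otimes> y" x] xyx x y by (simp add: u_def sq_def m_assoc)
    then have xyx_ne: "(x \<otimes> y) \<otimes> x \<notin> center G"
      using central_mult_cancel[OF u(1) y(1)] center_m_closed[OF u(1)] y by metis
    have "\<exists>t c. (t = \<one> \<or> t = x \<or> t = y \<or> t = x \<otimes> y \<or> t = y \<otimes> x \<or> t = (x \<otimes> y) \<otimes> x) \<and> c \<in> center G \<and> a = t \<otimes> c"
      using or
    proof (elim disjE)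
      assume "cmt x a = \<one>"
      then show ?thesis by (rule cent_cases[OF x y a]) blast
    next
      assume "cmt y a = \<one>"
      then show ?thesis by (rule cent_cases[OF y(1,3) x(1) yx x(2) yx_ne a]) blast
    next
      assume "cmt (x \<otimes> y) a = \<one>"
      then show ?thesis by (rule cent_cases[OF m_closed[OF x(1) y(1)] y(4) x(1) xyx x(2) xyx_ne a]) blast
    qed
    then obtain t c where tc: "t = \<one> \<or> t = x \<or> t = y \<or> t = x \<otimes> y \<or> t = y \<otimes> x \<or> t = (x \<otimes> y) \<otimes> x"
      "c \<in> center G" "a = t \<otimes> c" by blast
    have cG: "c \<in> carrier G" using tc center_closed by blast
    from tc(1) show "cmt x a = \<one>" "cmt y a = \<one>"
      unfolding tc(3) using x y yx tc(2) cG by (elim disjE; simp add: cmt_prod_right)+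
  qed
  obtain g where g: "g \<in> carrier G" "cmt x g = u" "sq g = v"
    using froots_nonempty[OF x v] uv by (auto simp: froots_def u_def)
  have gnc: "g \<notin> center G" using g x u by auto
  have yg: "cmt y g = w"
  proof -
    have "cmt y g \<noteq> \<one>" using A[OF g(1)] g u by auto
    moreover have "cmt y g \<noteq> u"
    proof
      assume "cmt y g = u"
      then have "cmt (x \<otimes> y) g = \<one>" using cmt_prod_left[OF x(1) y(1) g(1)] g uu by simp
      then show False using A[OF g(1)] g u by auto
    qed
    \<comment> \<open>If [y,g] = v, then [t,g] = t^2 for t = 1, x, y, x y, so multiplying g by such
      a t keeps its square v. But some g' with square w has the same commutator with x, so it is
      such a multiple up to a central factor.\<close>
    moreover have "cmt y g \<noteq> v"
    proof
      assume ygv: "cmt y g = v"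
      obtain g' where g': "g' \<in> carrier G" "cmt x g' = u" "sq g' = w"
        using froots_nonempty[OF x w w1] uw_ne by (auto simp: froots_def u_def)
      let ?a = "inv g \<otimes> g'"
      have aG: "?a \<in> carrier G" using g g' by simp
      have g'_eq: "g' = g \<otimes> ?a" using g g' by (simp add: m_assoc[symmetric])
      have "cmt x g' = cmt x g \<otimes> cmt x ?a" using cmt_prod_right[OF x(1) g(1) aG] g'_eq by simp
      then have "cmt x ?a = \<one>" using g g' G aG x by simp
      then obtain t c where tc: "t = \<one> \<or> t = x \<or> t = y \<or> t = x \<otimes> y" "c \<in> center G" "?a = t \<otimes> c"
        by (rule cent_cases[OF x y aG])
      have t: "t \<in> carrier G" using tc x y by auto
      have cG: "c \<in> carrier G" using tc center_closed by blast
      have "cmt t g = sq t"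
        using tc(1) g x y ygv sq_xy G
        by (elim disjE) (simp_all add: u_def v_def w_def cmt_prod_left sq_central center_one)
      then have "cmt g ?a = sq t" unfolding tc(3) using cmt_sym t g cG tc(2) by (simp add: cmt_prod_right)
      moreover have "sq ?a = sq t" unfolding tc(3) using sq_prod_central t tc by simp
      ultimately have "sq g' = sq g \<otimes> sq t \<otimes> sq t" using sq_prod[OF g(1) aG] g'_eq by simp
      also have "\<dots> = sq g" using g G t central_mult_self[OF sq_center[OF t]] by (simp add: m_assoc)
      finally show False using g g' vw_ne by simp
    qed
    ultimately show ?thesis using cen[OF cmt_center[OF y(1) g(1)]] by blast
  qed
  \<comment> \<open>Otherwise k commutes with x, y or x y and so lies in one of the cosets of 1, x,
    y, x y. As [g,t] is u, w, v for the last three, only a central k would commute with g.\<close>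
  have key: "cmt x k \<noteq> \<one> \<and> cmt y k \<noteq> \<one> \<and> cmt x k \<noteq> cmt y k"
    if k: "k \<in> carrier G" "cmt g k = \<one>" "k \<notin> center G" for k
  proof (rule ccontr)
    assume no: "\<not> ?thesis"
    have "cmt (x \<otimes> y) k = \<one>" if "cmt x k = cmt y k"
      using cmt_prod_left[OF x(1) y(1) k(1)] that central_mult_self[OF cmt_center[OF y(1) k(1)]] by simp
    then have "cmt x k = \<one>" using A[OF k(1)] no by blast
    then obtain t c where tc: "t = \<one> \<or> t = x \<or> t = y \<or> t = x \<otimes> y" "c \<in> center G" "k = t \<otimes> c"
      by (rule cent_cases[OF x y k(1)])
    have t: "t \<in> carrier G" using tc x y by auto
    have cG: "c \<in> carrier G" using tc center_closed by blast
    have "cmt g t = \<one>" using k(2) tc(2) t g cG unfolding tc(3) by (simp add: cmt_prod_right)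
    moreover have "cmt g x = u" "cmt g y = w" "cmt g (x \<otimes> y) = v"
      using cmt_sym g x y yg uw cmt_prod_right[OF g(1) x(1) y(1)] by auto
    ultimately have "t = \<one>" using tc(1) u v w1 by auto
    then show False using k tc cG by simp
  qed
  obtain h0 where h0: "h0 \<in> carrier G" "cmt g h0 = \<one>" "h0 \<notin> center G" "g \<otimes> h0 \<notin> center G"
    using cent_independent_ex[OF g(1) gnc] by blast
  have gh0: "cmt g (g \<otimes> h0) = \<one>" using cmt_prod_right[OF g(1) g(1) h0(1)] h0 g by simp
  have xgh0: "cmt x (g \<otimes> h0) = u \<otimes> cmt x h0" using cmt_prod_right[OF x(1) g(1) h0(1)] g by simp
  have "cmt x h0 \<noteq> u"
  proof
    assume "cmt x h0 = u"
    then show False using key[of "g \<otimes> h0"] gh0 xgh0 uu h0 g by simp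
  qed
  then have "cmt x h0 = v \<or> cmt x h0 = w" using cen[OF cmt_center[OF x(1) h0(1)]] key[OF h0(1-3)] by blast
  \<comment> \<open>Replacing h0 by g h0 multiplies [x,h0] by u, which exchanges w and v.\<close>
  then have "\<exists>h \<in> carrier G. cmt g h = \<one> \<and> cmt x h = v"
  proof
    assume "cmt x h0 = w"
    then show ?thesis using xgh0 gh0 uw g h0 by (intro bexI[of _ "g \<otimes> h0"]) auto
  qed (use h0 in blast)
  then obtain h where h: "h \<in> carrier G" "cmt g h = \<one>" "cmt x h = v" by blast
  have hnc: "h \<notin> center G" using h x v by auto
  have xgh: "cmt x (g \<otimes> h) = w" using cmt_prod_right[OF x(1) g(1) h(1)] g h by (simp add: w_def)
  then have ghnc: "g \<otimes> h \<notin> center G" using x w1 by auto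
  \<comment> \<open>The values 1 and v are excluded by \<open>key\<close> for h, the value w by
    \<open>key\<close> for g h.\<close>
  have yh: "cmt y h = u"
  proof -
    have "cmt y h \<noteq> \<one>" "cmt y h \<noteq> v" using key[OF h(1,2) hnc] h by auto
    moreover have "cmt y h \<noteq> w"
    proof
      assume "cmt y h = w"
      then have "cmt y (g \<otimes> h) = \<one>" using cmt_prod_right[OF y(1) g(1) h(1)] yg ww by simp
      moreover have "cmt g (g \<otimes> h) = \<one>" using cmt_prod_right[OF g(1) g(1) h(1)] h g by simp
      ultimately show False using key[of "g \<otimes> h"] g h ghnc by simp
    qed
    ultimately show ?thesis using cen[OF cmt_center[OF y(1) h(1)]] by blast
  qed
  \<comment> \<open>With h^2 = v the element g h, and with h^2 = w the element x h, would square to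
    1 and be central.\<close>
  have sh: "sq h = u"
  proof -
    have "sq h \<noteq> \<one>" using sq_ne_one[OF h(1) hnc] .
    moreover have "sq h \<noteq> v"
    proof
      assume "sq h = v"
      then have "sq (g \<otimes> h) = \<one>" using sq_prod[OF g(1) h(1)] g h vv by simp
      then show False using sq_ne_one[OF _ ghnc] g h by simp
    qed
    moreover have "sq h \<noteq> w"
    proof
      assume "sq h = w"
      then have "sq (x \<otimes> h) = \<one>"
        using sq_prod[OF x(1) h(1)] h uw vv by (simp add: u_def[symmetric])
      then have "x \<otimes> h \<in> center G" using center_iff_sq x h by simp
      then have "cmt x (x \<otimes> h) = \<one>" using x by simp
      then show False using cmt_prod_right[OF x(1) x(1) h(1)] h x v G by simp
    qed
    ultimately show ?thesis using cen[OF sq_center[OF h(1)]] by blast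
  qed
  interpret g64_relations G x y g h u v
    by unfold_locales
      (use x y g h u v uv yg yh sh card_carrier in \<open>simp_all add: u_def[symmetric] v_def[symmetric] w_def\<close>)
  show ?thesis by (rule iso_G64)
qed

end

section \<open>Homocyclic groups and the classification\<close>

lemma carrier_homocyclic_model:
  "0 < p \<Longrightarrow> f \<in> carrier (homocyclic_model p e k) \<longleftrightarrow>
    (\<forall>i<k. 0 \<le> f i \<and> f i < int (p ^ e)) \<and> (\<forall>i\<ge>k. f i = 0)"
  by (auto simp: homocyclic_model_def carrier_integer_mod_group)

lemma mult_homocyclic_model:
  "f \<otimes>\<^bsub>homocyclic_model p e k\<^esub> g = (\<lambda>i. if i < k then (f i + g i) mod int (p ^ e) else 0)"
  by (auto simp: homocyclic_model_def fun_eq_iff)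

lemma homocyclic_model_closed:
  "0 < p \<Longrightarrow> f \<otimes>\<^bsub>homocyclic_model p e k\<^esub> g \<in> carrier (homocyclic_model p e k)"
  by (simp add: carrier_homocyclic_model mult_homocyclic_model)

text \<open>A copy of the k-fold power of the cyclic group of order p^e inside G, to be enlarged by
  one factor as long as it is not everything.\<close>

locale homocyclic_embedding = comm_group +
  fixes p e k :: nat and \<psi>
  assumes p_prime: "Factorial_Ring.prime p"
    and fin: "finite (carrier G)"
    and exponent: "x \<in> carrier G \<Longrightarrow> x [^] (p ^ e) = \<one>"
    and roots: "x \<in> carrier G \<Longrightarrow> x [^] p = \<one> \<Longrightarrow> \<exists>g \<in> carrier G. g [^] (p ^ (e - 1)) = x"
    and hom: "\<psi> \<in> hom (homocyclic_model p e k) G"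
    and inj: "inj_on \<psi> (carrier (homocyclic_model p e k))"
begin

abbreviation (input) "M \<equiv> homocyclic_model p e k"
abbreviation (input) "H \<equiv> \<psi> ` carrier (homocyclic_model p e k)"

lemma p_pos: "0 < p" using p_prime by (rule prime_gt_0_nat)

lemmas carrier_M = carrier_homocyclic_model[OF p_pos]

lemma H_closed: "y \<in> H \<Longrightarrow> y \<in> carrier G"
  using hom by (auto simp: hom_def)

lemma hom_mult': "f \<in> carrier M \<Longrightarrow> g \<in> carrier M \<Longrightarrow> \<psi> (f \<otimes>\<^bsub>M\<^esub> g) = \<psi> f \<otimes> \<psi> g"
  using hom by (simp add: hom_def)

lemma zero_M: "(\<lambda>i. 0) \<in> carrier M"
  using p_pos by (simp add: carrier_M)

lemma hom_zero: "\<psi> (\<lambda>i. 0) = \<one>"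
proof -
  have "(\<lambda>i. 0) \<otimes>\<^bsub>M\<^esub> (\<lambda>i. 0) = (\<lambda>i. 0)" by (auto simp: mult_homocyclic_model fun_eq_iff)
  then have "\<psi> (\<lambda>i. 0) \<otimes> \<psi> (\<lambda>i. 0) = \<psi> (\<lambda>i. 0)" using hom_mult'[OF zero_M zero_M] by simp
  moreover have "\<psi> (\<lambda>i. 0) \<in> carrier G" using H_closed zero_M by blast
  ultimately show ?thesis by simp
qed

lemma H_mult: "y \<in> H \<Longrightarrow> z \<in> H \<Longrightarrow> y \<otimes> z \<in> H"
proof -
  assume "y \<in> H" "z \<in> H"
  then obtain f g where fg: "f \<in> carrier M" "g \<in> carrier M" "y = \<psi> f" "z = \<psi> g" by blast
  then have "y \<otimes> z = \<psi> (f \<otimes>\<^bsub>M\<^esub> g)" using hom_mult' by simp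
  then show ?thesis using homocyclic_model_closed[OF p_pos] by blast
qed

lemma H_one: "\<one> \<in> H" using hom_zero zero_M by (metis imageI)

lemma H_pow: "y \<in> H \<Longrightarrow> y [^] (n::nat) \<in> H"
  by (induction n) (auto intro: H_mult H_one simp del: image_iff)

lemma H_int_pow: "y \<in> H \<Longrightarrow> y [^] (l::int) \<in> H"
proof -
  assume y: "y \<in> H"
  then have yG: "y \<in> carrier G" by (rule H_closed)
  have pos: "0 < ord y" using ord_ge_1[OF fin yG] by simp
  have "y [^] l = y [^] int (nat (l mod int (ord y)))"
    using int_pow_eq[OF yG, of l "l mod int (ord y)"] pos by (simp add: mod_eq_dvd_iff[symmetric])
  then show ?thesis unfolding int_pow_int using H_pow[OF y] by simp
qed

lemma H_inv: "y \<in> H \<Longrightarrow> inv y \<in> H"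
  using H_int_pow[of y "-1"] H_closed[of y] int_pow_neg[of y 1] by (simp add: int_pow_1)

lemma hom_multiple:
  assumes a: "a \<in> carrier M"
  shows "\<psi> (\<lambda>i. if i < k then (int n * a i) mod int (p ^ e) else 0) = \<psi> a [^] n"
proof (induction n)
  case 0
  have "(\<lambda>i. if i < k then (int 0 * a i) mod int (p ^ e) else 0) = (\<lambda>i. 0)" by auto
  then show ?case using hom_zero by simp
next
  case (Suc n)
  let ?f = "\<lambda>i. if i < k then (int n * a i) mod int (p ^ e) else 0"
  have f: "?f \<in> carrier M" using p_pos by (simp add: carrier_M)
  have "(\<lambda>i. if i < k then (int (Suc n) * a i) mod int (p ^ e) else 0) = ?f \<otimes>\<^bsub>M\<^esub> a"
    by (auto simp: mult_homocyclic_model fun_eq_iff mod_simps algebra_simps)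
  then show ?case using hom_mult'[OF f a] Suc by simp
qed

text \<open>For t outside H let r be the last of t, t^p, t^(p^2), ... before H is reached, so r^p
  lies in H. The exponent bound makes r^p the p-th power of an element of H, and dividing r by that
  element gives the required v.\<close>

lemma p_torsion_outside_ex:
  assumes "H \<noteq> carrier G"
  shows "\<exists>v \<in> carrier G. v [^] p = \<one> \<and> v \<notin> H"
proof -
  obtain t where t: "t \<in> carrier G" "t \<notin> H" using assms H_closed by blast
  have "e \<noteq> 0"
  proof
    assume "e = 0"
    then have "t = \<one>" using exponent[OF t(1)] t by simp
    then show False using t H_one by simp
  qed
  define i where "i = (LEAST i. t [^] (p ^ i) \<in> H)"
  have "t [^] (p ^ e) \<in> H" using t exponent H_one by simp
  then have i: "t [^] (p ^ i) \<in> H" unfolding i_def by (rule LeastI)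
  have "i \<noteq> 0"
  proof
    assume "i = 0" then show False using i t by simp
  qed
  then obtain j where j: "i = Suc j" using not0_implies_Suc by blast
  define r where "r = t [^] (p ^ j)"
  have r: "r \<in> carrier G" "r \<notin> H"
    using t not_less_Least[of j "\<lambda>i. t [^] (p ^ i) \<in> H"] j unfolding i_def r_def by auto
  have "r [^] p \<in> H" using i t unfolding j r_def by (simp add: nat_pow_pow mult.commute)
  then obtain a where a: "a \<in> carrier M" "r [^] p = \<psi> a" by blast
  have "\<psi> a [^] (p ^ (e - 1)) = r [^] (p ^ Suc (e - 1))" unfolding a(2)[symmetric] using r by (simp add: nat_pow_pow)
  then have "\<psi> a [^] (p ^ (e - 1)) = \<one>" using exponent[OF r(1)] \<open>e \<noteq> 0\<close> by simp
  \<comment> \<open>In coordinates, p^(e-1) a = 0 modulo p^e means that p divides every coordinate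
    of a, so that a = p b.\<close>
  then have "\<psi> (\<lambda>i. if i < k then (int (p ^ (e - 1)) * a i) mod int (p ^ e) else 0) = \<psi> (\<lambda>i. 0)"
    unfolding hom_multiple[OF a(1)] hom_zero .
  then have "(\<lambda>i. if i < k then (int (p ^ (e - 1)) * a i) mod int (p ^ e) else 0) = (\<lambda>i. 0)"
    by (rule inj_onD[OF inj _ _ zero_M]) (use p_pos in \<open>simp add: carrier_M\<close>)
  then have "(int (p ^ (e - 1)) * a i) mod int (p ^ e) = 0" if "i < k" for i
    using that by (metis (no_types, lifting))
  then have dvd: "int p dvd a i" if "i < k" for i
  proof -
    have "int (p ^ (e - 1)) * int p dvd int (p ^ (e - 1)) * a i"
      using \<open>\<And>i. i < k \<Longrightarrow> _\<close>[OF that] \<open>e \<noteq> 0\<close>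
      by (metis Suc_pred' bot_nat_0.not_eq_extremum dvd_eq_mod_eq_0 of_nat_mult power_Suc2)
    then show ?thesis using p_pos by simp
  qed
  define b where "b = (\<lambda>i. a i div int p)"
  have a_bounds: "0 \<le> a i" "a i < int (p ^ e)" if "i < k" for i using a that by (auto simp: carrier_M)
  have a_zero: "a i = 0" if "k \<le> i" for i using a that by (auto simp: carrier_M)
  have b: "b \<in> carrier M"
    unfolding carrier_M
  proof (intro conjI allI impI)
    fix i assume i: "i < k"
    show "0 \<le> b i" using a_bounds[OF i] p_pos by (simp add: b_def pos_imp_zdiv_nonneg_iff)
    have "b i \<le> a i" using a_bounds[OF i] p_pos zdiv_mono2[of "a i" 1 "int p"] by (simp add: b_def)
    then show "b i < int (p ^ e)" using a_bounds[OF i] by simp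
  next
    fix i assume "k \<le> i"
    then show "b i = 0" using a_zero by (simp add: b_def)
  qed
  have "(\<lambda>i. if i < k then (int p * b i) mod int (p ^ e) else 0) = a"
  proof
    fix i
    show "(if i < k then (int p * b i) mod int (p ^ e) else 0) = a i"
      using a_bounds[of i] a_zero[of i] dvd[of i] by (auto simp: b_def)
  qed
  then have ab: "\<psi> a = \<psi> b [^] p" using hom_multiple[OF b, of p] by simp
  have bG: "\<psi> b \<in> H" "\<psi> b \<in> carrier G" using b H_closed by auto
  let ?v = "r \<otimes> inv (\<psi> b)"
  have "?v [^] p = r [^] p \<otimes> inv (\<psi> b [^] p)"
    using r bG by (simp add: nat_pow_distrib nat_pow_inv)
  then have "?v [^] p = \<one>" using a ab r bG by simp
  moreover have "?v \<notin> H"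
  proof
    assume "?v \<in> H"
    then have "?v \<otimes> \<psi> b \<in> H" using H_mult bG by blast
    then show False using r bG by (simp add: m_assoc)
  qed
  moreover have "?v \<in> carrier G" using r bG by simp
  ultimately show ?thesis by blast
qed

text \<open>Take v of order p outside H and x with x^(p^(e-1)) = v. Every nontrivial subgroup of <x>
  contains v, so <x> meets H trivially and becomes a new factor of full order p^e.\<close>

lemma extend:
  assumes "H \<noteq> carrier G"
  shows "\<exists>\<psi>'. \<psi>' \<in> hom (homocyclic_model p e (Suc k)) G \<and>
    inj_on \<psi>' (carrier (homocyclic_model p e (Suc k))) \<and> H \<subset> \<psi>' ` carrier (homocyclic_model p e (Suc k))"
proof -
  obtain v where v: "v \<in> carrier G" "v [^] p = \<one>" "v \<notin> H" using p_torsion_outside_ex[OF assms] by blast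
  obtain x where x: "x \<in> carrier G" "x [^] (p ^ (e - 1)) = v" using roots[OF v(1,2)] by blast
  have v1: "v \<noteq> \<one>" using v H_one by blast
  have "e \<noteq> 0"
  proof
    assume "e = 0"
    then show False using exponent[OF v(1)] v v1 by simp
  qed
  then have ox: "ord x = p ^ Suc (e - 1)"
    using ord_eq_prime_power[OF p_prime x(1), of "e - 1"] exponent[OF x(1)] x v1 by simp
  have in_H: "x [^] c = \<one>" if c: "x [^] (c::int) \<in> H" for c
  proof (rule ccontr)
    assume ne: "x [^] c \<noteq> \<one>"
    define y where "y = x [^] c"
    have y: "y \<in> carrier G" "y \<in> H" "y \<noteq> \<one>" using x c ne by (auto simp: y_def)
    define i where "i = (LEAST i. y [^] (p ^ i) = \<one>)"
    have i: "y [^] (p ^ i) = \<one>" unfolding i_def by (rule LeastI) (rule exponent[OF y(1)])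
    have "i \<noteq> 0"
    proof
      assume "i = 0" then show False using i y by simp
    qed
    then obtain j where j: "i = Suc j" using not0_implies_Suc by blast
    have yj: "y [^] (p ^ j) \<noteq> \<one>"
      using not_less_Least[of j "\<lambda>i. y [^] (p ^ i) = \<one>"] j unfolding i_def by simp
    have yx: "y [^] (p ^ j) = x [^] (c * int (p ^ j))" unfolding y_def by (rule int_pow_nat_pow[OF x(1)])
    have "(y [^] (p ^ j)) [^] p = \<one>" using i y unfolding j by (simp add: nat_pow_pow mult.commute)
    then obtain l :: int where "v = (y [^] (p ^ j)) [^] l"
      using prime_order_power(2)[OF p_prime x(1) ox] yj x(2) unfolding yx by metis
    then show False using H_int_pow[OF H_pow[OF y(2)]] v by simp
  qed
  let ?M' = "homocyclic_model p e (Suc k)"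
  define \<psi>' where "\<psi>' f = \<psi> (f(k := 0)) \<otimes> x [^] (f k :: int)" for f
  have trunc: "f(k := 0) \<in> carrier M" if "f \<in> carrier ?M'" for f
    using that p_pos by (auto simp: carrier_homocyclic_model)
  have trunc_H: "\<psi> (f(k := 0)) \<in> H" "\<psi> (f(k := 0)) \<in> carrier G" if "f \<in> carrier ?M'" for f
    using trunc[OF that] H_closed by auto
  have "\<psi>' \<in> hom ?M' G"
  proof (rule homI)
    fix f assume f: "f \<in> carrier ?M'"
    show "\<psi>' f \<in> carrier G" using trunc_H[OF f] x by (simp add: \<psi>'_def)
  next
    fix f g assume f: "f \<in> carrier ?M'" and g: "g \<in> carrier ?M'"
    have 1: "(f \<otimes>\<^bsub>?M'\<^esub> g)(k := 0) = f(k := 0) \<otimes>\<^bsub>M\<^esub> g(k := 0)"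
      by (auto simp: mult_homocyclic_model fun_eq_iff)
    have "(f \<otimes>\<^bsub>?M'\<^esub> g) k = (f k + g k) mod int (p ^ e)" by (simp add: mult_homocyclic_model)
    moreover have "x [^] ((f k + g k) mod int (p ^ e)) = x [^] (f k + g k)"
      using \<open>e \<noteq> 0\<close> by (simp add: int_pow_eq[OF x(1)] ox mod_eq_dvd_iff[symmetric])
    ultimately have 2: "x [^] ((f \<otimes>\<^bsub>?M'\<^esub> g) k) = x [^] f k \<otimes> x [^] g k"
      using x by (simp add: int_pow_mult)
    show "\<psi>' (f \<otimes>\<^bsub>?M'\<^esub> g) = \<psi>' f \<otimes> \<psi>' g"
      unfolding \<psi>'_def 1 2 hom_mult'[OF trunc[OF f] trunc[OF g]]
      using trunc_H[OF f] trunc_H[OF g] x by (simp add: m_ac)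
  qed
  moreover have "inj_on \<psi>' (carrier ?M')"
  proof (rule inj_onI)
    fix f g assume f: "f \<in> carrier ?M'" and g: "g \<in> carrier ?M'" and eq: "\<psi>' f = \<psi>' g"
    let ?a = "\<psi> (f(k := 0))" and ?b = "\<psi> (g(k := 0))"
    have ab: "?a \<in> carrier G" "?b \<in> carrier G" "?a \<in> H" "?b \<in> H" using trunc_H f g by auto
    have "?a \<otimes> x [^] f k = ?b \<otimes> x [^] g k" using eq by (simp add: \<psi>'_def)
    then have "x [^] f k = inv ?a \<otimes> (?b \<otimes> x [^] g k)" using ab x by (subst inv_solve_left) auto
    then have "x [^] f k = (inv ?a \<otimes> ?b) \<otimes> x [^] g k" using ab x by (simp add: m_assoc)
    then have "x [^] f k \<otimes> inv (x [^] g k) = inv ?a \<otimes> ?b" using ab x by (subst inv_solve_right') auto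
    then have "x [^] (f k - g k) = inv ?a \<otimes> ?b" using x by (simp add: int_pow_diff)
    then have "x [^] (f k - g k) \<in> H" using H_mult[OF H_inv] ab by simp
    then have "x [^] (f k - g k) = \<one>" by (rule in_H)
    then have "int (p ^ e) dvd f k - g k" using int_pow_eq_id[OF x(1)] ox \<open>e \<noteq> 0\<close> by simp
    moreover have "0 \<le> f k" "f k < int (p ^ e)" "0 \<le> g k" "g k < int (p ^ e)"
      using f g p_pos by (simp_all add: carrier_homocyclic_model)
    then have "\<bar>f k - g k\<bar> < int (p ^ e)" by linarith
    ultimately have fg: "f k = g k" using dvd_imp_le_int[of "f k - g k" "int (p ^ e)"] by fastforce
    then have "?a = ?b" using \<open>?a \<otimes> x [^] f k = ?b \<otimes> x [^] g k\<close> ab x by simp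
    then have "f(k := 0) = g(k := 0)" using inj_onD[OF inj] trunc[OF f] trunc[OF g] by blast
    then show "f = g" using fg by (metis fun_upd_triv fun_upd_upd)
  qed
  moreover have "H \<subset> \<psi>' ` carrier ?M'"
  proof
    show "H \<subseteq> \<psi>' ` carrier ?M'"
    proof
      fix y assume "y \<in> H"
      then obtain f where f: "f \<in> carrier M" "y = \<psi> f" by blast
      then have fk: "f k = 0" by (simp add: carrier_M)
      then have "f(k := 0) = f" by auto
      then have "\<psi>' f = y" using f fk H_closed[of y] by (simp add: \<psi>'_def)
      moreover have "f \<in> carrier ?M'" using f fk p_pos by (auto simp: carrier_homocyclic_model less_Suc_eq)
      ultimately show "y \<in> \<psi>' ` carrier ?M'" by blast
    qed
    let ?d = "(\<lambda>i. 0)(k := 1 :: int)"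
    have "1 < int (p ^ e)" using one_less_power[OF prime_gt_1_nat[OF p_prime], of e] \<open>e \<noteq> 0\<close> by linarith
    then have d: "?d \<in> carrier ?M'" using p_pos by (auto simp: carrier_homocyclic_model)
    have "?d(k := 0) = (\<lambda>i. 0)" by auto
    then have "\<psi>' ?d = x" using x hom_zero by (simp add: \<psi>'_def int_pow_1)
    then have "x \<in> \<psi>' ` carrier ?M'" using d by blast
    moreover have "x \<notin> H" using H_pow[of x] x v by blast
    ultimately show "H \<noteq> \<psi>' ` carrier ?M'" by blast
  qed
  ultimately show ?thesis by blast
qed

end

text \<open>Among all embedded powers of the cyclic group of order p^e, starting from the trivial
  one, an embedding with the largest image cannot be extended, so its image is the whole
  group.\<close>

theorem (in comm_group) homocyclic_if_roots:
  fixes p e :: nat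
  assumes p: "Factorial_Ring.prime p" and fin: "finite (carrier G)"
    and exponent: "\<And>x. x \<in> carrier G \<Longrightarrow> x [^] (p ^ e) = \<one>"
    and roots: "\<And>x. x \<in> carrier G \<Longrightarrow> x [^] p = \<one> \<Longrightarrow> \<exists>g \<in> carrier G. g [^] (p ^ (e - 1)) = x"
  shows "homocyclic p G"
proof -
  let ?emb = "\<lambda>k \<psi>. \<psi> \<in> hom (homocyclic_model p e k) G \<and> inj_on \<psi> (carrier (homocyclic_model p e k))"
  let ?size = "\<lambda>n. \<exists>k \<psi>. ?emb k \<psi> \<and> card (\<psi> ` carrier (homocyclic_model p e k)) = n"
  have "?emb 0 (\<lambda>_. \<one>)"
    by (auto simp: hom_def inj_on_def homocyclic_model_def)
  then have "\<exists>n. ?size n" by blast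
  moreover have bound: "n \<le> card (carrier G)" if n: "?size n" for n
  proof -
    obtain k \<psi> where "?emb k \<psi>" "card (\<psi> ` carrier (homocyclic_model p e k)) = n" using n by blast
    then show ?thesis using card_mono[OF fin, of "\<psi> ` carrier (homocyclic_model p e k)"] by (auto simp: hom_def)
  qed
  ultimately have "?size (GREATEST n. ?size n)"
    by (intro GreatestI_ex_nat[of ?size "card (carrier G)"]) auto
  then obtain k \<psi> where k: "?emb k \<psi>"
    and max: "card (\<psi> ` carrier (homocyclic_model p e k)) = (GREATEST n. ?size n)" by blast
  interpret homocyclic_embedding G p e k \<psi>
    by unfold_locales (use p fin exponent roots k in auto)
  have "\<psi> ` carrier (homocyclic_model p e k) = carrier G"
  proof (rule ccontr)
    assume "\<not> ?thesis"
    then obtain \<psi>' where \<psi>': "?emb (Suc k) \<psi>'"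
      "\<psi> ` carrier (homocyclic_model p e k) \<subset> \<psi>' ` carrier (homocyclic_model p e (Suc k))"
      using extend by blast
    have "\<psi>' ` carrier (homocyclic_model p e (Suc k)) \<subseteq> carrier G" using \<psi>'(1) by (auto simp: hom_def)
    then have "card (\<psi> ` carrier (homocyclic_model p e k)) < card (\<psi>' ` carrier (homocyclic_model p e (Suc k)))"
      using psubset_card_mono[OF _ \<psi>'(2)] finite_subset[OF _ fin] by blast
    moreover have "card (\<psi>' ` carrier (homocyclic_model p e (Suc k))) \<le> (GREATEST n. ?size n)"
      by (rule Greatest_le_nat[of ?size _ "card (carrier G)"]) (use \<psi>'(1) bound in blast)+
    ultimately show False using max by simp
  qed
  then have "\<psi> \<in> iso (homocyclic_model p e k) G" using k by (simp add: iso_def bij_betw_def)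
  then have "G \<cong> homocyclic_model p e k"
    by (rule is_iso_symI) (rule homocyclic_model_closed[OF p_pos])
  then show ?thesis unfolding homocyclic_def by blast
qed

text \<open>By \<open>cmt_small_iff\<close> one commutator [x,g] outside {1, x^2} yields such a
  commutator for every noncentral y, and then [y,G] is the whole center by
  \<open>cmt_full\<close>.\<close>

theorem (in exceptional_2_group) Q8_or_G64: "G \<cong> Q8 \<or> G \<cong> G64"
proof (cases "\<exists>x \<in> carrier G. \<exists>g \<in> carrier G. cmt x g \<noteq> \<one> \<and> cmt x g \<noteq> sq x")
  case True
  then obtain x g where x: "x \<in> carrier G" and g: "g \<in> carrier G" "cmt x g \<noteq> \<one>" "cmt x g \<noteq> sq x" by blast
  have "x \<notin> center G" using g by auto
  then have wit: "\<exists>g \<in> carrier G. cmt y g \<noteq> \<one> \<and> cmt y g \<noteq> sq y" if "y \<in> carrier G" "y \<notin> center G" for y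
    using cmt_small_iff[OF x _ that] g by blast
  interpret full_commutators G
  proof
    fix y z assume y: "y \<in> carrier G" "y \<notin> center G"
    show "z \<in> center G \<Longrightarrow> \<exists>g \<in> carrier G. cmt y g = z" using wit[OF y] cmt_full[OF y(1)] by blast
    show "\<exists>z \<in> center G. z \<noteq> \<one> \<and> z \<noteq> sq y" using wit[OF y] cmt_center[OF y(1)] by blast
  qed
  show ?thesis using iso_G64 by blast
next
  case False
  then interpret small_commutators G by unfold_locales blast
  show ?thesis using iso_Q8 by blast
qed

theorem theorem4p11:
  fixes G :: "('a, 'b) monoid_scheme" and p :: nat
  assumes "Factorial_Ring.prime p"
    and "finite_p_group p G"
    and "two_tuple_regular G"
  shows "homocyclic p G \<or> G \<cong> Q8 \<or> G \<cong> G64"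
proof -
  interpret regular_p_group G p
    using assms by (simp add: regular_p_group_def regular_p_group_axioms_def finite_p_group_def)
  obtain s where s: "\<And>x. x \<in> carrier G \<Longrightarrow> x \<in> center G \<longleftrightarrow> x [^]\<^bsub>G\<^esub> (p ^ s) = \<one>\<^bsub>G\<^esub>"
    using center_eq_torsion by blast
  obtain e y where e: "\<And>x. x \<in> carrier G \<Longrightarrow> x [^]\<^bsub>G\<^esub> (p ^ e) = \<one>\<^bsub>G\<^esub>"
    and y: "y \<in> carrier G" "ord y = p ^ e"
    using exponent_ex by blast
  show ?thesis
  proof (cases "center G = carrier G")
    case True
    interpret comm_group G
      by (rule group_comm_groupI) (use True centerD in blast)
    have "homocyclic p G"
    proof (rule homocyclic_if_roots[OF assms(1) fin e])
      fix x assume x: "x \<in> carrier G" "x [^]\<^bsub>G\<^esub> p = \<one>\<^bsub>G\<^esub>"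
      show "\<exists>g \<in> carrier G. g [^]\<^bsub>G\<^esub> (p ^ (e - 1)) = x"
      \<comment> \<open>For e = 0 the exponent e - 1 is truncated to 0, and the group is
        trivial.\<close>
      proof (cases "e = 0")
        case True
        then have "x = \<one>\<^bsub>G\<^esub>" using e[OF x(1)] x by simp
        then show ?thesis by (intro bexI[of _ "\<one>\<^bsub>G\<^esub>"]) auto
      next
        case False
        then show ?thesis using root_ex[OF y x(1), of 1] x by simp
      qed
    qed
    then show ?thesis by blast
  next
    case False
    obtain n where n: "card (carrier G) = p ^ n" using card_G by blast
    have "carrier G \<noteq> {\<one>\<^bsub>G\<^esub>}"
    proof
      assume triv: "carrier G = {\<one>\<^bsub>G\<^esub>}"
      have "center G \<subseteq> carrier G" using center_closed by blast
      then show False using False center_one unfolding triv by blast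
    qed
    then obtain c where c: "c \<in> center G" "c \<noteq> \<one>\<^bsub>G\<^esub>"
      using p_group_center_nontrivial[OF assms(1) fin n] by blast
    have "1 \<le> s"
    proof (rule ccontr)
      assume "\<not> 1 \<le> s"
      then have "s = 0" by simp
      then show False using s[of c] c center_closed[OF c(1)] by simp
    qed
    \<comment> \<open>With e \<le> s every element would be killed by p^s and hence be
      central.\<close>
    moreover have "s < e"
    proof (rule ccontr)
      assume "\<not> s < e"
      then have "p ^ e dvd p ^ s" by (simp add: le_imp_power_dvd)
      then obtain k where k: "p ^ s = p ^ e * k" by (auto simp: dvd_def)
      have "x \<in> center G" if "x \<in> carrier G" for x
        using s[OF that] e[OF that] nat_pow_pow[OF that, of "p ^ e" k] unfolding k by simp
      then show False using False center_closed by blast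
    qed
    ultimately interpret nonabelian_regular_p_group G p s e
      using s e y by unfold_locales blast+
    have pse: "p = 2" "s = 1" "e = 2" using exceptional_exponents by auto
    have "exceptional_2_group G"
      using nonabelian_regular_p_group_axioms unfolding pse exceptional_2_group_def .
    then show ?thesis using exceptional_2_group.Q8_or_G64 by blast
  qed
qed

end
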